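(* Let $\lambda=(\lambda_1,\dots,\lambda_n)\in\mathbb{R}^n$ be weakly decreasing and let $L$ be an $n\times n$ complex matrix with $\mathrm{i}L\in\mathcal{O}_\lambda$. (i) If $\lambda_1>\cdots>\lambda_n>0$, then $\mathrm{i}L\in\mathcal{O}_\lambda^{>0}$ if and only if $L$ is eventually totally positive, i.e., $L^m\in\mathrm{GL}_n^{>0}$ for some integer $m>0$. (ii) If $\lambda=\omega_k:=(1,\dots,1,0,\dots,0)$ ($k$ ones followed by $n-k$ zeros, $0\le k\le n$), then $\mathrm{i}L\in\mathcal{O}_\lambda^{>0}$ (respectively, $\mathrm{i}L\in\mathcal{O}_\lambda^{\ge 0}$) if and only if all $k\times k$ minors of $L$ are real and positive (respectively, real and nonnegative). (iii) If $\lambda$ is nonconstant and $L$ is tridiagonal, then $\mathrm{i}L\in\mathcal{O}_\lambda^{>0}$ (respectively, $\mathrm{i}L\in\mathcal{O}_\lambda^{\ge 0}$) if and only if $L$ is real and its entries immediately above and below the diagonal are positive (respectively, nonnegative).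
   Context: Here $\mathrm{i}=\sqrt{-1}$. $\mathrm{GL}_n^{>0}$ is the set of real $n\times n$ matrices all of whose minors (of all sizes) are positive. $\mathrm{U}_n$ is the group of unitary $n\times n$ matrices and $\mathfrak{u}_n$ the space of skew-Hermitian $n\times n$ matrices. Every $g\in\mathrm{GL}_n(\mathbb{C})$ factors uniquely as $g=g_1g_2g_3$ with $g_1\in\mathrm{U}_n$, $g_2$ diagonal with positive diagonal entries, and $g_3$ upper-triangular unipotent (Iwasawa/QR decomposition); put $\pi_{\mathrm{U}}(g)=g_1$. $\mathrm{U}_n^{>0}:=\pi_{\mathrm{U}}(\mathrm{GL}_n^{>0})$ and $\mathrm{U}_n^{\ge 0}$ is its closure in $\mathrm{U}_n$. (Equivalently, $\mathrm{U}_n^{>0}$, resp. $\mathrm{U}_n^{\ge 0}$, consists of the $g\in\mathrm{U}_n$ all of whose left-justified minors, i.e. minors with row set $I$ and column set $\{1,\dots,|I|\}$, are real and positive, resp. nonnegative.) For weakly decreasing $\lambda\in\mathbb{R}^n$, the adjoint orbit is $\mathcal{O}_\lambda=\{g(\mathrm{i}\,\mathrm{Diag}(\lambda))g^{-1}:g\in\mathrm{U}_n\}\subseteq\mathfrak{u}_n$, its totally positive part is $\mathcal{O}_\lambda^{>0}=\{g(\mathrm{i}\,\mathrm{Diag}(\lambda))g^{-1}:g\in\mathrm{U}_n^{>0}\}$, and its totally nonnegative part is the closure $\mathcal{O}_\lambda^{\ge 0}=\overline{\mathcal{O}_\lambda^{>0}}=\{g(\mathrm{i}\,\mathrm{Diag}(\lambda))g^{-1}:g\in\mathrm{U}_n^{\ge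 0}\}$. *)

theory Defs
  imports
    "HOL-Analysis.Function_Topology"
    "Jordan_Normal_Form.Matrix"
    "Jordan_Normal_Form.Determinant"
    "Jordan_Normal_Form.DL_Submatrix"
    "Jordan_Normal_Form.Schur_Decomposition"
begin

text \<open>Indices run from \<open>0\<close> to \<open>n - 1\<close>.\<close>

definition minor :: "'a::comm_ring_1 mat \<Rightarrow> nat set \<Rightarrow> nat set \<Rightarrow> 'a" where
  "minor A I J = det (submatrix A I J)"

text \<open>The empty minor is included in the condition below, but it equals 1.\<close>

definition GL_pos :: "nat \<Rightarrow> real mat set" where
  "GL_pos n = {A \<in> carrier_mat n n.
     \<forall>I J. I \<subseteq> {..<n} \<longrightarrow> J \<subseteq> {..<n} \<longrightarrow> card I = card J \<longrightarrow> 0 < minor A I J}"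

definition GL_pos_complex :: "nat \<Rightarrow> complex mat set" where
  "GL_pos_complex n = map_mat complex_of_real ` GL_pos n"

definition unitary_group :: "nat \<Rightarrow> complex mat set" where
  "unitary_group n = {g \<in> carrier_mat n n. mat_adjoint g * g = 1\<^sub>m n}"

lemma unitary_group_inverse:
  assumes "g \<in> unitary_group n"
  shows "mat_adjoint g \<in> carrier_mat n n"
    and "inverts_mat g (mat_adjoint g)" and "inverts_mat (mat_adjoint g) g"
proof -
  have g: "g \<in> carrier_mat n n" and e: "mat_adjoint g * g = 1\<^sub>m n"
    using assms by (auto simp: unitary_group_def)
  show a: "mat_adjoint g \<in> carrier_mat n n"
    using g by (auto simp: mat_adjoint_def)
  show "inverts_mat (mat_adjoint g) g"
    using e a by (auto simp: inverts_mat_def)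
  show "inverts_mat g (mat_adjoint g)"
    using mat_mult_left_right_inverse[OF a g e] g by (auto simp: inverts_mat_def)
qed

definition iwasawa :: "complex mat \<Rightarrow> complex mat \<Rightarrow> complex mat \<Rightarrow> complex mat \<Rightarrow> bool" where
  "iwasawa g g1 g2 g3 \<longleftrightarrow>
     g1 \<in> unitary_group (dim_row g) \<and>
     (\<exists>d. (\<forall>i<dim_row g. 0 < d i) \<and> g2 = mat_diag (dim_row g) (\<lambda>i. complex_of_real (d i))) \<and>
     g3 \<in> carrier_mat (dim_row g) (dim_row g) \<and> upper_triangular g3 \<and>
     (\<forall>i<dim_row g. g3 $$ (i, i) = 1) \<and>
     g = g1 * g2 * g3"

text \<open>The factorisation exists and is unique for every invertible \<open>g\<close>; \<open>pi_U\<close> is unspecified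
  on other matrices.\<close>

definition pi_U :: "complex mat \<Rightarrow> complex mat" where
  "pi_U g = (THE g1. \<exists>g2 g3. iwasawa g g1 g2 g3)"

definition U_pos :: "nat \<Rightarrow> complex mat set" where
  "U_pos n = pi_U ` GL_pos_complex n"

text \<open>For unitary \<open>g\<close> the adjoint is the inverse, see \<open>unitary_group_inverse\<close>.\<close>

definition conj_diag :: "nat \<Rightarrow> real vec \<Rightarrow> complex mat \<Rightarrow> complex mat" where
  "conj_diag n lam g =
     g * (\<i> \<cdot>\<^sub>m mat_diag n (\<lambda>i. complex_of_real (lam $ i))) * mat_adjoint g"

definition orbit :: "nat \<Rightarrow> real vec \<Rightarrow> complex mat set" where
  "orbit n lam = conj_diag n lam ` unitary_group n"

definition orbit_pos :: "nat \<Rightarrow> real vec \<Rightarrow> complex mat set" where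
  "orbit_pos n lam = conj_diag n lam ` U_pos n"

text \<open>Matrices of the type \<open>complex mat\<close> carry no topology in the library. This is the usual
  topology on complex \<open>n \<times> n\<close> matrices, as the product of \<open>n\<^sup>2\<close> copies of the complex plane.\<close>

definition mat_topology :: "nat \<Rightarrow> complex mat topology" where
  "mat_topology n =
     pullback_topology (carrier_mat n n)
       (\<lambda>A. restrict (\<lambda>ij. A $$ ij) ({..<n} \<times> {..<n}))
       (product_topology (\<lambda>_. euclidean) ({..<n} \<times> {..<n}))"

text \<open>\<open>orbit n lam\<close> is compact, so it does not matter whether the closure is taken in the orbit,
  in the skew-Hermitian matrices or in all matrices.\<close>

definition orbit_nonneg :: "nat \<Rightarrow> real vec \<Rightarrow> complex mat set" where
  "orbit_nonneg n lam = mat_topology n closure_of orbit_pos n lam"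

definition omega :: "nat \<Rightarrow> nat \<Rightarrow> real vec" where
  "omega n k = vec n (\<lambda>i. if i < k then 1 else 0)"

definition tridiagonal :: "'a::zero mat \<Rightarrow> bool" where
  "tridiagonal A \<longleftrightarrow>
     (\<forall>i<dim_row A. \<forall>j<dim_col A. i + 1 < j \<or> j + 1 < i \<longrightarrow> A $$ (i, j) = 0)"

end

theory Submission
  imports Defs
begin

text \<open>Everything is read off from the left-justified minors of a unitary \<open>g\<close>. By the Cauchy--Binet
  formula the minors of \<open>g diag(\<mu>) g\<^sup>*\<close> are sums of products of minors of \<open>g\<close> weighted by products of
  the \<open>\<mu>\<close>, so its \<open>k\<close>-th compound matrix has the left-justified minors of order \<open>k\<close> as a top
  eigenvector.

  For (i), a high power is dominated by this eigenvector; conversely a positive compound matrix has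
  an eigenvector of constant phase (Perron--Frobenius), and the phases are absorbed by rescaling the
  columns of \<open>g\<close>.

  For (ii), the \<open>k \<times> k\<close> minors of the projection are products of Pluecker coordinates, and a subspace
  with positive Pluecker coordinates is completed to a totally positive flag with the help of a
  totally positive matrix close to the identity. The nonnegative case follows by applying such
  matrices and compactness.

  For (iii), \<open>1 + q L\<close> is totally nonnegative for small \<open>q\<close> and its \<open>n\<close>-th power is totally positive
  when the off-diagonal entries are positive, which reduces to (i). Conversely, after a diagonal
  change of phases the Perron--Frobenius comparison forces the off-diagonal entries to be
  nonnegative, and strictness in the Ky Fan inequality excludes zeros.\<close>

section \<open>Minors and the Cauchy--Binet formula\<close>

text \<open>The totally positive part is defined through \<open>pi_U\<close>, hence through positive
  matrices modulo an upper triangular factor, whereas a point of the orbit determines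
  \<open>g\<close> only up to a unitary change of basis in each eigenspace. So a good
  \<open>g\<close> has to be found among many. Two facts make this possible. By
  \<open>U_pos_iff\<close>, membership in \<open>U_pos\<close> is a condition on the left-justified
  minors, so it concerns only the flag spanned by the leading columns and their phases. And
  \<open>udiag n g\<close> is a functional calculus: powers and shifts of \<open>L\<close> share its
  eigenvectors, so total positivity of one function of \<open>L\<close> with nonnegative, equally
  ordered eigenvalues already settles the question for \<open>L\<close> itself. In (ii) just one
  subspace of the flag is prescribed and the rest must be built. The totally positive matrices
  needed along the way come from the kernel \<open>q ^ sq_dist i j\<close>: as \<open>q\<close>
  tends to 0, each of its minors has a single term of lowest order. The tridiagonal shift
  \<open>1 + q L\<close> fits the same pattern, because its entries occur only at squared distances
  0 and 1.\<close>

definition ksub :: "nat \<Rightarrow> nat \<Rightarrow> nat set set" where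
  "ksub n k = {K. K \<subseteq> {..<n} \<and> card K = k}"

text \<open>Determinants of functions instead of matrices: choosing rows and columns becomes
  substitution of index functions, with no dimension side conditions.\<close>

definition fdet :: "nat \<Rightarrow> (nat \<Rightarrow> nat \<Rightarrow> 'a::comm_ring_1) \<Rightarrow> 'a" where
  "fdet k h = det (mat k k (\<lambda>(a, b). h a b))"

text \<open>The same data as a set in \<open>ksub n k\<close>, given by its increasing enumeration.
  Index sets obtained by moving or replacing single indices are easier to describe this way;
  \<open>incr_image\<close> and \<open>incr_eq_pick\<close> translate.\<close>

definition incr :: "nat \<Rightarrow> nat \<Rightarrow> (nat \<Rightarrow> nat) \<Rightarrow> bool" where
  "incr k n r \<longleftrightarrow> strict_mono_on {..<k} r \<and> r ` {..<k} \<subseteq> {..<n}"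

lemma finite_ksub [simp]: "finite (ksub n k)"
  by (rule finite_subset[of _ "Pow {..<n}"]) (auto simp: ksub_def)

lemma ksubD:
  assumes "K \<in> ksub n k"
  shows "K \<subseteq> {..<n}" "card K = k" "finite K"
  using assms finite_subset[of K "{..<n}"] by (auto simp: ksub_def)

lemma lessThan_ksub: "k \<le> n \<Longrightarrow> {..<k} \<in> ksub n k"
  by (auto simp: ksub_def)

lemma ksub_empty: "n < k \<Longrightarrow> ksub n k = {}"
proof -
  assume "n < k"
  have "card K \<le> n" if "K \<subseteq> {..<n}" for K
    using card_mono[OF finite_lessThan that] by simp
  then have "\<not> (K \<subseteq> {..<n} \<and> card K = k)" for K
    using \<open>n < k\<close> by (metis not_less)
  then show ?thesis by (simp add: ksub_def)
qed

lemma pick_in_ksub: "K \<in> ksub n k \<Longrightarrow> a < k \<Longrightarrow> pick K a \<in> K"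
  using pick_in_set_le[of a K] ksubD by auto

lemma pick_less: "K \<in> ksub n k \<Longrightarrow> a < k \<Longrightarrow> pick K a < n"
  using pick_in_ksub[of K n k a] ksubD[of K n k] by auto

lemma incr_pick: "K \<in> ksub n k \<Longrightarrow> incr k n (pick K)"
  unfolding incr_def strict_mono_on_def
  using pick_mono_le[of _ K] pick_less[of K n k] ksubD(2)[of K n k] by auto

lemma incr_less: "incr k n r \<Longrightarrow> a < k \<Longrightarrow> r a < n"
  by (auto simp: incr_def)

lemma incr_mono: "incr k n r \<Longrightarrow> a < b \<Longrightarrow> b < k \<Longrightarrow> r a < r b"
  by (auto simp: incr_def strict_mono_on_def)

lemma incr_mono_le: "incr k n r \<Longrightarrow> a \<le> b \<Longrightarrow> b < k \<Longrightarrow> r a \<le> r b"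
  using incr_mono[of k n r a b] by (cases "a = b") auto

lemma incr_inj: "incr k n r \<Longrightarrow> inj_on r {..<k}"
  by (auto simp: incr_def intro: strict_mono_on_imp_inj_on)

lemma incr_image: "incr k n r \<Longrightarrow> r ` {..<k} \<in> ksub n k"
  using incr_inj[of k n r] by (auto simp: incr_def ksub_def card_image)

lemma incr_id: "k \<le> n \<Longrightarrow> incr k n (\<lambda>a. a)"
  by (auto simp: incr_def strict_mono_on_def)

text \<open>Exactly \<open>a\<close> elements of the image, namely those enumerated before, lie
  below \<open>r a\<close>.\<close>

lemma incr_eq_pick:
  assumes "incr k n r" "a < k"
  shows "r a = pick (r ` {..<k}) a"
proof -
  have "r a = pick (r ` {..<k}) (card {x \<in> r ` {..<k}. x < r a})"
    using pick_card_in_set[of "r a" "r ` {..<k}"] assms by auto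
  moreover have "{x \<in> r ` {..<k}. x < r a} = r ` {..<a}"
  proof -
    have "r b < r a \<longleftrightarrow> b < a" if "b < k" for b
      using assms that incr_mono[of k n r a b] incr_mono[of k n r b a]
      by (cases "b = a") (auto simp: not_less_iff_gr_or_eq dest: less_asym linorder_neqE_nat)
    then show ?thesis using assms by auto
  qed
  moreover have "card (r ` {..<a}) = a"
    using incr_inj[OF assms(1)] assms(2) by (subst card_image) (auto intro: inj_on_subset)
  ultimately show ?thesis by simp
qed

lemma pick_lessThan: "a < k \<Longrightarrow> pick {..<k} a = a"
  using incr_eq_pick[OF incr_id[of k k], of a] by simp

lemma pick_image_ksub: "K \<in> ksub n k \<Longrightarrow> pick K ` {..<k} = K"
proof -
  assume K: "K \<in> ksub n k"
  have "pick K ` {..<k} \<subseteq> K" using pick_in_ksub[OF K] by auto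
  moreover have "card (pick K ` {..<k}) = card K"
    using incr_inj[OF incr_pick[OF K]] ksubD[OF K] by (simp add: card_image)
  ultimately show ?thesis using ksubD[OF K] card_subset_eq by blast
qed

section \<open>Determinants indexed by functions\<close>

lemma fdet_cong: "(\<And>a b. a < k \<Longrightarrow> b < k \<Longrightarrow> h a b = h' a b) \<Longrightarrow> fdet k h = fdet k h'"
  unfolding fdet_def by (intro arg_cong[of _ _ det]) auto

lemma incr_minor_pick:
  assumes "incr k n r" "incr k p c"
  shows "fdet k (\<lambda>a b. h (r a) (c b)) = fdet k (\<lambda>a b. h (pick (r ` {..<k}) a) (pick (c ` {..<k}) b))"
  by (rule fdet_cong) (use assms incr_eq_pick in metis)

lemma fdet_expand: "fdet k h = (\<Sum>p | p permutes {..<k}. of_int (sign p) * (\<Prod>a<k. h a (p a)))"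
proof -
  have "fdet k h = (\<Sum>p | p permutes {0..<k}. signof p * (\<Prod>i = 0..<k. mat k k (\<lambda>(a, b). h a b) $$ (i, p i)))"
    unfolding fdet_def by (subst det_def') auto
  also have "\<dots> = (\<Sum>p | p permutes {0..<k}. of_int (sign p) * (\<Prod>a = 0..<k. h a (p a)))"
    by (intro sum.cong refl arg_cong2[where f="(*)"] prod.cong)
       (auto simp: permutes_in_image dest: permutes_in_image)
  finally show ?thesis by (simp add: atLeast0LessThan)
qed

lemma fdet_0 [simp]: "fdet 0 h = 1"
  by (simp add: fdet_def)

lemma fdet_transpose: "fdet k (\<lambda>a b. h b a) = fdet k h"
proof -
  have "mat k k (\<lambda>(a, b). h b a) = transpose_mat (mat k k (\<lambda>(a, b). h a b))" by auto
  then show ?thesis unfolding fdet_def by (metis det_transpose mat_carrier)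
qed

lemma fdet_scale_cols: "fdet k (\<lambda>a b. h a b * d b) = fdet k h * (\<Prod>b<k. d b)"
proof -
  have "(\<Prod>a<k. d (p a)) = (\<Prod>b<k. d b)" if "p permutes {..<k}" for p
    using prod.permute[OF that, of d] by (simp add: o_def)
  then show ?thesis
    by (auto simp: fdet_expand sum_distrib_right prod.distrib mult.assoc intro!: sum.cong)
qed

lemma fdet_scale_rows: "fdet k (\<lambda>a b. d a * h a b) = (\<Prod>b<k. d b) * fdet k h"
  by (simp add: fdet_expand sum_distrib_left prod.distrib mult.left_commute mult.commute)

lemma fdet_permute_rows:
  assumes "p permutes {..<k}"
  shows "fdet k (\<lambda>a b. h (p a) b) = of_int (sign p) * fdet k h"
proof -
  have "mat k k (\<lambda>(i, j). mat k k (\<lambda>(a, b). h a b) $$ (p i, j)) = mat k k (\<lambda>(a, b). h (p a) b)"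
    using permutes_in_image[OF assms] by (intro eq_matI) auto
  then show ?thesis
    using det_permute_rows[of "mat k k (\<lambda>(a, b). h a b)" k p] assms
    by (simp add: fdet_def atLeast0LessThan)
qed

lemma fdet_identical_rows:
  assumes "a < k" "b < k" "a \<noteq> b" "\<And>c. c < k \<Longrightarrow> h a c = h b c"
  shows "fdet k h = 0"
  unfolding fdet_def using assms
  by (intro det_identical_rows[of _ k a b]) auto

lemma fdet_zero_row:
  assumes "i < k" "\<And>b. b < k \<Longrightarrow> h i b = 0"
  shows "fdet k h = 0"
proof -
  have "(\<Prod>a<k. h a (p a)) = 0" if "p permutes {..<k}" for p
    using assms permutes_in_image[OF that, of i] by (intro prod_zero) auto
  then show ?thesis unfolding fdet_expand by (intro sum.neutral) auto
qed

lemma fdet_hom: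
  assumes "comm_ring_hom f"
  shows "f (fdet k h) = fdet k (\<lambda>a b. f (h a b))"
proof -
  interpret comm_ring_hom f by fact
  have "map_mat f (mat k k (\<lambda>(a, b). h a b)) = mat k k (\<lambda>(a, b). f (h a b))" by auto
  then show ?thesis unfolding fdet_def hom_det[symmetric] by simp
qed

lemma fdet_cnj: "cnj (fdet k h) = fdet k (\<lambda>a b. cnj (h a b))"
  by (rule fdet_hom) (unfold_locales, auto)

lemma fdet_of_real: "complex_of_real (fdet k h) = fdet k (\<lambda>a b. complex_of_real (h a b))"
  by (rule fdet_hom) (unfold_locales, auto)

lemma fdet_lower_triangular:
  assumes "\<And>a b. a < b \<Longrightarrow> b < k \<Longrightarrow> h a b = 0"
  shows "fdet k h = (\<Prod>a<k. h a a)"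
proof -
  have "fdet k h = prod_list (diag_mat (mat k k (\<lambda>(a, b). h a b)))"
    unfolding fdet_def using assms by (intro det_lower_triangular[of k]) auto
  then show ?thesis by (simp add: prod_list_diag_prod atLeast0LessThan)
qed

lemma fdet_upper_triangular:
  assumes "\<And>a b. b < a \<Longrightarrow> a < k \<Longrightarrow> h a b = 0"
  shows "fdet k h = (\<Prod>a<k. h a a)"
  using fdet_lower_triangular[of k "\<lambda>a b. h b a"] assms fdet_transpose[of k h] by simp

lemma fdet_laplace_last_col:
  "fdet (Suc k) h = (\<Sum>i\<le>k. h i k * (-1) ^ (i + k) * fdet k (\<lambda>a b. h (if a < i then a else Suc a) b))"
proof -
  let ?M = "mat (Suc k) (Suc k) (\<lambda>(a, b). h a b)"
  have "fdet (Suc k) h = (\<Sum>i<Suc k. ?M $$ (i, k) * cofactor ?M i k)"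
    unfolding fdet_def by (rule laplace_expansion_column) auto
  also have "\<dots> = (\<Sum>i<Suc k. h i k * (-1) ^ (i + k) * fdet k (\<lambda>a b. h (if a < i then a else Suc a) b))"
  proof (rule sum.cong[OF refl])
    fix i assume i: "i \<in> {..<Suc k}"
    have "mat_delete ?M i k = mat k k (\<lambda>(a, b). h (if a < i then a else Suc a) b)"
      unfolding mat_delete_def by (intro eq_matI) auto
    then show "?M $$ (i, k) * cofactor ?M i k
      = h i k * (-1) ^ (i + k) * fdet k (\<lambda>a b. h (if a < i then a else Suc a) b)"
      using i by (simp add: cofactor_def fdet_def mult.assoc)
  qed
  finally show ?thesis by (simp only: lessThan_Suc_atMost)
qed

text \<open>Expand each row of the product multilinearly; an injective choice of indices is a
  \<open>k\<close>-subset together with a permutation.\<close>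

lemma Cauchy_Binet:
  fixes A B :: "nat \<Rightarrow> nat \<Rightarrow> 'a::comm_ring_1"
  shows "fdet k (\<lambda>a b. \<Sum>l<n. A a l * B l b)
    = (\<Sum>K\<in>ksub n k. fdet k (\<lambda>a b. A a (pick K b)) * fdet k (\<lambda>a b. B (pick K a) b))"
proof -
  define F where "F = {..<k} \<rightarrow>\<^sub>E {..<n}"
  define G where "G = {f \<in> F. inj_on f {..<k}}"
  have finF: "finite F" unfolding F_def by (intro finite_PiE) auto
  have "fdet k (\<lambda>a b. \<Sum>l<n. A a l * B l b) =
      (\<Sum>p | p permutes {..<k}. of_int (sign p) * (\<Sum>f\<in>F. \<Prod>a<k. A a (f a) * B (f a) (p a)))"
    unfolding fdet_expand F_def
    by (intro sum.cong refl arg_cong2[where f="(*)"] prod_sum_PiE) auto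
  also have "\<dots> = (\<Sum>f\<in>F. \<Sum>p | p permutes {..<k}. of_int (sign p) * (\<Prod>a<k. A a (f a) * B (f a) (p a)))"
    unfolding sum_distrib_left by (rule sum.swap)
  also have "\<dots> = (\<Sum>f\<in>F. (\<Prod>a<k. A a (f a)) * fdet k (\<lambda>a b. B (f a) b))"
    unfolding fdet_expand sum_distrib_left prod.distrib
    by (intro sum.cong refl) (simp only: mult.left_commute)
  also have "\<dots> = (\<Sum>f\<in>G. (\<Prod>a<k. A a (f a)) * fdet k (\<lambda>a b. B (f a) b))"
  proof (rule sum.mono_neutral_right[OF finF])
    show "\<forall>f\<in>F - G. (\<Prod>a<k. A a (f a)) * fdet k (\<lambda>a b. B (f a) b) = 0"
    proof
      fix f assume "f \<in> F - G"
      then obtain a b where "a < k" "b < k" "a \<noteq> b" "f a = f b" by (auto simp: G_def inj_on_def)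
      then have "fdet k (\<lambda>a b. B (f a) b) = 0" by (intro fdet_identical_rows[of a k b]) auto
      then show "(\<Prod>a<k. A a (f a)) * fdet k (\<lambda>a b. B (f a) b) = 0" by simp
    qed
  qed (auto simp: G_def)
  also have "\<dots> = (\<Sum>K\<in>ksub n k. \<Sum>f | f \<in> G \<and> f ` {..<k} = K. (\<Prod>a<k. A a (f a)) * fdet k (\<lambda>a b. B (f a) b))"
  proof -
    have "(\<lambda>f. f ` {..<k}) ` G \<subseteq> ksub n k"
    proof (rule image_subsetI)
      fix f assume "f \<in> G"
      then have "f ` {..<k} \<subseteq> {..<n}" "inj_on f {..<k}" by (auto simp: G_def F_def)
      then show "f ` {..<k} \<in> ksub n k" by (simp add: ksub_def card_image)
    qed
    moreover have "finite G" using finF by (simp add: G_def)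
    ultimately show ?thesis
      using sum.group[of G "ksub n k" "\<lambda>f. f ` {..<k}" "\<lambda>f. (\<Prod>a<k. A a (f a)) * fdet k (\<lambda>a b. B (f a) b)"]
      by simp
  qed
  also have "\<dots> = (\<Sum>K\<in>ksub n k. fdet k (\<lambda>a b. A a (pick K b)) * fdet k (\<lambda>a b. B (pick K a) b))"
  proof (rule sum.cong[OF refl])
    fix K assume K: "K \<in> ksub n k"
    let ?\<phi> = "\<lambda>p. restrict (\<lambda>a. pick K (p a)) {..<k}"
    have inj: "inj_on (pick K) {..<k}" using incr_inj[OF incr_pick[OF K]] .
    have "bij_betw ?\<phi> {p. p permutes {..<k}} {f \<in> G. f ` {..<k} = K}"
      unfolding bij_betw_def
    proof
      show "inj_on ?\<phi> {p. p permutes {..<k}}"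
      proof (rule inj_onI, rule ext)
        fix p q a assume p: "p \<in> {p. p permutes {..<k}}" "q \<in> {p. p permutes {..<k}}" "?\<phi> p = ?\<phi> q"
        show "p a = q a"
        proof (cases "a < k")
          case True
          then have "pick K (p a) = pick K (q a)" using fun_cong[OF p(3), of a] by auto
          moreover have "p a < k" "q a < k" using p True permutes_in_image by fastforce+
          ultimately show ?thesis using inj by (auto simp: inj_on_def)
        next
          case False
          then show ?thesis using p by (auto simp: permutes_def)
        qed
      qed
      show "?\<phi> ` {p. p permutes {..<k}} = {f \<in> G. f ` {..<k} = K}"
      proof
        show "?\<phi> ` {p. p permutes {..<k}} \<subseteq> {f \<in> G. f ` {..<k} = K}"
        proof
          fix f assume "f \<in> ?\<phi> ` {p. p permutes {..<k}}"
          then obtain p where p: "p permutes {..<k}" and f: "f = ?\<phi> p" by auto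
          have img: "p ` {..<k} = {..<k}" using p by (rule permutes_image)
          have pk: "p a < k" if "a < k" for a using permutes_in_image[OF p, of a] that by simp
          have "f ` {..<k} = pick K ` (p ` {..<k})" unfolding f by (simp add: image_image)
          then have "f ` {..<k} = K" using img pick_image_ksub[OF K] by simp
          moreover have "inj_on f {..<k}"
          proof -
            have "inj_on (pick K \<circ> p) {..<k}"
              by (rule comp_inj_on) (simp_all add: inj img permutes_inj_on[OF p])
            then show ?thesis using inj_on_cong[of "{..<k}" f "pick K \<circ> p"] by (simp add: f)
          qed
          moreover have "f \<in> F"
            unfolding F_def f by (intro restrict_PiE_iff[THEN iffD2] ballI) (simp add: pick_less[OF K] pk)
          ultimately show "f \<in> {f \<in> G. f ` {..<k} = K}" by (auto simp: G_def)
        qed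
        show "{f \<in> G. f ` {..<k} = K} \<subseteq> ?\<phi> ` {p. p permutes {..<k}}"
        proof
          fix f assume "f \<in> {f \<in> G. f ` {..<k} = K}"
          then have f: "f \<in> F" "inj_on f {..<k}" "f ` {..<k} = K" by (auto simp: G_def)
          define p where "p a = (if a < k then inv_into {..<k} (pick K) (f a) else a)" for a
          have fK: "f a \<in> pick K ` {..<k}" if "a < k" for a
            using f(3) that pick_image_ksub[OF K] by auto
          have pk: "pick K (p a) = f a" "p a < k" if "a < k" for a
            using f_inv_into_f[OF fK[OF that]] inv_into_into[OF fK[OF that]] that by (auto simp: p_def)
          have "inj_on p {..<k}" using pk f(2) by (metis inj_on_def lessThan_iff)
          moreover have "p ` {..<k} \<subseteq> {..<k}" using pk(2) by blast
          ultimately have "bij_betw p {..<k} {..<k}"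
            using endo_inj_surj[of "{..<k}" p] by (simp add: bij_betw_def)
          then have "p permutes {..<k}" by (rule bij_imp_permutes) (simp add: p_def)
          moreover have "?\<phi> p = f"
          proof (rule ext)
            fix a
            show "?\<phi> p a = f a"
              using pk(1)[of a] PiE_arb[OF f(1)[unfolded F_def], of a] by (cases "a < k") simp_all
          qed
          ultimately show "f \<in> ?\<phi> ` {p. p permutes {..<k}}" by blast
        qed
      qed
    qed
    then have "(\<Sum>f | f \<in> G \<and> f ` {..<k} = K. (\<Prod>a<k. A a (f a)) * fdet k (\<lambda>a b. B (f a) b))
        = (\<Sum>p | p permutes {..<k}. (\<Prod>a<k. A a (?\<phi> p a)) * fdet k (\<lambda>a b. B (?\<phi> p a) b))"
      by (rule sum.reindex_bij_betw[symmetric])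
    also have "\<dots> = (\<Sum>p | p permutes {..<k}. (\<Prod>a<k. A a (pick K (p a))) * fdet k (\<lambda>a b. B (pick K (p a)) b))"
      by (intro sum.cong refl arg_cong2[where f="(*)"] prod.cong fdet_cong) auto
    also have "\<dots> = (\<Sum>p | p permutes {..<k}. (\<Prod>a<k. A a (pick K (p a))) * (of_int (sign p) * fdet k (\<lambda>a b. B (pick K a) b)))"
      by (intro sum.cong refl arg_cong2[where f="(*)"] fdet_permute_rows[of _ k "\<lambda>a b. B (pick K a) b"]) auto
    also have "\<dots> = fdet k (\<lambda>a b. A a (pick K b)) * fdet k (\<lambda>a b. B (pick K a) b)"
      unfolding fdet_expand[of k "\<lambda>a b. A a (pick K b)"] sum_distrib_right
      by (intro sum.cong refl) (simp only: mult_ac)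
    finally show "(\<Sum>f | f \<in> G \<and> f ` {..<k} = K. (\<Prod>a<k. A a (f a)) * fdet k (\<lambda>a b. B (f a) b))
      = fdet k (\<lambda>a b. A a (pick K b)) * fdet k (\<lambda>a b. B (pick K a) b)" .
  qed
  finally show ?thesis .
qed

lemma minor_eq_fdet:
  assumes "A \<in> carrier_mat m n" "I \<in> ksub m k" "J \<in> ksub n k"
  shows "minor A I J = fdet k (\<lambda>a b. A $$ (pick I a, pick J b))"
proof -
  have "{i. i < m \<and> i \<in> I} = I" "{j. j < n \<and> j \<in> J} = J" using assms(2,3) by (auto simp: ksub_def)
  then show ?thesis using assms by (simp add: minor_def submatrix_def fdet_def ksub_def)
qed

section \<open>Dominant terms of minors\<close>

lemma incr_ge: "incr k n r \<Longrightarrow> a < k \<Longrightarrow> a \<le> r a"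
proof (induction a)
  case (Suc a)
  then show ?case using incr_mono[of k n r a "Suc a"] by simp
qed simp

text \<open>Exponent of a discrete Gaussian kernel. Strict convexity of the square makes the
  order-preserving matching of two increasing sequences the unique cheapest one. The detour through
  \<open>int\<close> avoids truncated subtraction.\<close>

definition sq_dist :: "nat \<Rightarrow> nat \<Rightarrow> nat" where
  "sq_dist i j = nat ((int i - int j)\<^sup>2)"

lemma int_sq_dist: "int (sq_dist i j) = (int i - int j)\<^sup>2"
  by (simp add: sq_dist_def)

lemma sq_dist_eq_0 [simp]: "sq_dist i j = 0 \<longleftrightarrow> i = j"
  by (auto simp: sq_dist_def)

lemma sq_dist_self [simp]: "sq_dist i i = 0"
  by simp

lemma sq_dist_Suc [simp]: "sq_dist i (Suc i) = 1" "sq_dist (Suc i) i = 1"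
  by (auto simp: sq_dist_def)

text \<open>An increasing enumeration is determined by its image, and the image here is
  \<open>{..<k}\<close>.\<close>

lemma strict_mono_permutes_id:
  fixes p :: "nat \<Rightarrow> nat"
  assumes "p permutes {..<k}" "\<And>a b. a < b \<Longrightarrow> b < k \<Longrightarrow> p a < p b"
  shows "p = id"
proof
  fix a
  have i: "incr k k p" using assms permutes_image[OF assms(1)]
    by (auto simp: incr_def strict_mono_on_def)
  show "p a = id a"
  proof (cases "a < k")
    case True
    then show ?thesis using incr_eq_pick[OF i True] pick_lessThan permutes_image[OF assms(1)] by simp
  next
    case False
    then show ?thesis using assms(1) by (simp add: permutes_def)
  qed
qed

text \<open>Undoing an inversion strictly decreases the sum, so a minimising permutation has none.\<close>

lemma rearrangement_strict:
  assumes r: "incr k n r" and c: "incr k m c" and p: "p permutes {..<k}" "p \<noteq> id"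
  shows "(\<Sum>a<k. sq_dist (r a) (c a)) < (\<Sum>a<k. sq_dist (r a) (c (p a)))"
proof -
  define S where "S p = (\<Sum>a<k. sq_dist (r a) (c (p a)))" for p
  let ?P = "{p. p permutes {..<k}}"
  have fin: "finite ?P" by (rule finite_permutations) simp
  have min_id: "q = id" if q: "q permutes {..<k}" and min: "\<And>q'. q' permutes {..<k} \<Longrightarrow> S q \<le> S q'" for q
  proof (rule strict_mono_permutes_id[OF q], rule ccontr)
    fix a b assume ab: "a < b" "b < k" "\<not> q a < q b"
    have "q a \<noteq> q b" using ab permutes_inj[OF q] by (metis injD less_irrefl)
    then have qba: "q b < q a" using ab by simp
    define q' where "q' = q \<circ> Transposition.transpose a b"
    have q': "q' permutes {..<k}" unfolding q'_def
      by (intro permutes_compose[OF _ q] permutes_swap_id) (use ab in auto)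
    have "q a < k" "q b < k" using permutes_in_image[OF q, of a] permutes_in_image[OF q, of b] ab by auto
    then have cc: "int (c (q b)) < int (c (q a))" using incr_mono[OF c qba] by simp
    have rr: "int (r a) < int (r b)" using incr_mono[OF r ab(1,2)] by simp
    have split: "(\<Sum>x<k. f x) = (\<Sum>x\<in>{..<k} - {a, b}. f x) + (f a + f b)" for f :: "nat \<Rightarrow> int"
      using sum.subset_diff[of "{a, b}" "{..<k}" f] ab by simp
    have same: "(\<Sum>x\<in>{..<k} - {a, b}. int (sq_dist (r x) (c (q' x)))) = (\<Sum>x\<in>{..<k} - {a, b}. int (sq_dist (r x) (c (q x))))"
      by (intro sum.cong refl) (simp add: q'_def transpose_def)
    have "int (S q') - int (S q) = 2 * ((int (r a) - int (r b)) * (int (c (q a)) - int (c (q b))))"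
      unfolding S_def of_nat_sum split same
      by (simp add: q'_def int_sq_dist power2_eq_square algebra_simps)
    also have "\<dots> < 0" using cc rr by (simp add: mult_neg_pos)
    finally show False using min[OF q'] by simp
  qed
  obtain q where q: "q permutes {..<k}" "\<And>q'. q' permutes {..<k} \<Longrightarrow> S q \<le> S q'"
  proof -
    have "id \<in> ?P" by (simp add: permutes_id)
    then have "Min (S ` ?P) \<in> S ` ?P" using Min_in[of "S ` ?P"] fin by blast
    then obtain q where "q \<in> ?P" "S q = Min (S ` ?P)" by (metis imageE)
    then show ?thesis using Min_le[of "S ` ?P"] fin by (intro that[of q]) auto
  qed
  then have "q = id" by (rule min_id)
  then have le: "S id \<le> S q'" if "q' permutes {..<k}" for q' using q(2) that by simp
  have "S id \<noteq> S p"
  proof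
    assume "S id = S p"
    then have "p = id" by (intro min_id) (use p le in simp_all)
    then show False using p by simp
  qed
  then show ?thesis using le[OF p(1)] by (simp add: S_def)
qed

text \<open>By the rearrangement inequality the identity permutation alone contributes the lowest power
  of the small parameter.\<close>

lemma eventually_minor_pos:
  fixes Y :: "real \<Rightarrow> nat \<Rightarrow> nat \<Rightarrow> real"
  assumes r: "incr k n r" and c: "incr k m c"
    and lim: "\<And>a b. a < k \<Longrightarrow> b < k \<Longrightarrow> ((\<lambda>q. Y q (r a) (c b)) \<longlongrightarrow> Z (r a) (c b)) (at_right 0)"
    and pos: "\<And>a. a < k \<Longrightarrow> 0 < Z (r a) (c a)"
  shows "\<forall>\<^sub>F q in at_right 0. 0 < fdet k (\<lambda>a b. Y q (r a) (c b) * q ^ sq_dist (r a) (c b))"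
proof -
  let ?P = "{p. p permutes {..<k}}"
  define E where "E p = (\<Sum>a<k. sq_dist (r a) (c (p a)))" for p
  \<comment> \<open>The minor divided by its lowest power of \<open>q\<close>. The subtraction is
    never truncated, since \<open>E id\<close> is minimal; in the limit
    \<open>0 ^ (E p - E id)\<close> removes every term except \<open>p = id\<close>.\<close>
  define G where "G q = (\<Sum>p\<in>?P. of_int (sign p) * (\<Prod>a<k. Y q (r a) (c (p a))) * q ^ (E p - E id))" for q
  have E: "E id < E p" if "p \<in> ?P" "p \<noteq> id" for p
    using rearrangement_strict[OF r c] that by (simp add: E_def)
  have eq: "fdet k (\<lambda>a b. Y q (r a) (c b) * q ^ sq_dist (r a) (c b)) = q ^ E id * G q" for q
    unfolding fdet_expand G_def sum_distrib_left
  proof (rule sum.cong[OF refl])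
    fix p assume p: "p \<in> ?P"
    have "(\<Prod>a<k. q ^ sq_dist (r a) (c (p a))) = q ^ E p"
      by (simp add: E_def power_sum)
    also have "E p = E id + (E p - E id)" using E[OF p] by (cases "p = id") auto
    finally show "of_int (sign p) * (\<Prod>a<k. Y q (r a) (c (p a)) * q ^ sq_dist (r a) (c (p a))) =
      q ^ E id * (of_int (sign p) * (\<Prod>a<k. Y q (r a) (c (p a))) * q ^ (E p - E id))"
      by (simp add: prod.distrib power_add algebra_simps)
  qed
  have fin: "finite ?P" by (rule finite_permutations) simp
  have "(G \<longlongrightarrow> (\<Sum>p\<in>?P. if p = id then (\<Prod>a<k. Z (r a) (c a)) else 0)) (at_right 0)"
    unfolding G_def
  proof (rule tendsto_sum)
    fix p assume p: "p \<in> ?P"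
    have pl: "p a < k" if "a < k" for a using permutes_in_image[of p "{..<k}" a] p that by auto
    have t1: "((\<lambda>q. of_int (sign p) * (\<Prod>a<k. Y q (r a) (c (p a)))) \<longlongrightarrow>
        of_int (sign p) * (\<Prod>a<k. Z (r a) (c (p a)))) (at_right 0)"
      by (intro tendsto_intros lim pl) auto
    have t2: "((\<lambda>q::real. q ^ (E p - E id)) \<longlongrightarrow> 0 ^ (E p - E id)) (at_right 0)"
      by (intro tendsto_intros)
    have "of_int (sign p) * (\<Prod>a<k. Z (r a) (c (p a))) * 0 ^ (E p - E id)
        = (if p = id then (\<Prod>a<k. Z (r a) (c a)) else 0)"
      using E[OF p] by (auto simp: sign_id)
    then show "((\<lambda>q. of_int (sign p) * (\<Prod>a<k. Y q (r a) (c (p a))) * q ^ (E p - E id)) \<longlongrightarrow>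
        (if p = id then (\<Prod>a<k. Z (r a) (c a)) else 0)) (at_right 0)"
      using tendsto_mult[OF t1 t2] by simp
  qed
  also have "(\<Sum>p\<in>?P. if p = id then (\<Prod>a<k. Z (r a) (c a)) else 0) = (\<Prod>a<k. Z (r a) (c a))"
    using fin by (simp add: permutes_id)
  finally have "\<forall>\<^sub>F q in at_right 0. 0 < G q"
    by (rule order_tendstoD) (use pos in \<open>auto intro: prod_pos\<close>)
  moreover have "\<forall>\<^sub>F q in at_right 0. (0::real) < q" by (rule eventually_at_right_less)
  ultimately show ?thesis
    by eventually_elim (simp add: eq)
qed

lemma eventually_all_minors:
  assumes "\<And>k I J. k \<le> n \<Longrightarrow> I \<in> ksub n k \<Longrightarrow> J \<in> ksub n k \<Longrightarrow> eventually (\<lambda>q. P q k I J) F"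
  shows "eventually (\<lambda>q. \<forall>k\<le>n. \<forall>I\<in>ksub n k. \<forall>J\<in>ksub n k. P q k I J) F"
proof -
  have "eventually (\<lambda>q. \<forall>k\<in>{..n}. \<forall>I\<in>ksub n k. \<forall>J\<in>ksub n k. P q k I J) F"
    using assms by (intro eventually_ball_finite ballI finite_atMost finite_ksub) auto
  then show ?thesis by (simp add: Ball_def)
qed

section \<open>Positivity of minors and small-parameter constructions\<close>

text \<open>The order on \<open>complex\<close> makes \<open>0 < z\<close> include that
  \<open>z\<close> is real, so no separate reality condition appears.\<close>

definition totally_pos :: "nat \<Rightarrow> (nat \<Rightarrow> nat \<Rightarrow> complex) \<Rightarrow> bool" where
  "totally_pos n A \<longleftrightarrow> (\<forall>k\<le>n. \<forall>I\<in>ksub n k. \<forall>J\<in>ksub n k. 0 < fdet k (\<lambda>a b. A (pick I a) (pick J b)))"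

definition left_pos :: "nat \<Rightarrow> (nat \<Rightarrow> nat \<Rightarrow> complex) \<Rightarrow> bool" where
  "left_pos n A \<longleftrightarrow> (\<forall>k\<le>n. \<forall>I\<in>ksub n k. 0 < fdet k (\<lambda>a b. A (pick I a) b))"

lemma totally_posD:
  assumes "totally_pos n A" "incr k n r" "incr k n c" "k \<le> n"
  shows "0 < fdet k (\<lambda>a b. A (r a) (c b))"
  using assms incr_image[OF assms(2)] incr_image[OF assms(3)]
  unfolding totally_pos_def by (subst incr_minor_pick[OF assms(2,3)]) blast

lemma left_posD:
  assumes "left_pos n A" "incr k n r" "k \<le> n"
  shows "0 < fdet k (\<lambda>a b. A (r a) b)"
proof -
  have "fdet k (\<lambda>a b. A (r a) b) = fdet k (\<lambda>a b. A (pick (r ` {..<k}) a) b)"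
    using incr_eq_pick[OF assms(2)] by (intro fdet_cong) simp
  then show ?thesis using assms incr_image[OF assms(2)] by (simp add: left_pos_def)
qed

lemma complex_of_real_pos [simp]: "0 < complex_of_real x \<longleftrightarrow> 0 < x"
  by (simp add: less_complex_def)

lemma complex_of_real_nonneg [simp]: "0 \<le> complex_of_real x \<longleftrightarrow> 0 \<le> x"
  by (simp add: less_eq_complex_def)

text \<open>All coefficients of the kernel are 1, so the lowest-order term of every minor is
  present. This supplies totally positive matrices arbitrarily close to the identity.\<close>

lemma totally_pos_gauss:
  "\<forall>\<^sub>F q in at_right (0::real). totally_pos n (\<lambda>i j. complex_of_real (q ^ sq_dist i j))"
  unfolding totally_pos_def
proof (rule eventually_all_minors)
  fix k I J assume "I \<in> ksub n k" "J \<in> ksub n k"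
  then have "\<forall>\<^sub>F q in at_right 0. 0 < fdet k (\<lambda>a b. 1 * q ^ sq_dist (pick I a) (pick J b) :: real)"
    by (intro eventually_minor_pos[where Z="\<lambda>_ _. 1", OF incr_pick incr_pick]) auto
  then show "\<forall>\<^sub>F q in at_right 0. 0 < fdet k (\<lambda>a b. complex_of_real (q ^ sq_dist (pick I a) (pick J b)))"
    unfolding fdet_of_real[symmetric] by simp
qed

lemma tendsto_gauss:
  "((\<lambda>q. complex_of_real (q ^ sq_dist i j)) \<longlongrightarrow> (if i = j then 1 else 0)) (at_right 0)"
proof -
  have "((\<lambda>q. complex_of_real (q ^ sq_dist i j)) \<longlongrightarrow> complex_of_real (0 ^ sq_dist i j)) (at_right 0)"
    by (intro tendsto_intros)
  also have "complex_of_real (0 ^ sq_dist i j) = (if i = j then 1 else 0)"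
    by (cases "i = j") (auto simp: power_0_left)
  finally show ?thesis .
qed

text \<open>Cutting the Gaussian kernel to its upper triangle can kill minors, but not those on the
  top rows: \<open>a \<le> pick J a\<close>, so their diagonal terms survive. The set
  \<open>I\<close> in the proof is a dummy that allows \<open>eventually_all_minors\<close> to be
  reused. The result provides the upper triangular factor in \<open>U_posI\<close>.\<close>

lemma eventually_upper_initial_minors_pos:
  "\<forall>\<^sub>F q in at_right (0::real). \<forall>k\<le>n. \<forall>J\<in>ksub n k.
     0 < fdet k (\<lambda>a b. (if a \<le> pick J b then q ^ sq_dist a (pick J b) else 0))"
proof -
  have "\<forall>\<^sub>F q in at_right (0::real). \<forall>k\<le>n. \<forall>I\<in>ksub n k. \<forall>J\<in>ksub n k.
     0 < fdet k (\<lambda>a b. (if a \<le> pick J b then q ^ sq_dist a (pick J b) else 0))"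
  proof (rule eventually_all_minors)
    fix k I J assume k: "k \<le> n" and J: "J \<in> ksub n k"
    have "\<forall>\<^sub>F q in at_right 0. 0 < fdet k (\<lambda>a b. (if a \<le> pick J b then 1 else 0) * q ^ sq_dist a (pick J b) :: real)"
      by (rule eventually_minor_pos[where Y="\<lambda>_ i j. if i \<le> j then 1 else 0" and Z="\<lambda>i j. if i \<le> j then 1 else 0",
            OF incr_id[OF k] incr_pick[OF J]])
        (use incr_ge[OF incr_pick[OF J]] in auto)
    then show "\<forall>\<^sub>F q in at_right 0. 0 < fdet k (\<lambda>a b. (if a \<le> pick J b then q ^ sq_dist a (pick J b) else 0) :: real)"
      by (simp add: if_distrib[where f="\<lambda>x. x * _"] cong: if_cong)
  qed
  then show ?thesis
  proof (rule eventually_mono, intro allI impI ballI)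
    fix q :: real and k J
    assume *: "\<forall>k\<le>n. \<forall>I\<in>ksub n k. \<forall>J\<in>ksub n k.
        0 < fdet k (\<lambda>a b. if a \<le> pick J b then q ^ sq_dist a (pick J b) else 0)"
      and k: "k \<le> n" and J: "J \<in> ksub n k"
    show "0 < fdet k (\<lambda>a b. if a \<le> pick J b then q ^ sq_dist a (pick J b) else 0)"
      using *[rule_format, OF k lessThan_ksub[OF k] J] .
  qed
qed

text \<open>The zero block has \<open>a0 + 1\<close> rows and \<open>k - a0\<close> columns, one too
  many in total: a nonzero term would have to place rows \<open>0..a0\<close> injectively into only
  \<open>a0\<close> columns.\<close>

lemma fdet_block_zero:
  assumes "a0 < k" "\<And>a b. a \<le> a0 \<Longrightarrow> a0 \<le> b \<Longrightarrow> b < k \<Longrightarrow> h a b = 0"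
  shows "fdet k h = 0"
  unfolding fdet_expand
proof (intro sum.neutral ballI)
  fix p assume p: "p \<in> {p. p permutes {..<k}}"
  have "\<exists>a\<le>a0. a0 \<le> p a"
  proof (rule ccontr)
    assume "\<not> ?thesis"
    then have "p x < a0" if "x \<le> a0" for x using that by (meson not_le)
    then have "p ` {..a0} \<subseteq> {..<a0}" by (simp add: image_subset_iff)
    moreover have "inj_on p {..a0}" using p permutes_inj_on by auto
    ultimately have "card {..a0} \<le> card {..<a0}" by (intro card_inj_on_le) auto
    then show False by simp
  qed
  then obtain a where a: "a \<le> a0" "a0 \<le> p a" by auto
  have "p a < k" using permutes_in_image[of p "{..<k}" a] p a assms(1) by auto
  then have "h a (p a) = 0" using assms(2) a by blast
  then have "(\<Prod>a<k. h a (p a)) = 0" using a assms(1) by (intro prod_zero) auto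
  then show "of_int (sign p) * (\<Prod>a<k. h a (p a)) = 0" by simp
qed

lemma fdet_block_zero':
  assumes "a0 < k" "\<And>a b. b \<le> a0 \<Longrightarrow> a0 \<le> a \<Longrightarrow> a < k \<Longrightarrow> h a b = 0"
  shows "fdet k h = 0"
proof -
  have "fdet k (\<lambda>a b. h b a) = 0" by (rule fdet_block_zero[OF assms(1)]) (use assms(2) in blast)
  then show ?thesis using fdet_transpose[of k h] by simp
qed

text \<open>A dichotomy: either every position \<open>(r a, c a)\<close> carries a nonzero entry of
  the shifted matrix, and the lowest-order term is positive, or one of them does not, and then a
  zero block makes the minor vanish for every \<open>q\<close>.\<close>

lemma eventually_tridiagonal_minor:
  fixes P :: "nat \<Rightarrow> nat \<Rightarrow> real"
  assumes tri: "\<And>i j. i + 1 < j \<or> j + 1 < i \<Longrightarrow> P i j = 0"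
    and nonneg: "\<And>i. 0 \<le> P i (Suc i)" "\<And>i. 0 \<le> P (Suc i) i"
    and r: "incr k n r" and c: "incr k m c"
  shows "\<forall>\<^sub>F q in at_right 0. 0 \<le> fdet k (\<lambda>a b. (if r a = c b then 1 else 0) + q * P (r a) (c b)) \<and>
    ((\<forall>a<k. r a = c a \<or> 0 < P (r a) (c a)) \<longrightarrow>
      0 < fdet k (\<lambda>a b. (if r a = c b then 1 else 0) + q * P (r a) (c b)))"
proof (cases "\<forall>a<k. r a = c a \<or> P (r a) (c a) \<noteq> 0")
  case True
  \<comment> \<open>Chosen so that \<open>Y q i j * q ^ sq_dist i j\<close> is the entry of the
    shifted matrix: the diagonal carries \<open>q ^ 0\<close>, the neighbouring entries carry
    \<open>q ^ 1\<close>, and nothing else occurs.\<close>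
  define Y where "Y q i j = (if i = j then 1 + q * P i i else if sq_dist i j = 1 then P i j else 0)" for q i j
  have pos: "0 < Y 0 (r a) (c a)" if "a < k" for a
  proof (cases "r a = c a")
    case False
    then have "P (r a) (c a) \<noteq> 0" using True that by auto
    then have "r a + 1 = c a \<or> c a + 1 = r a" using tri[of "r a" "c a"] False by linarith
    then consider "c a = Suc (r a)" | "r a = Suc (c a)" by linarith
    then show ?thesis
    proof cases
      case 1
      then show ?thesis using \<open>P (r a) (c a) \<noteq> 0\<close> nonneg(1)[of "r a"] by (simp add: Y_def)
    next
      case 2
      then show ?thesis using \<open>P (r a) (c a) \<noteq> 0\<close> nonneg(2)[of "c a"] by (simp add: Y_def)
    qed
  qed (simp add: Y_def)
  have lim: "((\<lambda>q. Y q i j) \<longlongrightarrow> Y 0 i j) (at_right 0)" for i j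
    unfolding Y_def by (auto intro!: tendsto_eq_intros)
  have "\<forall>\<^sub>F q in at_right 0. 0 < fdet k (\<lambda>a b. Y q (r a) (c b) * q ^ sq_dist (r a) (c b))"
    by (rule eventually_minor_pos[where Y=Y and Z="Y 0", OF r c lim pos])
  moreover have "Y q i j * q ^ sq_dist i j = (if i = j then 1 else 0) + q * P i j" for q i j
  proof -
    have "P i j = 0" if "i \<noteq> j" "sq_dist i j \<noteq> 1"
    proof (rule tri, rule ccontr)
      assume "\<not> (i + 1 < j \<or> j + 1 < i)"
      then have "j = Suc i \<or> i = Suc j" using that(1) by linarith
      then show False using that(2) by auto
    qed
    then show ?thesis by (auto simp: Y_def)
  qed
  ultimately have "\<forall>\<^sub>F q in at_right 0. 0 < fdet k (\<lambda>a b. (if r a = c b then 1 else 0) + q * P (r a) (c b))"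
    by simp
  then show ?thesis by (rule eventually_mono) simp
next
  case False
  \<comment> \<open>Position \<open>a0\<close> produces the zero block. By monotonicity of
    \<open>r\<close> and \<open>c\<close>, entries of the block lie at least as far from the
    diagonal as \<open>(r a0, c a0)\<close>; each is either outside the three diagonals or that
    vanishing entry itself.\<close>
  then obtain a0 where a0: "a0 < k" "r a0 \<noteq> c a0" "P (r a0) (c a0) = 0" by auto
  have "fdet k (\<lambda>a b. (if r a = c b then 1 else 0) + q * P (r a) (c b)) = 0" for q
  proof (cases "r a0 < c a0")
    case True
    show ?thesis
    proof (rule fdet_block_zero[OF a0(1)])
      fix a b assume ab: "a \<le> a0" "a0 \<le> b" "b < k"
      have le: "r a \<le> r a0" "c a0 \<le> c b"
        using incr_mono_le[OF r ab(1)] incr_mono_le[OF c ab(2)] ab a0 by simp_all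
      have "P (r a) (c b) = 0"
      proof (cases "r a + 1 < c b")
        case False
        then have "r a = r a0" "c b = c a0" using le True by linarith+
        then show ?thesis using a0 by simp
      qed (use tri in blast)
      moreover have "r a \<noteq> c b" using le True by linarith
      ultimately show "(if r a = c b then 1 else 0) + q * P (r a) (c b) = 0" by simp
    qed
  next
    case False
    then have lt: "c a0 < r a0" using a0 by simp
    show ?thesis
    proof (rule fdet_block_zero'[OF a0(1)])
      fix a b assume ab: "b \<le> a0" "a0 \<le> a" "a < k"
      have le: "c b \<le> c a0" "r a0 \<le> r a"
        using incr_mono_le[OF c ab(1)] incr_mono_le[OF r ab(2)] ab a0 by simp_all
      have "P (r a) (c b) = 0"
      proof (cases "c b + 1 < r a")
        case False
        then have "r a = r a0" "c b = c a0" using le lt by linarith+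
        then show ?thesis using a0 by simp
      qed (use tri in blast)
      moreover have "r a \<noteq> c b" using le lt by linarith
      ultimately show "(if r a = c b then 1 else 0) + q * P (r a) (c b) = 0" by simp
    qed
  qed
  moreover have "\<not> (\<forall>a<k. r a = c a \<or> 0 < P (r a) (c a))" using a0 by force
  ultimately show ?thesis by simp
qed

section \<open>The Iwasawa decomposition\<close>

lemma ksub_full: "ksub k k = {{..<k}}"
  using card_subset_eq[of "{..<k}"] by (auto simp: ksub_def)

lemma fdet_mult: "fdet k (\<lambda>a b. \<Sum>l<k. A a l * B l b) = fdet k A * fdet k B"
proof -
  have "fdet k (\<lambda>a b. A a (pick {..<k} b)) = fdet k A" "fdet k (\<lambda>a b. B (pick {..<k} a) b) = fdet k B"
    by (auto intro!: fdet_cong simp: pick_lessThan)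
  then show ?thesis unfolding Cauchy_Binet ksub_full by simp
qed

lemma fdet_1: "fdet (Suc 0) h = h 0 0"
  using fdet_upper_triangular[of "Suc 0" h] by simp

lemma mat_adjoint_index [simp]:
  assumes "A \<in> carrier_mat m n" "i < n" "j < m"
  shows "mat_adjoint A $$ (i, j) = conjugate (A $$ (j, i))"
  using carrier_matD[OF assms(1)] assms(2,3) by (simp add: mat_adjoint_def mat_of_rows_index)

lemma mat_adjoint_dim [simp]:
  "dim_row (mat_adjoint A) = dim_col A" "dim_col (mat_adjoint A) = dim_row A"
  by (simp_all add: mat_adjoint_def)

lemma mat_adjoint_carrier [simp]: "A \<in> carrier_mat m n \<Longrightarrow> mat_adjoint A \<in> carrier_mat n m"
  by (auto simp: mat_adjoint_def)

lemma index_mult_sum: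
  assumes "A \<in> carrier_mat m n" "B \<in> carrier_mat n p" "i < m" "j < p"
  shows "(A * B) $$ (i, j) = (\<Sum>l<n. A $$ (i, l) * B $$ (l, j))"
  using assms by (auto simp: scalar_prod_def atLeast0LessThan)

lemma unitary_iff:
  "g \<in> unitary_group n \<longleftrightarrow> g \<in> carrier_mat n n \<and>
    (\<forall>i<n. \<forall>j<n. (\<Sum>l<n. cnj (g $$ (l, i)) * g $$ (l, j)) = (if i = j then 1 else 0))"
proof (cases "g \<in> carrier_mat n n")
  case True
  have "mat_adjoint g * g = 1\<^sub>m n \<longleftrightarrow>
    (\<forall>i<n. \<forall>j<n. (mat_adjoint g * g) $$ (i, j) = (if i = j then 1 else 0))"
    using True mat_adjoint_carrier[OF True] by (auto simp: mat_eq_iff)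
  also have "\<dots> \<longleftrightarrow> (\<forall>i<n. \<forall>j<n. (\<Sum>l<n. cnj (g $$ (l, i)) * g $$ (l, j)) = (if i = j then 1 else 0))"
    using True by (simp add: index_mult_sum[OF mat_adjoint_carrier[OF True] True] del: index_mult_mat(1))
  finally show ?thesis using True by (simp add: unitary_group_def)
qed (simp add: unitary_group_def)

lemma unitary_carrier: "g \<in> unitary_group n \<Longrightarrow> g \<in> carrier_mat n n"
  by (simp add: unitary_group_def)

lemma unitary_cols:
  "g \<in> unitary_group n \<Longrightarrow> i < n \<Longrightarrow> j < n \<Longrightarrow>
    (\<Sum>l<n. cnj (g $$ (l, i)) * g $$ (l, j)) = (if i = j then 1 else 0)"
  by (simp add: unitary_iff)

lemma unitary_rows:
  assumes "g \<in> unitary_group n" "i < n" "j < n"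
  shows "(\<Sum>l<n. g $$ (i, l) * cnj (g $$ (j, l))) = (if i = j then 1 else 0)"
proof -
  have g: "g \<in> carrier_mat n n" using assms by (simp add: unitary_group_def)
  have "g * mat_adjoint g = 1\<^sub>m n"
    using unitary_group_inverse(2)[OF assms(1)] g by (simp add: inverts_mat_def)
  then have "(g * mat_adjoint g) $$ (i, j) = (if i = j then 1 else 0)" using assms by simp
  then show ?thesis using assms g
    by (simp add: index_mult_sum[OF g mat_adjoint_carrier[OF g]] del: index_mult_mat(1))
qed

text \<open>Column \<open>j\<close> of the product only involves columns up to \<open>j\<close> of
  \<open>H\<close>, and on and below row \<open>j\<close> the earlier ones are already known to
  vanish. Dividing by \<open>b j j\<close> settles column \<open>j\<close>. The lemma serves both
  uniqueness of the QR decomposition and the Schur form.\<close>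

lemma upper_factor:
  fixes H :: "nat \<Rightarrow> nat \<Rightarrow> 'a::field"
  assumes b: "\<And>i j. j < i \<Longrightarrow> i < n \<Longrightarrow> b i j = 0" "\<And>j. j < n \<Longrightarrow> b j j \<noteq> 0"
    and c: "\<And>i j. j < i \<Longrightarrow> i < n \<Longrightarrow> c i j = 0"
    and eq: "\<And>i j. i < n \<Longrightarrow> j < n \<Longrightarrow> (\<Sum>l<n. H i l * b l j) = c i j"
  shows "j < n \<Longrightarrow> (\<forall>i<n. j < i \<longrightarrow> H i j = 0) \<and> H j j * b j j = c j j"
proof (induction j rule: less_induct)
  case (less j)
  have *: "H i j * b j j = c i j" if "i < n" "j \<le> i" for i
  proof -
    have "(\<Sum>l<n. H i l * b l j) = (\<Sum>l\<in>{j}. H i l * b l j)"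
    proof (rule sum.mono_neutral_right)
      show "\<forall>l\<in>{..<n} - {j}. H i l * b l j = 0"
      proof
        fix l assume "l \<in> {..<n} - {j}"
        then show "H i l * b l j = 0"
          using less that b(1)[of j l] by (cases "l < j") auto
      qed
    qed (use less in auto)
    then show ?thesis using eq[of i j] that less.prems by simp
  qed
  show ?case using *[of j] * b(2)[of j] c[of j] less.prems by (metis less_imp_le_nat mult_eq_0_iff order_refl)
qed

lemma complex_prod_pos: "(\<And>j. j \<in> S \<Longrightarrow> 0 < f j) \<Longrightarrow> 0 < (\<Prod>j\<in>S. f j :: complex)"
proof -
  assume "\<And>j. j \<in> S \<Longrightarrow> 0 < f j"
  then have *: "f j = of_real (Re (f j))" "0 < Re (f j)" if "j \<in> S" for j
    using that by (auto simp: less_complex_def complex_eq_iff)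
  have "(\<Prod>j\<in>S. f j) = of_real (\<Prod>j\<in>S. Re (f j))" unfolding of_real_prod by (rule prod.cong) (use * in auto)
  moreover have "0 < (\<Prod>j\<in>S. Re (f j))" by (rule prod_pos) (use * in auto)
  ultimately show ?thesis by (simp del: of_real_prod)
qed

lemma complex_mult_pos: "0 < x \<Longrightarrow> 0 < y \<Longrightarrow> 0 < (x * y :: complex)"
  by (simp add: less_complex_def)

lemma complex_pos_mult_cancel: "0 < y \<Longrightarrow> 0 < (x * y :: complex) \<Longrightarrow> 0 < x"
  by (auto simp: less_complex_def zero_less_mult_iff)

lemma cnj_mult_pos_eq_1: "0 < z \<Longrightarrow> cnj z * z = 1 \<Longrightarrow> z = 1"
proof -
  assume z: "0 < z" "cnj z * z = 1"
  then have "z = complex_of_real (Re z)" "0 < Re z" by (auto simp: less_complex_def complex_eq_iff)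
  from this z(2) have "Re z * Re z = 1"
    by (metis complex_cnj_complex_of_real of_real_1 of_real_eq_iff of_real_mult)
  then have "(Re z - 1) * (Re z + 1) = 0" by (simp add: algebra_simps)
  then have "Re z = 1" using \<open>0 < Re z\<close> by simp
  then show "z = 1" using \<open>z = complex_of_real (Re z)\<close> by simp
qed

text \<open>Once the rows before \<open>i\<close> are those of the identity, orthonormality of
  columns \<open>i\<close> and \<open>j\<close> reduces to the single term \<open>l = i\<close>. A
  positive number of modulus 1 is 1, and the rest of the row follows.\<close>

lemma unitary_upper_eq_1:
  fixes H :: "nat \<Rightarrow> nat \<Rightarrow> complex"
  assumes u: "\<And>i j. i < n \<Longrightarrow> j < n \<Longrightarrow> (\<Sum>l<n. cnj (H l i) * H l j) = (if i = j then 1 else 0)"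
    and up: "\<And>i j. j < i \<Longrightarrow> i < n \<Longrightarrow> H i j = 0" and pos: "\<And>j. j < n \<Longrightarrow> 0 < H j j"
  shows "i < n \<Longrightarrow> (\<forall>j<n. H i j = (if i = j then 1 else 0))"
proof (induction i rule: less_induct)
  case (less i)
  have *: "cnj (H i i) * H i j = (if i = j then 1 else 0)" if "j < n" for j
  proof -
    have "(\<Sum>l<n. cnj (H l i) * H l j) = (\<Sum>l\<in>{i}. cnj (H l i) * H l j)"
    proof (rule sum.mono_neutral_right)
      show "\<forall>l\<in>{..<n} - {i}. cnj (H l i) * H l j = 0"
      proof
        fix l assume "l \<in> {..<n} - {i}"
        then show "cnj (H l i) * H l j = 0"
          using less up[of i l] by (cases "l < i") auto
      qed
    qed (use less in auto)
    then show ?thesis using u[of i j] that less.prems by simp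
  qed
  have "H i i = 1" using *[of i] pos less.prems cnj_mult_pos_eq_1 by simp
  then show ?case using * up less.prems by (metis complex_cnj_one mult_1)
qed

text \<open>One Gram--Schmidt step. The new vector is nonzero, since otherwise all minors of order
  \<open>k + 1\<close> would vanish by the Cauchy--Binet formula.\<close>

lemma QR_exists:
  fixes M :: "nat \<Rightarrow> nat \<Rightarrow> complex"
  assumes nz: "\<And>k. k \<le> n \<Longrightarrow> \<exists>r. (\<forall>a<k. r a < n) \<and> fdet k (\<lambda>a b. M (r a) b) \<noteq> 0"
  shows "k \<le> n \<Longrightarrow> \<exists>G b. (\<forall>i<k. \<forall>j<k. (\<Sum>l<n. cnj (G l i) * G l j) = (if i = j then 1 else 0)) \<and>
    (\<forall>j<k. 0 < b j j) \<and> (\<forall>i j. j < i \<longrightarrow> b i j = 0) \<and>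
    (\<forall>a<n. \<forall>j<k. M a j = (\<Sum>i<k. G a i * b i j))"
proof (induction k)
  case 0
  show ?case by (rule exI, rule exI[of _ "\<lambda>_ _. 0"]) simp
next
  case (Suc k)
  then obtain G b where
    orth: "\<And>i j. i < k \<Longrightarrow> j < k \<Longrightarrow> (\<Sum>l<n. cnj (G l i) * G l j) = (if i = j then 1 else 0)"
    and bpos: "\<And>j. j < k \<Longrightarrow> 0 < b j j" and bup: "\<And>i j. j < i \<Longrightarrow> b i j = 0"
    and M: "\<And>a j. a < n \<Longrightarrow> j < k \<Longrightarrow> M a j = (\<Sum>i<k. G a i * b i j)"
    by fastforce
  \<comment> \<open>Projection coefficients of column \<open>k\<close> onto the earlier orthonormal
    columns, then the residual vector and its norm.\<close>
  define \<beta> where "\<beta> i = (\<Sum>a<n. cnj (G a i) * M a k)" for i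
  define y where "y a = M a k - (\<Sum>i<k. G a i * \<beta> i)" for a
  define N where "N = sqrt (\<Sum>a<n. (cmod (y a))\<^sup>2)"
  have "\<exists>a<n. y a \<noteq> 0"
  proof (rule ccontr)
    assume "\<not> ?thesis"
    then have y0: "M a k = (\<Sum>i<k. G a i * \<beta> i)" if "a < n" for a using that by (auto simp: y_def)
    obtain r where r: "\<forall>a<Suc k. r a < n" "fdet (Suc k) (\<lambda>a b. M (r a) b) \<noteq> 0"
      using nz[OF Suc.prems] by blast
    have "fdet (Suc k) (\<lambda>a b. M (r a) b) =
        fdet (Suc k) (\<lambda>a c. \<Sum>i<k. G (r a) i * (if c = k then \<beta> i else b i c))"
    proof (rule fdet_cong)
      fix a c assume "a < Suc k" "c < Suc k"
      then show "M (r a) c = (\<Sum>i<k. G (r a) i * (if c = k then \<beta> i else b i c))"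
        using r(1) y0 M by (cases "c = k") auto
    qed
    also have "\<dots> = 0" by (simp only: Cauchy_Binet) (simp add: ksub_empty)
    finally show False using r(2) by simp
  qed
  then have N: "0 < N" unfolding N_def
    by (auto intro!: sum_pos2)
  have yy: "(\<Sum>a<n. cnj (y a) * y a) = of_real (N * N)"
  proof -
    have "cnj (y a) * y a = of_real ((cmod (y a))\<^sup>2)" for a
      by (simp only: complex_norm_square mult.commute)
    then have "(\<Sum>a<n. cnj (y a) * y a) = of_real (\<Sum>a<n. (cmod (y a))\<^sup>2)" by simp
    also have "(\<Sum>a<n. (cmod (y a))\<^sup>2) = N * N"
      by (simp add: N_def sum_nonneg)
    finally show ?thesis .
  qed
  have yG: "(\<Sum>a<n. cnj (G a i) * y a) = 0" if "i < k" for i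
  proof -
    have "(\<Sum>a<n. cnj (G a i) * y a) = \<beta> i - (\<Sum>a<n. \<Sum>l<k. cnj (G a i) * (G a l * \<beta> l))"
      by (simp add: y_def right_diff_distrib sum_subtractf \<beta>_def sum_distrib_left)
    also have "(\<Sum>a<n. \<Sum>l<k. cnj (G a i) * (G a l * \<beta> l)) = (\<Sum>l<k. \<Sum>a<n. cnj (G a i) * (G a l * \<beta> l))"
      by (rule sum.swap)
    also have "\<dots> = (\<Sum>l<k. (\<Sum>a<n. cnj (G a i) * G a l) * \<beta> l)"
      by (simp add: sum_distrib_right mult.assoc)
    also have "\<dots> = (\<Sum>l<k. if i = l then \<beta> l else 0)"
      using orth that by (intro sum.cong) auto
    also have "\<dots> = \<beta> i" using that by simp
    finally show ?thesis by simp
  qed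
  have yG': "(\<Sum>a<n. cnj (y a) * G a i) = 0" if "i < k" for i
    using arg_cong[OF yG[OF that], of cnj] by (simp add: mult.commute)
  \<comment> \<open>The normalised residual becomes the new column of \<open>G\<close>; the new
    column of \<open>b\<close> collects the coefficients \<open>\<beta>\<close> and, on the
    diagonal, the norm \<open>N\<close>.\<close>
  define G' where "G' a i = (if i = k then y a / N else G a i)" for a i
  define b' where "b' i j = (if j = k then (if i < k then \<beta> i else if i = k then of_real N else 0) else b i j)" for i j
  have 1: "(\<Sum>l<n. cnj (G' l i) * G' l j) = (if i = j then 1 else 0)"
    if ij: "i < Suc k" "j < Suc k" for i j
  proof -
    consider "i < k" "j < k" | "i < k" "j = k" | "i = k" "j < k" | "i = k" "j = k"
      using ij unfolding less_Suc_eq by blast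
    then show ?thesis
    proof cases
      case 1 then show ?thesis using orth by (simp add: G'_def)
    next
      case 2 then show ?thesis using yG[of i] by (simp add: G'_def flip: sum_divide_distrib)
    next
      case 3 then show ?thesis using yG'[of j] by (simp add: G'_def flip: sum_divide_distrib)
    next
      case 4 then show ?thesis using yy N by (simp add: G'_def flip: sum_divide_distrib)
    qed
  qed
  have 2: "0 < b' j j" if "j < Suc k" for j using that bpos N by (auto simp: b'_def less_Suc_eq)
  have 3: "b' i j = 0" if "j < i" for i j using that bup by (auto simp: b'_def)
  have 4: "M a j = (\<Sum>i<Suc k. G' a i * b' i j)" if "a < n" "j < Suc k" for a j
  proof (cases "j = k")
    case True
    have "(\<Sum>i<k. G' a i * b' i k) = (\<Sum>i<k. G a i * \<beta> i)"
      by (intro sum.cong) (auto simp: G'_def b'_def)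
    then show ?thesis using True N by (simp add: G'_def b'_def y_def)
  next
    case False
    then have "(\<Sum>i<k. G' a i * b' i j) = (\<Sum>i<k. G a i * b i j)"
      by (intro sum.cong) (auto simp: G'_def b'_def)
    then show ?thesis using False that M bup[of j k] by (simp add: b'_def)
  qed
  show ?case using 1 2 3 4 by blast
qed

text \<open>Product of the diagonal and the unipotent factor of an Iwasawa decomposition. Kept as
  one factor, it turns the decomposition into QR.\<close>

definition upper_pos :: "nat \<Rightarrow> (nat \<Rightarrow> nat \<Rightarrow> complex) \<Rightarrow> bool" where
  "upper_pos n b \<longleftrightarrow> (\<forall>i j. j < i \<longrightarrow> i < n \<longrightarrow> b i j = 0) \<and> (\<forall>j<n. 0 < b j j)"

text \<open>The adjoint of \<open>g'\<close> times \<open>g\<close> is a unitary \<open>H\<close>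
  with \<open>H b = b'\<close>. It is therefore upper triangular with positive diagonal, and so it
  is the identity.\<close>

lemma unitary_upper_pos_unique:
  assumes g: "g \<in> unitary_group n" "g' \<in> unitary_group n" and b: "upper_pos n b" "upper_pos n b'"
    and eq: "\<And>a j. a < n \<Longrightarrow> j < n \<Longrightarrow> (\<Sum>i<n. g $$ (a, i) * b i j) = (\<Sum>i<n. g' $$ (a, i) * b' i j)"
  shows "g = g'"
proof -
  note c = unitary_carrier[OF g(1)] unitary_carrier[OF g(2)]
  have ca: "mat_adjoint g' \<in> carrier_mat n n" using c by simp
  define H where "H i j = (\<Sum>l<n. cnj (g' $$ (l, i)) * g $$ (l, j))" for i j
  have Hmat: "mat n n (\<lambda>(i, j). H i j) = mat_adjoint g' * g"
    by (rule eq_matI) (use carrier_matD[OF c(1)] carrier_matD[OF c(2)] c in \<open>auto simp: H_def index_mult_sum[OF ca c(1)] simp del: index_mult_mat(1)\<close>)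
  have g'a: "g' * mat_adjoint g' = 1\<^sub>m n"
    using unitary_group_inverse(2)[OF g(2)] c by (simp add: inverts_mat_def)
  have gg: "g = g' * mat n n (\<lambda>(i, j). H i j)"
    unfolding Hmat using c ca g'a by (simp flip: assoc_mult_mat[OF c(2) ca c(1)])
  have gH: "g $$ (a, j) = (\<Sum>i<n. g' $$ (a, i) * H i j)" if "a < n" "j < n" for a j
    using arg_cong[OF gg, of "\<lambda>m. m $$ (a, j)"] that c
      index_mult_sum[OF c(2), of "mat n n (\<lambda>(i, j). H i j)" n a j]
    by (simp del: index_mult_mat(1))
  have Hb: "(\<Sum>l<n. H i l * b l j) = b' i j" if "i < n" "j < n" for i j
  proof -
    have "(\<Sum>l<n. H i l * b l j) = (\<Sum>l<n. \<Sum>a<n. cnj (g' $$ (a, i)) * (g $$ (a, l) * b l j))"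
      by (simp add: H_def sum_distrib_right mult.assoc)
    also have "\<dots> = (\<Sum>a<n. cnj (g' $$ (a, i)) * (\<Sum>l<n. g $$ (a, l) * b l j))"
      by (subst sum.swap) (simp add: sum_distrib_left)
    also have "\<dots> = (\<Sum>a<n. cnj (g' $$ (a, i)) * (\<Sum>l<n. g' $$ (a, l) * b' l j))"
      using eq that by simp
    also have "\<dots> = (\<Sum>l<n. (\<Sum>a<n. cnj (g' $$ (a, i)) * g' $$ (a, l)) * b' l j)"
      by (simp add: sum_distrib_left sum_distrib_right mult.assoc) (rule sum.swap)
    also have "\<dots> = (\<Sum>l<n. if i = l then b' l j else 0)"
      using unitary_cols[OF g(2)] that by (intro sum.cong) auto
    finally show ?thesis using that by simp
  qed
  have up: "(\<forall>i<n. j < i \<longrightarrow> H i j = 0) \<and> H j j * b j j = b' j j" if "j < n" for j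
    by (rule upper_factor[OF _ _ _ Hb that]) (use b in \<open>force simp: upper_pos_def\<close>)+
  have Hpos: "0 < H j j" if "j < n" for j
  proof -
    have "0 < b j j" "0 < b' j j" using b that by (auto simp: upper_pos_def)
    moreover have "H j j * b j j = b' j j" using up that by blast
    ultimately show ?thesis using complex_pos_mult_cancel[of "b j j" "H j j"] by simp
  qed
  have Hu: "(\<Sum>l<n. cnj (H l i) * H l j) = (if i = j then 1 else 0)" if "i < n" "j < n" for i j
  proof -
    have "(\<Sum>l<n. cnj (H l i) * H l j) = (\<Sum>l<n. \<Sum>a<n. cnj (g $$ (a, i)) * (g' $$ (a, l) * H l j))"
      unfolding H_def[of _ i] cnj_sum sum_distrib_right
      by (intro sum.cong refl) (simp add: mult_ac)
    also have "\<dots> = (\<Sum>a<n. cnj (g $$ (a, i)) * (\<Sum>l<n. g' $$ (a, l) * H l j))"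
      by (subst sum.swap) (simp add: sum_distrib_left)
    also have "\<dots> = (\<Sum>a<n. cnj (g $$ (a, i)) * g $$ (a, j))" using gH that by simp
    finally show ?thesis using unitary_cols[OF g(1)] that by simp
  qed
  have H1: "H i j = (if i = j then 1 else 0)" if "i < n" "j < n" for i j
  proof -
    have "H i j = 0" if "j < i" "i < n" for i j using up[of j] that by simp
    then have "\<forall>j<n. H i j = (if i = j then 1 else 0)"
      using unitary_upper_eq_1[of n H i] Hu Hpos that(1) by simp
    then show ?thesis using that(2) by simp
  qed
  show ?thesis
  proof (rule eq_matI)
    fix a j assume aj: "a < dim_row g'" "j < dim_col g'"
    then have "g $$ (a, j) = (\<Sum>i<n. g' $$ (a, i) * H i j)" using gH c by simp
    also have "\<dots> = (\<Sum>i<n. if i = j then g' $$ (a, i) else 0)"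
      using H1 aj c by (intro sum.cong) auto
    finally show "g $$ (a, j) = g' $$ (a, j)" using aj c by simp
  qed (use c in auto)
qed

lemma iwasawaD:
  assumes "iwasawa M g1 g2 g3" "M \<in> carrier_mat n n"
  shows "g1 \<in> unitary_group n \<and> (\<exists>b. upper_pos n b \<and>
    (\<forall>a<n. \<forall>j<n. M $$ (a, j) = (\<Sum>i<n. g1 $$ (a, i) * b i j)))"
proof -
  obtain d where g1: "g1 \<in> unitary_group n" and d: "\<forall>i<n. 0 < d i"
    and g2: "g2 = mat_diag n (\<lambda>i. complex_of_real (d i))"
    and g3: "g3 \<in> carrier_mat n n" "upper_triangular g3" "\<forall>i<n. g3 $$ (i, i) = 1" and M: "M = g1 * g2 * g3"
    using assms by (auto simp: iwasawa_def)
  note c = unitary_carrier[OF g1]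
  have c2: "g2 \<in> carrier_mat n n" by (simp add: g2)
  have eq: "g2 * g3 = mat n n (\<lambda>(i, j). complex_of_real (d i) * g3 $$ (i, j))"
    unfolding g2 by (rule mat_diag_mult_left[OF g3(1)])
  have "M = g1 * mat n n (\<lambda>(i, j). complex_of_real (d i) * g3 $$ (i, j))"
    unfolding M assoc_mult_mat[OF c c2 g3(1)] eq ..
  then have "M $$ (a, j) = (\<Sum>i<n. g1 $$ (a, i) * (complex_of_real (d i) * g3 $$ (i, j)))"
    if "a < n" "j < n" for a j
    using that by (simp add: index_mult_sum[OF c mat_carrier] del: index_mult_mat(1))
  moreover have "upper_pos n (\<lambda>i j. complex_of_real (d i) * g3 $$ (i, j))"
    using d g3 carrier_matD[OF g3(1)] by (auto simp: upper_pos_def upper_triangular_def)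
  ultimately show ?thesis using g1 by blast
qed

text \<open>Evaluates the description that defines \<open>pi_U\<close>. Existence splits
  \<open>b\<close> into its diagonal and the unipotent matrix of the quotients
  \<open>b i j / b i i\<close>; uniqueness is that of QR.\<close>

lemma pi_U_eqI:
  assumes M: "M \<in> carrier_mat n n" and g: "g \<in> unitary_group n" and b: "upper_pos n b"
    and eq: "\<And>a j. a < n \<Longrightarrow> j < n \<Longrightarrow> M $$ (a, j) = (\<Sum>i<n. g $$ (a, i) * b i j)"
  shows "pi_U M = g"
  unfolding pi_U_def
proof (rule the_equality)
  have br: "b i i = complex_of_real (Re (b i i))" "0 < Re (b i i)" if "i < n" for i
    using b that by (auto simp: upper_pos_def less_complex_def complex_eq_iff)
  let ?d = "\<lambda>i. Re (b i i)"
  let ?g2 = "mat_diag n (\<lambda>i. complex_of_real (?d i))" and ?g3 = "mat n n (\<lambda>(i, j). b i j / b i i)"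
  note c = unitary_carrier[OF g]
  have bnz: "b i i \<noteq> 0" if "i < n" for i
    using br(2)[OF that] by (metis less_irrefl zero_complex.sel(1))
  have eq23: "?g2 * ?g3 = mat n n (\<lambda>(i, j). b i j)"
    by (subst mat_diag_mult_left[of _ n n], simp, rule eq_matI) (use b in \<open>auto simp: upper_pos_def br(1)[symmetric]\<close>)
  have "M = g * mat n n (\<lambda>(i, j). b i j)"
    by (rule eq_matI) (use M carrier_matD[OF c] eq in \<open>auto simp: index_mult_sum[OF c mat_carrier] simp del: index_mult_mat(1)\<close>)
  then have "M = g * ?g2 * ?g3"
    using eq23 assoc_mult_mat[OF c, of ?g2 n ?g3 n] by simp
  moreover have "upper_triangular ?g3" using b by (auto simp: upper_pos_def)
  moreover have "?g3 $$ (i, i) = 1" if "i < n" for i using bnz[OF that] that by simp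
  moreover have "\<exists>d. (\<forall>i<n. 0 < d i) \<and> ?g2 = mat_diag n (\<lambda>i. complex_of_real (d i))"
    by (rule exI[of _ ?d]) (use br in simp)
  ultimately have "iwasawa M g ?g2 ?g3"
    unfolding iwasawa_def carrier_matD(1)[OF M] using g by simp
  then show "\<exists>g2 g3. iwasawa M g g2 g3" by blast
next
  fix g1 assume "\<exists>g2 g3. iwasawa M g1 g2 g3"
  then obtain g2 g3 where "iwasawa M g1 g2 g3" by blast
  then obtain b' where "g1 \<in> unitary_group n" "upper_pos n b'"
    "\<forall>a<n. \<forall>j<n. M $$ (a, j) = (\<Sum>i<n. g1 $$ (a, i) * b' i j)"
    using iwasawaD[OF _ M] by blast
  then show "g1 = g" using unitary_upper_pos_unique[of g1 n g b' b] g b eq by simp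
qed

text \<open>The first \<open>k\<close> columns of the product only use the first \<open>k\<close>
  columns of \<open>A\<close>, because \<open>b\<close> is upper triangular. Hence passing to the
  unitary factor changes left-justified minors only by positive factors when \<open>b\<close> has
  positive diagonal.\<close>

lemma left_minor_mult_upper:
  assumes b: "\<And>i j. j < i \<Longrightarrow> i < n \<Longrightarrow> b i j = 0" and k: "k \<le> n"
  shows "fdet k (\<lambda>a j. \<Sum>i<n. A a i * b i j) = fdet k A * (\<Prod>j<k. b j j)"
proof -
  have "fdet k (\<lambda>a j. \<Sum>i<n. A a i * b i j) = fdet k (\<lambda>a j. \<Sum>i<k. A a i * b i j)"
  proof (rule fdet_cong)
    fix a j assume "a < k" "j < k"
    then have "b i j = 0" if "i \<in> {..<n} - {..<k}" for i using b[of j i] that by simp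
    then show "(\<Sum>i<n. A a i * b i j) = (\<Sum>i<k. A a i * b i j)"
      using k by (intro sum.mono_neutral_right) simp_all
  qed
  also have "\<dots> = fdet k A * fdet k b" by (rule fdet_mult)
  also have "fdet k b = (\<Prod>j<k. b j j)" by (rule fdet_upper_triangular) (use b k in auto)
  finally show ?thesis .
qed

section \<open>Totally positive unitary matrices\<close>

lemma complex_zero_less_one: "(0::complex) < 1"
  by (simp add: less_complex_def)

lemma QR_unitary:
  fixes M :: "nat \<Rightarrow> nat \<Rightarrow> complex"
  assumes "\<And>k. k \<le> n \<Longrightarrow> \<exists>r. (\<forall>a<k. r a < n) \<and> fdet k (\<lambda>a b. M (r a) b) \<noteq> 0"
  shows "\<exists>g b. g \<in> unitary_group n \<and> upper_pos n b \<and>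
    (\<forall>a<n. \<forall>j<n. M a j = (\<Sum>i<n. g $$ (a, i) * b i j))"
proof -
  obtain G b where Gb: "\<forall>i<n. \<forall>j<n. (\<Sum>l<n. cnj (G l i) * G l j) = (if i = j then 1 else 0)"
    "\<forall>j<n. 0 < b j j" "\<forall>i j. j < i \<longrightarrow> b i j = 0" "\<forall>a<n. \<forall>j<n. M a j = (\<Sum>i<n. G a i * b i j)"
    using QR_exists[of n M, OF assms order_refl] by blast
  have "mat n n (\<lambda>(i, j). G i j) \<in> unitary_group n"
    unfolding unitary_iff using Gb(1) by simp
  moreover have "upper_pos n b" using Gb by (simp add: upper_pos_def)
  moreover have "\<forall>a<n. \<forall>j<n. M a j = (\<Sum>i<n. mat n n (\<lambda>(i, j). G i j) $$ (a, i) * b i j)"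
    using Gb(4) by simp
  ultimately show ?thesis by blast
qed

lemma left_pos_mult_upper_pos:
  assumes b: "upper_pos n b"
    and eq: "\<And>a j. a < n \<Longrightarrow> j < n \<Longrightarrow> M a j = (\<Sum>i<n. G a i * b i j)"
  shows "left_pos n M \<longleftrightarrow> left_pos n G"
proof -
  have "0 < fdet k (\<lambda>a b. M (pick I a) b) \<longleftrightarrow> 0 < fdet k (\<lambda>a b. G (pick I a) b)"
    if k: "k \<le> n" and I: "I \<in> ksub n k" for k I
  proof -
    have "fdet k (\<lambda>a j. M (pick I a) j) = fdet k (\<lambda>a j. \<Sum>i<n. G (pick I a) i * b i j)"
      by (rule fdet_cong) (use eq pick_less[OF I] k in simp)
    also have "\<dots> = fdet k (\<lambda>a j. G (pick I a) j) * (\<Prod>j<k. b j j)"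
      by (rule left_minor_mult_upper) (use b k in \<open>simp_all add: upper_pos_def\<close>)
    finally have e: "fdet k (\<lambda>a j. M (pick I a) j) = fdet k (\<lambda>a j. G (pick I a) j) * (\<Prod>j<k. b j j)" .
    have "0 < (\<Prod>j<k. b j j)" by (rule complex_prod_pos) (use b k in \<open>simp add: upper_pos_def\<close>)
    then show ?thesis unfolding e using complex_mult_pos complex_pos_mult_cancel by blast
  qed
  then show ?thesis by (simp add: left_pos_def)
qed

lemma left_minors_cong:
  "k \<le> n \<Longrightarrow> I \<in> ksub n k \<Longrightarrow> fdet k (\<lambda>a b. A (pick I a) (pick {..<k} b)) = fdet k (\<lambda>a b. A (pick I a) b)"
  by (rule fdet_cong) (simp add: pick_lessThan)

lemma totally_pos_imp_left_pos: "totally_pos n A \<Longrightarrow> left_pos n A"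
  unfolding left_pos_def
proof (intro allI impI ballI)
  fix k I assume A: "totally_pos n A" and k: "k \<le> n" and I: "I \<in> ksub n k"
  then have "0 < fdet k (\<lambda>a b. A (pick I a) (pick {..<k} b))"
    using lessThan_ksub[OF k] unfolding totally_pos_def by blast
  then show "0 < fdet k (\<lambda>a b. A (pick I a) b)" unfolding left_minors_cong[OF k I] .
qed

lemma left_pos_nonzero:
  assumes "left_pos n M" "k \<le> n"
  shows "\<exists>r. (\<forall>a<k. r a < n) \<and> fdet k (\<lambda>a b. M (r a) b) \<noteq> 0"
  using left_posD[OF assms(1) incr_id[OF assms(2)] assms(2)] assms(2)
  by (intro exI[of _ "\<lambda>a. a"]) auto

lemma GL_pos_iff:
  assumes "A \<in> carrier_mat n n"
  shows "A \<in> GL_pos n \<longleftrightarrow> (\<forall>k\<le>n. \<forall>I\<in>ksub n k. \<forall>J\<in>ksub n k. 0 < fdet k (\<lambda>a b. A $$ (pick I a, pick J b)))"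
proof -
  have le: "card I \<le> n" if "I \<subseteq> {..<n}" for I
    using card_mono[OF finite_lessThan that] by simp
  have "A \<in> GL_pos n \<longleftrightarrow> (\<forall>I J. I \<subseteq> {..<n} \<longrightarrow> J \<subseteq> {..<n} \<longrightarrow> card I = card J \<longrightarrow> 0 < minor A I J)"
    using assms by (simp add: GL_pos_def)
  also have "\<dots> \<longleftrightarrow> (\<forall>k\<le>n. \<forall>I\<in>ksub n k. \<forall>J\<in>ksub n k. 0 < minor A I J)"
  proof (intro iffI allI impI ballI)
    fix I J assume *: "\<forall>k\<le>n. \<forall>I\<in>ksub n k. \<forall>J\<in>ksub n k. 0 < minor A I J"
      and IJ: "I \<subseteq> {..<n}" "J \<subseteq> {..<n}" "card I = card J"
    then have "I \<in> ksub n (card I)" "J \<in> ksub n (card I)" by (simp_all add: ksub_def)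
    then show "0 < minor A I J" using * le[OF IJ(1)] by blast
  qed (simp add: ksub_def)
  also have "\<dots> \<longleftrightarrow> (\<forall>k\<le>n. \<forall>I\<in>ksub n k. \<forall>J\<in>ksub n k. 0 < fdet k (\<lambda>a b. A $$ (pick I a, pick J b)))"
    by (simp add: minor_eq_fdet[OF assms] cong: ball_cong)
  finally show ?thesis .
qed

lemma GL_pos_complex_iff:
  "X \<in> GL_pos_complex n \<longleftrightarrow> X \<in> carrier_mat n n \<and> totally_pos n (\<lambda>i j. X $$ (i, j))"
proof
  assume "X \<in> GL_pos_complex n"
  then obtain A where A: "A \<in> GL_pos n" "X = map_mat complex_of_real A" by (auto simp: GL_pos_complex_def)
  then have c: "A \<in> carrier_mat n n" by (simp add: GL_pos_def)
  have "fdet k (\<lambda>a b. X $$ (pick I a, pick J b)) = complex_of_real (fdet k (\<lambda>a b. A $$ (pick I a, pick J b)))"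
    if "I \<in> ksub n k" "J \<in> ksub n k" for k I J
    unfolding fdet_of_real by (rule fdet_cong) (use A(2) carrier_matD[OF c] pick_less that in simp)
  then show "X \<in> carrier_mat n n \<and> totally_pos n (\<lambda>i j. X $$ (i, j))"
    using A c GL_pos_iff[OF c] by (simp add: totally_pos_def)
next
  assume X: "X \<in> carrier_mat n n \<and> totally_pos n (\<lambda>i j. X $$ (i, j))"
  define A where "A = map_mat Re X"
  have c: "A \<in> carrier_mat n n" using X by (simp add: A_def)
  \<comment> \<open>Minors of order one are the entries themselves, so taking real parts loses
    nothing.\<close>
  have re: "X $$ (i, j) = complex_of_real (A $$ (i, j))" if "i < n" "j < n" for i j
  proof -
    have "incr 1 n (\<lambda>_. i)" "incr 1 n (\<lambda>_. j)" using that by (auto simp: incr_def strict_mono_on_def)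
    then have "0 < fdet (Suc 0) (\<lambda>a b. X $$ (i, j))"
      using totally_posD[of n "\<lambda>i j. X $$ (i, j)" "Suc 0"] X that by simp
    then show ?thesis using that X by (auto simp: fdet_1 A_def less_complex_def complex_eq_iff)
  qed
  have "fdet k (\<lambda>a b. X $$ (pick I a, pick J b)) = complex_of_real (fdet k (\<lambda>a b. A $$ (pick I a, pick J b)))"
    if "I \<in> ksub n k" "J \<in> ksub n k" for k I J
    unfolding fdet_of_real by (rule fdet_cong) (use re pick_less that in simp)
  then have "A \<in> GL_pos n" using X by (simp add: GL_pos_iff[OF c] totally_pos_def)
  moreover have "X = map_mat complex_of_real A"
    by (rule eq_matI) (use X c re in auto)
  ultimately show "X \<in> GL_pos_complex n" by (auto simp: GL_pos_complex_def)
qed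

text \<open>A totally positive matrix has positive left-justified minors, and these keep their signs
  when the upper triangular factor with positive diagonal is removed.\<close>

lemma U_pos_imp:
  assumes "g \<in> U_pos n"
  shows "g \<in> unitary_group n" "left_pos n (\<lambda>i j. g $$ (i, j))"
proof -
  obtain X where X: "X \<in> carrier_mat n n" "totally_pos n (\<lambda>i j. X $$ (i, j))" and g: "g = pi_U X"
    using assms by (auto simp: U_pos_def GL_pos_complex_iff)
  note l = totally_pos_imp_left_pos[OF X(2)]
  obtain g' b where g': "g' \<in> unitary_group n" "upper_pos n b"
    "\<forall>a<n. \<forall>j<n. X $$ (a, j) = (\<Sum>i<n. g' $$ (a, i) * b i j)"
    using QR_unitary[of n "\<lambda>i j. X $$ (i, j)"] left_pos_nonzero[OF l] by blast
  have "g = g'" unfolding g using g' by (intro pi_U_eqI[OF X(1)]) auto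
  then show "g \<in> unitary_group n" "left_pos n (\<lambda>i j. g $$ (i, j))"
    using g' left_pos_mult_upper_pos[OF g'(2), of "\<lambda>i j. X $$ (i, j)" "\<lambda>i j. g' $$ (i, j)"] l by auto
qed

text \<open>The matrix \<open>H\<close> with \<open>g = g' * H\<close> has the same left-justified minors as the identity.\<close>

lemma unitary_eqI_left_minors:
  assumes g: "g \<in> unitary_group n" "g' \<in> unitary_group n"
    and eq: "\<And>k I. k \<le> n \<Longrightarrow> I \<in> ksub n k \<Longrightarrow>
      fdet k (\<lambda>a b. g $$ (pick I a, b)) = fdet k (\<lambda>a b. g' $$ (pick I a, b))"
  shows "g = g'"
proof -
  define H where "H i j = (\<Sum>l<n. cnj (g' $$ (l, i)) * g $$ (l, j))" for i j
  define D where "D i j = (if i = j then 1 else 0 :: complex)" for i j :: nat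
  have minors: "fdet k (\<lambda>a b. H (r a) b) = fdet k (\<lambda>a b. D (r a) b)"
    if "k \<le> n" "\<And>a. a < k \<Longrightarrow> r a < n" for k r
  proof -
    have "fdet k (\<lambda>a b. H (r a) b) = (\<Sum>K\<in>ksub n k. fdet k (\<lambda>a b. cnj (g' $$ (pick K b, r a))) * fdet k (\<lambda>a b. g $$ (pick K a, b)))"
      unfolding H_def by (rule Cauchy_Binet)
    also have "\<dots> = (\<Sum>K\<in>ksub n k. fdet k (\<lambda>a b. cnj (g' $$ (pick K b, r a))) * fdet k (\<lambda>a b. g' $$ (pick K a, b)))"
      by (intro sum.cong refl arg_cong2[where f="(*)"] eq that(1))
    also have "\<dots> = fdet k (\<lambda>a b. \<Sum>l<n. cnj (g' $$ (l, r a)) * g' $$ (l, b))"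
      by (rule Cauchy_Binet[symmetric])
    also have "\<dots> = fdet k (\<lambda>a b. D (r a) b)"
      by (rule fdet_cong) (use unitary_cols[OF g(2)] that in \<open>simp add: D_def\<close>)
    finally show ?thesis .
  qed
  have Hc: "\<forall>i<n. j \<le> i \<longrightarrow> H i j = D i j" if "j < n" for j
    using that
  proof (induction j rule: less_induct)
    case (less j)
    show ?case
    proof (intro allI impI)
      fix i assume i: "i < n" "j \<le> i"
      \<comment> \<open>Rows \<open>0..j-1\<close> followed by row \<open>i\<close>. With the
        earlier columns already known, this left minor is upper triangular with ones before the last
        diagonal entry, so it equals the entry at \<open>(i, j)\<close>.\<close>
      define r where "r a = (if a < j then a else i)" for a
      have red: "fdet (Suc j) (\<lambda>a b. F (r a) b) = F i j"
        if F: "\<And>i' j'. j' < j \<Longrightarrow> j' \<le> i' \<Longrightarrow> i' < n \<Longrightarrow> F i' j' = D i' j'" for F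
      proof -
        have "fdet (Suc j) (\<lambda>a b. F (r a) b) = (\<Prod>a<Suc j. F (r a) a)"
        proof (rule fdet_upper_triangular)
          fix a b assume "b < a" "a < Suc j"
          then show "F (r a) b = 0"
            using F[of b "r a"] i less.prems by (auto simp: r_def D_def)
        qed
        also have "\<dots> = (\<Prod>a<j. F (r a) a) * F i j" by (simp add: r_def)
        also have "(\<Prod>a<j. F (r a) a) = 1"
          by (rule prod.neutral) (use F less.prems in \<open>simp add: r_def D_def\<close>)
        finally show ?thesis by simp
      qed
      have "H i j = fdet (Suc j) (\<lambda>a b. H (r a) b)"
        using less by (intro red[symmetric]) simp
      also have "\<dots> = fdet (Suc j) (\<lambda>a b. D (r a) b)"
        by (rule minors) (use i less.prems in \<open>auto simp: r_def\<close>)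
      also have "\<dots> = D i j" by (rule red) simp
      finally show "H i j = D i j" .
    qed
  qed
  have gH: "g $$ (a, j) = (\<Sum>i<n. g' $$ (a, i) * H i j)" if "a < n" "j < n" for a j
  proof -
    have "(\<Sum>i<n. g' $$ (a, i) * H i j) = (\<Sum>l<n. (\<Sum>i<n. g' $$ (a, i) * cnj (g' $$ (l, i))) * g $$ (l, j))"
      unfolding H_def sum_distrib_left sum_distrib_right by (subst sum.swap) (simp add: mult.assoc)
    also have "\<dots> = (\<Sum>l<n. if a = l then g $$ (l, j) else 0)"
      using unitary_rows[OF g(2) that(1)] by (intro sum.cong) auto
    finally show ?thesis using that by simp
  qed
  have up: "upper_pos n D" "upper_pos n H"
    using Hc by (auto simp: upper_pos_def D_def complex_zero_less_one)
  show ?thesis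
  proof (rule unitary_upper_pos_unique[OF g up])
    fix a j assume "a < n" "j < n"
    then show "(\<Sum>i<n. g $$ (a, i) * D i j) = (\<Sum>i<n. g' $$ (a, i) * H i j)"
      using gH by (simp add: D_def if_distrib[where f="\<lambda>x. _ * x"] cong: if_cong)
  qed
qed

text \<open>The complex conjugate of \<open>g\<close> is unitary with the conjugated left minors.
  Those are real, so \<open>unitary_eqI_left_minors\<close> identifies it with
  \<open>g\<close>.\<close>

lemma left_pos_unitary_real:
  assumes g: "g \<in> unitary_group n" and l: "left_pos n (\<lambda>i j. g $$ (i, j))" and ij: "i < n" "j < n"
  shows "cnj (g $$ (i, j)) = g $$ (i, j)"
proof -
  note c = unitary_carrier[OF g]
  have "map_mat cnj g = g"
  proof (rule unitary_eqI_left_minors[OF _ g])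
    show "map_mat cnj g \<in> unitary_group n"
      unfolding unitary_iff
    proof (intro conjI allI impI)
      fix i j assume ij: "i < n" "j < n"
      have "(\<Sum>l<n. cnj (map_mat cnj g $$ (l, i)) * map_mat cnj g $$ (l, j)) = cnj (\<Sum>l<n. cnj (g $$ (l, i)) * g $$ (l, j))"
        using c ij by simp
      also have "\<dots> = (if i = j then 1 else 0)" using unitary_cols[OF g ij] by simp
      finally show "(\<Sum>l<n. cnj (map_mat cnj g $$ (l, i)) * map_mat cnj g $$ (l, j)) = (if i = j then 1 else 0)" .
    qed (use c in simp)
    fix k I assume k: "k \<le> n" "I \<in> ksub n k"
    have "fdet k (\<lambda>a b. map_mat cnj g $$ (pick I a, b)) = fdet k (\<lambda>a b. cnj (g $$ (pick I a, b)))"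
      by (rule fdet_cong) (use c k pick_less in simp)
    also have "\<dots> = cnj (fdet k (\<lambda>a b. g $$ (pick I a, b)))" by (rule fdet_cnj[symmetric])
    also have "\<dots> = fdet k (\<lambda>a b. g $$ (pick I a, b))"
      using l k by (auto simp: left_pos_def less_complex_def complex_eq_iff)
    finally show "fdet k (\<lambda>a b. map_mat cnj g $$ (pick I a, b)) = fdet k (\<lambda>a b. g $$ (pick I a, b))" .
  qed
  then have "map_mat cnj g $$ (i, j) = g $$ (i, j)" by simp
  then show ?thesis using c ij by simp
qed

lemma sum_pick_gt:
  assumes K: "K \<in> ksub n k" "K \<noteq> {..<k}"
  shows "(\<Sum>b<k. b) < (\<Sum>b<k. pick K b)"
proof (rule sum_strict_mono_ex1)
  show "\<forall>b\<in>{..<k}. b \<le> pick K b" using incr_ge[OF incr_pick[OF K(1)]] by simp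
  show "\<exists>b\<in>{..<k}. b < pick K b"
  proof (rule ccontr)
    assume "\<not> ?thesis"
    then have "pick K b = b" if "b < k" for b
      using incr_ge[OF incr_pick[OF K(1)] that] that by (metis lessThan_iff nat_less_le)
    then have "pick K ` {..<k} = {..<k}" by simp
    then show False using pick_image_ksub[OF K(1)] K(2) by simp
  qed
qed simp

text \<open>Multiplying \<open>g\<close> by \<open>diag (1, e, e\<^sup>2, \<dots>)\<close> and a suitable upper triangular matrix makes the
  left-justified minors of \<open>g\<close> dominate in the Cauchy--Binet expansion of every minor.\<close>

lemma U_posI:
  assumes g: "g \<in> unitary_group n" and l: "left_pos n (\<lambda>i j. g $$ (i, j))"
  shows "g \<in> U_pos n"
proof -
  define R where "R i j = Re (g $$ (i, j))" for i j
  have gR: "g $$ (i, j) = complex_of_real (R i j)" if "i < n" "j < n" for i j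
    using left_pos_unitary_real[OF g l that] by (simp add: R_def complex_eq_iff)
  have Rpos: "0 < fdet k (\<lambda>a b. R (pick I a) b)" if "k \<le> n" "I \<in> ksub n k" for k I
  proof -
    have "fdet k (\<lambda>a b. g $$ (pick I a, b)) = complex_of_real (fdet k (\<lambda>a b. R (pick I a) b))"
      unfolding fdet_of_real by (rule fdet_cong) (use gR pick_less that in simp)
    moreover have "0 < fdet k (\<lambda>a b. g $$ (pick I a, b))" using l that unfolding left_pos_def by blast
    ultimately show ?thesis by simp
  qed
  have "\<forall>\<^sub>F q in at_right (0::real). (\<forall>k\<le>n. \<forall>J\<in>ksub n k.
     0 < fdet k (\<lambda>a b. (if a \<le> pick J b then q ^ sq_dist a (pick J b) else 0))) \<and> 0 < q"
    by (intro eventually_conj eventually_upper_initial_minors_pos eventually_at_right_less)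
  then obtain q :: real where q: "0 < q" "\<And>k J. k \<le> n \<Longrightarrow> J \<in> ksub n k \<Longrightarrow>
     0 < fdet k (\<lambda>a b. (if a \<le> pick J b then q ^ sq_dist a (pick J b) else 0))"
    using eventually_happens'[OF trivial_limit_at_right_real] by blast
  define u where "u i j = (if i \<le> j then q ^ sq_dist i j else 0)" for i j
  have u_pos: "0 < fdet k (\<lambda>a b. u a (pick J b))" if "k \<le> n" "J \<in> ksub n k" for k J
    unfolding u_def by (rule q(2)[OF that])
  define h where "h e i j = (\<Sum>l<n. (R i l * e ^ l) * u l j)" for e :: real and i j
  have "\<forall>\<^sub>F e in at_right 0. (\<forall>k\<le>n. \<forall>I\<in>ksub n k. \<forall>J\<in>ksub n k. 0 < fdet k (\<lambda>a b. h e (pick I a) (pick J b))) \<and> 0 < e"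
  proof (intro eventually_conj eventually_at_right_less eventually_all_minors)
    fix k I J assume k: "k \<le> n" and I: "I \<in> ksub n k" and J: "J \<in> ksub n k"
    \<comment> \<open>In the Cauchy--Binet sum the set \<open>K\<close> carries the factor
      \<open>e ^ w K\<close>. The exponent is strictly smallest for \<open>{..<k}\<close>, whose
      coefficient is a left minor of \<open>R\<close> times a top minor of \<open>u\<close>, both
      positive.\<close>
    define w where "w K = (\<Sum>b<k. pick K b)" for K
    define f where "f K = fdet k (\<lambda>a b. R (pick I a) (pick K b)) * fdet k (\<lambda>a b. u (pick K a) (pick J b))" for K
    define G where "G e = (\<Sum>K\<in>ksub n k. f K * e ^ (w K - (\<Sum>b<k. b)))" for e :: real
    have w0: "w {..<k} = (\<Sum>b<k. b)" unfolding w_def by (intro sum.cong) (auto simp: pick_lessThan)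
    have wgt: "(\<Sum>b<k. b) < w K" if "K \<in> ksub n k" "K \<noteq> {..<k}" for K
      unfolding w_def by (rule sum_pick_gt[OF that])
    have eq: "fdet k (\<lambda>a b. h e (pick I a) (pick J b)) = e ^ (\<Sum>b<k. b) * G e" for e
    proof -
      have "fdet k (\<lambda>a b. h e (pick I a) (pick J b)) =
        (\<Sum>K\<in>ksub n k. fdet k (\<lambda>a b. R (pick I a) (pick K b) * e ^ pick K b) * fdet k (\<lambda>a b. u (pick K a) (pick J b)))"
        unfolding h_def by (rule Cauchy_Binet)
      also have "\<dots> = (\<Sum>K\<in>ksub n k. e ^ (\<Sum>b<k. b) * (f K * e ^ (w K - (\<Sum>b<k. b))))"
      proof (rule sum.cong[OF refl])
        fix K assume K: "K \<in> ksub n k"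
        have "w K = (\<Sum>b<k. b) + (w K - (\<Sum>b<k. b))" using wgt[OF K] w0 by (cases "K = {..<k}") auto
        then have "e ^ w K = e ^ (\<Sum>b<k. b) * e ^ (w K - (\<Sum>b<k. b))" by (metis power_add)
        then show "fdet k (\<lambda>a b. R (pick I a) (pick K b) * e ^ pick K b) * fdet k (\<lambda>a b. u (pick K a) (pick J b))
          = e ^ (\<Sum>b<k. b) * (f K * e ^ (w K - (\<Sum>b<k. b)))"
          unfolding fdet_scale_cols[of k "\<lambda>a b. R (pick I a) (pick K b)"] f_def
          by (simp add: power_sum[symmetric] w_def[symmetric])
      qed
      finally show ?thesis by (simp add: G_def sum_distrib_left)
    qed
    have "(G \<longlongrightarrow> (\<Sum>K\<in>ksub n k. f K * 0 ^ (w K - (\<Sum>b<k. b)))) (at_right 0)"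
      unfolding G_def by (intro tendsto_intros)
    also have "(\<Sum>K\<in>ksub n k. f K * 0 ^ (w K - (\<Sum>b<k. b))) = (\<Sum>K\<in>ksub n k. if K = {..<k} then f K else 0)"
      using wgt w0 by (intro sum.cong) auto
    also have "\<dots> = f {..<k}" using lessThan_ksub[OF k] by simp
    finally have lim: "(G \<longlongrightarrow> f {..<k}) (at_right 0)" .
    have "f {..<k} = fdet k (\<lambda>a b. R (pick I a) b) * fdet k (\<lambda>a b. u a (pick J b))"
      unfolding f_def by (intro arg_cong2[where f="(*)"] fdet_cong) (simp_all add: pick_lessThan)
    then have "0 < f {..<k}" using Rpos[OF k I] u_pos[OF k J] by simp
    then have "\<forall>\<^sub>F e in at_right 0. 0 < G e" using lim by (rule order_tendstoD(1)[rotated])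
    moreover have "\<forall>\<^sub>F e in at_right 0. (0::real) < e" by (rule eventually_at_right_less)
    ultimately show "\<forall>\<^sub>F e in at_right 0. 0 < fdet k (\<lambda>a b. h e (pick I a) (pick J b))"
      by eventually_elim (simp add: eq)
  qed
  then obtain e :: real where e: "0 < e" "\<forall>k\<le>n. \<forall>I\<in>ksub n k. \<forall>J\<in>ksub n k. 0 < fdet k (\<lambda>a b. h e (pick I a) (pick J b))"
    using eventually_happens'[OF trivial_limit_at_right_real] by blast
  define X where "X = mat n n (\<lambda>(i, j). complex_of_real (h e i j))"
  have Xc: "X \<in> carrier_mat n n" by (simp add: X_def)
  have "totally_pos n (\<lambda>i j. X $$ (i, j))"
    unfolding totally_pos_def
  proof (intro allI impI ballI)
    fix k I J assume k: "k \<le> n" "I \<in> ksub n k" "J \<in> ksub n k"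
    have "fdet k (\<lambda>a b. X $$ (pick I a, pick J b)) = complex_of_real (fdet k (\<lambda>a b. h e (pick I a) (pick J b)))"
      unfolding fdet_of_real X_def by (rule fdet_cong) (use pick_less k in simp)
    then show "0 < fdet k (\<lambda>a b. X $$ (pick I a, pick J b))" using e k by simp
  qed
  then have "X \<in> GL_pos_complex n" using Xc by (simp add: GL_pos_complex_iff)
  moreover have "pi_U X = g"
  proof (rule pi_U_eqI[OF Xc g])
    show "upper_pos n (\<lambda>i j. complex_of_real (e ^ i * u i j))"
      using e q(1) by (auto simp: upper_pos_def u_def simp del: of_real_mult of_real_power)
    fix a j assume "a < n" "j < n"
    then show "X $$ (a, j) = (\<Sum>i<n. g $$ (a, i) * complex_of_real (e ^ i * u i j))"
      using gR by (simp add: X_def h_def mult.assoc)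
  qed
  ultimately show ?thesis by (force simp: U_pos_def)
qed

lemma U_pos_iff: "g \<in> U_pos n \<longleftrightarrow> g \<in> unitary_group n \<and> left_pos n (\<lambda>i j. g $$ (i, j))"
  using U_pos_imp U_posI by blast

section \<open>A Perron--Frobenius argument\<close>

text \<open>The vector of absolute values of a top eigenvector maximises the Rayleigh quotient, hence is
  itself a top eigenvector; comparing the two eigenvector equations aligns the phases.\<close>

lemma top_eigenvector_phases:
  fixes C :: "'i \<Rightarrow> 'i \<Rightarrow> complex" and \<rho> :: "'i \<Rightarrow> real" and M :: "'i \<Rightarrow> 'i \<Rightarrow> real"
  assumes S: "finite S" "K0 \<in> S"
    and rows: "\<And>I J. I \<in> S \<Longrightarrow> J \<in> S \<Longrightarrow> (\<Sum>K\<in>S. C I K * cnj (C J K)) = (if I = J then 1 else 0)"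
    and cols: "\<And>K K'. K \<in> S \<Longrightarrow> K' \<in> S \<Longrightarrow> (\<Sum>I\<in>S. cnj (C I K) * C I K') = (if K = K' then 1 else 0)"
    and top: "\<And>K. K \<in> S \<Longrightarrow> \<rho> K \<le> \<rho> K0"
    and N: "\<And>I J. I \<in> S \<Longrightarrow> J \<in> S \<Longrightarrow> of_real (M I J) = (\<Sum>K\<in>S. C I K * of_real (\<rho> K) * cnj (C J K))"
    and M: "\<And>I J. I \<in> S \<Longrightarrow> J \<in> S \<Longrightarrow> 0 \<le> M I J"
    and IJ: "I \<in> S" "J \<in> S" "0 < M I J" "C J K0 \<noteq> 0"
  shows "C I K0 \<noteq> 0 \<and> cnj (C I K0) * C J K0 = of_real (cmod (C I K0) * cmod (C J K0))"
proof -
  define v where "v I = C I K0" for I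
  define x where "x I = cmod (v I)" for I
  \<comment> \<open>Coordinates of the vector of moduli \<open>x\<close> in the orthonormal
    eigenbasis given by the columns of \<open>C\<close>. The identity \<open>quad\<close> below then
    yields the Rayleigh form for \<open>a = \<rho>\<close> and Parseval's identity for
    \<open>a = 1\<close>.\<close>
  define y where "y K = (\<Sum>J\<in>S. cnj (C J K) * of_real (x J))" for K
  have cy: "cnj (y K) = (\<Sum>I\<in>S. of_real (x I) * C I K)" for K
    by (simp add: y_def mult.commute)
  have yy: "cnj (y K) * y K = of_real ((cmod (y K))\<^sup>2)" for K
    by (simp only: complex_norm_square mult.commute)
  have vv: "cnj (v I) * v I = of_real (x I * x I)" for I
    by (simp only: complex_norm_square mult.commute x_def flip: power2_eq_square)
  have quad: "(\<Sum>K\<in>S. a K * (\<Sum>I\<in>S. of_real (x I) * C I K) * (\<Sum>J\<in>S. cnj (C J K) * of_real (x J))) =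
      (\<Sum>I\<in>S. \<Sum>J\<in>S. of_real (x I) * (\<Sum>K\<in>S. C I K * a K * cnj (C J K)) * of_real (x J))" for a
  proof -
    have "(\<Sum>K\<in>S. a K * (\<Sum>I\<in>S. of_real (x I) * C I K) * (\<Sum>J\<in>S. cnj (C J K) * of_real (x J)))
      = (\<Sum>K\<in>S. \<Sum>I\<in>S. \<Sum>J\<in>S. of_real (x I) * (C I K * a K * cnj (C J K)) * of_real (x J))"
      by (simp add: sum_distrib_left sum_distrib_right mult_ac)
    also have "\<dots> = (\<Sum>I\<in>S. \<Sum>K\<in>S. \<Sum>J\<in>S. of_real (x I) * (C I K * a K * cnj (C J K)) * of_real (x J))"
      by (rule sum.swap)
    also have "\<dots> = (\<Sum>I\<in>S. \<Sum>J\<in>S. \<Sum>K\<in>S. of_real (x I) * (C I K * a K * cnj (C J K)) * of_real (x J))"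
      by (intro sum.cong refl sum.swap)
    finally show ?thesis by (simp add: sum_distrib_left sum_distrib_right)
  qed
  have "of_real (\<Sum>K\<in>S. \<rho> K * (cmod (y K))\<^sup>2) = (\<Sum>K\<in>S. of_real (\<rho> K) * cnj (y K) * y K)"
    unfolding of_real_sum of_real_mult by (simp only: mult.assoc yy)
  also have "\<dots> = (\<Sum>I\<in>S. \<Sum>J\<in>S. of_real (x I) * of_real (M I J) * of_real (x J))"
    unfolding cy unfolding y_def quad by (intro sum.cong refl) (simp add: N)
  finally have "complex_of_real (\<Sum>K\<in>S. \<rho> K * (cmod (y K))\<^sup>2) = of_real (\<Sum>I\<in>S. \<Sum>J\<in>S. x I * M I J * x J)"
    by simp
  then have form: "(\<Sum>K\<in>S. \<rho> K * (cmod (y K))\<^sup>2) = (\<Sum>I\<in>S. \<Sum>J\<in>S. x I * M I J * x J)"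
    using of_real_eq_iff by blast
  have "of_real (\<Sum>K\<in>S. (cmod (y K))\<^sup>2) = (\<Sum>K\<in>S. 1 * cnj (y K) * y K)"
    unfolding of_real_sum by (simp add: yy)
  also have "\<dots> = (\<Sum>I\<in>S. \<Sum>J\<in>S. of_real (x I) * (if I = J then 1 else 0) * of_real (x J))"
    unfolding cy unfolding y_def quad by (intro sum.cong refl) (simp add: rows)
  also have "\<dots> = (\<Sum>I\<in>S. \<Sum>J\<in>S. if I = J then of_real (x I * x J) else 0)"
    by (intro sum.cong refl) auto
  also have "\<dots> = of_real (\<Sum>I\<in>S. x I * x I)"
    using S by simp
  finally have nrm: "(\<Sum>K\<in>S. (cmod (y K))\<^sup>2) = (\<Sum>I\<in>S. x I * x I)"
    using of_real_eq_iff by blast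
  have eig: "(\<Sum>J\<in>S. of_real (M I J) * v J) = of_real (\<rho> K0) * v I" if "I \<in> S" for I
  proof -
    have "(\<Sum>J\<in>S. of_real (M I J) * v J) = (\<Sum>J\<in>S. \<Sum>K\<in>S. C I K * of_real (\<rho> K) * (cnj (C J K) * v J))"
      using that by (intro sum.cong refl) (simp add: N sum_distrib_right mult.assoc)
    also have "\<dots> = (\<Sum>K\<in>S. C I K * of_real (\<rho> K) * (\<Sum>J\<in>S. cnj (C J K) * v J))"
      by (subst sum.swap) (simp add: sum_distrib_left)
    also have "\<dots> = (\<Sum>K\<in>S. if K = K0 then C I K * of_real (\<rho> K) else 0)"
      using S by (intro sum.cong refl) (simp add: v_def cols)
    finally show ?thesis using S by (simp add: v_def)
  qed
  have "\<rho> K0 * (\<Sum>I\<in>S. x I * x I) \<le> (\<Sum>I\<in>S. \<Sum>J\<in>S. x I * M I J * x J)"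
  proof -
    have "of_real (\<rho> K0 * (\<Sum>I\<in>S. x I * x I)) = (\<Sum>I\<in>S. cnj (v I) * (\<Sum>J\<in>S. of_real (M I J) * v J))"
    proof -
      have "(\<Sum>I\<in>S. cnj (v I) * (\<Sum>J\<in>S. of_real (M I J) * v J)) = (\<Sum>I\<in>S. of_real (\<rho> K0) * (cnj (v I) * v I))"
        by (intro sum.cong refl) (simp add: eig)
      then show ?thesis by (simp add: vv sum_distrib_left del: of_real_mult) (simp add: sum_distrib_left)
    qed
    then have "\<rho> K0 * (\<Sum>I\<in>S. x I * x I) = Re (\<Sum>I\<in>S. cnj (v I) * (\<Sum>J\<in>S. of_real (M I J) * v J))"
      by (metis Re_complex_of_real)
    also have "\<dots> = (\<Sum>I\<in>S. \<Sum>J\<in>S. Re (cnj (v I) * (of_real (M I J) * v J)))"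
      by (simp only: sum_distrib_left Re_sum)
    also have "\<dots> \<le> (\<Sum>I\<in>S. \<Sum>J\<in>S. x I * M I J * x J)"
    proof (intro sum_mono)
      fix I J assume "I \<in> S" "J \<in> S"
      have "Re (cnj (v I) * (of_real (M I J) * v J)) \<le> cmod (cnj (v I) * (of_real (M I J) * v J))"
        by (rule complex_Re_le_cmod)
      also have "\<dots> = x I * M I J * x J" using M[OF \<open>I \<in> S\<close> \<open>J \<in> S\<close>] by (simp add: x_def norm_mult)
      finally show "Re (cnj (v I) * (of_real (M I J) * v J)) \<le> x I * M I J * x J" .
    qed
    finally show ?thesis .
  qed
  then have "(\<Sum>K\<in>S. (\<rho> K0 - \<rho> K) * (cmod (y K))\<^sup>2) \<le> 0"
    unfolding nrm[symmetric] form[symmetric] by (simp add: left_diff_distrib sum_subtractf sum_distrib_left)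
  moreover have nn: "0 \<le> (\<rho> K0 - \<rho> K) * (cmod (y K))\<^sup>2" if "K \<in> S" for K using top[OF that] by simp
  ultimately have "(\<Sum>K\<in>S. (\<rho> K0 - \<rho> K) * (cmod (y K))\<^sup>2) = 0"
    by (meson order_antisym sum_nonneg)
  then have "\<forall>K\<in>S. (\<rho> K0 - \<rho> K) * (cmod (y K))\<^sup>2 = 0"
    using sum_nonneg_eq_0_iff[OF S(1), of "\<lambda>K. (\<rho> K0 - \<rho> K) * (cmod (y K))\<^sup>2"] nn by blast
  \<comment> \<open>The Rayleigh quotient of \<open>x\<close> is an average of the
    \<open>\<rho> K\<close> with weights \<open>(cmod (y K))\<^sup>2\<close> and is not below the
    maximum. So \<open>y\<close> lives on indices with \<open>\<rho> K = \<rho> K0\<close>, and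
    \<open>x\<close> lies in the top eigenspace, whatever its dimension.\<close>
  then have ry: "of_real (\<rho> K) * y K = of_real (\<rho> K0) * y K" if "K \<in> S" for K
    using that by fastforce
  have eigx: "(\<Sum>J\<in>S. M I J * x J) = \<rho> K0 * x I" if "I \<in> S" for I
  proof -
    have "of_real (\<Sum>J\<in>S. M I J * x J) = (\<Sum>J\<in>S. \<Sum>K\<in>S. C I K * of_real (\<rho> K) * (cnj (C J K) * of_real (x J)))"
      unfolding of_real_sum using that by (intro sum.cong refl) (simp add: N sum_distrib_right mult.assoc)
    also have "\<dots> = (\<Sum>K\<in>S. C I K * (of_real (\<rho> K) * y K))"
      by (subst sum.swap) (simp add: sum_distrib_left y_def mult.assoc)
    also have "\<dots> = (\<Sum>K\<in>S. C I K * (of_real (\<rho> K0) * y K))"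
      by (intro sum.cong refl arg_cong2[where f="(*)"] ry)
    also have "\<dots> = (\<Sum>K\<in>S. \<Sum>J\<in>S. of_real (\<rho> K0) * (of_real (x J) * (C I K * cnj (C J K))))"
      by (simp add: y_def sum_distrib_left mult_ac)
    also have "\<dots> = (\<Sum>J\<in>S. of_real (\<rho> K0) * (of_real (x J) * (\<Sum>K\<in>S. C I K * cnj (C J K))))"
      by (subst sum.swap) (simp add: sum_distrib_left)
    also have "\<dots> = (\<Sum>J\<in>S. if I = J then of_real (\<rho> K0 * x J) else 0)"
      using that by (intro sum.cong refl) (simp add: rows)
    also have "\<dots> = of_real (\<rho> K0 * x I)" using S that by simp
    finally show ?thesis using of_real_eq_iff by blast
  qed
  have xJ: "0 < x J" using IJ by (simp add: x_def v_def)
  have vI: "v I \<noteq> 0"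
  proof
    assume "v I = 0"
    then have "(\<Sum>J\<in>S. M I J * x J) = 0" using eigx[OF IJ(1)] by (simp add: x_def)
    moreover have "0 \<le> M I J * x J" if "J \<in> S" for J using M[OF IJ(1) that] by (simp add: x_def)
    ultimately have "\<forall>J\<in>S. M I J * x J = 0"
      using sum_nonneg_eq_0_iff[OF S(1), of "\<lambda>J. M I J * x J"] by blast
    then have "M I J * x J = 0" using IJ(2) by blast
    then show False using IJ(3) xJ by simp
  qed
  \<comment> \<open>Row \<open>I\<close> of the eigenvector equations for \<open>v\<close> and for
    \<open>x\<close> gives the same value, so the \<open>M\<close>-weighted gaps between modulus and
    real part sum to zero. None is negative, and hence the gap vanishes wherever
    \<open>0 < M I J\<close>.\<close>
  have "(\<Sum>J\<in>S. M I J * (x I * x J - Re (cnj (v I) * v J))) = 0"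
  proof -
    have "(\<Sum>J\<in>S. M I J * Re (cnj (v I) * v J)) = Re (cnj (v I) * (\<Sum>J\<in>S. of_real (M I J) * v J))"
      unfolding sum_distrib_left Re_sum by (intro sum.cong refl) (simp add: algebra_simps)
    also have "\<dots> = Re (of_real (\<rho> K0) * (cnj (v I) * v I))" by (simp only: eig[OF IJ(1)] mult.left_commute)
    also have "\<dots> = \<rho> K0 * (x I * x I)" unfolding vv by simp
    also have "\<dots> = (\<Sum>J\<in>S. M I J * (x I * x J))"
      using eigx[OF IJ(1)] by (simp add: mult.left_commute flip: sum_distrib_left)
    finally show ?thesis by (simp add: right_diff_distrib sum_subtractf)
  qed
  moreover have le: "Re (cnj (v I) * v J) \<le> x I * x J" for J
    using complex_Re_le_cmod[of "cnj (v I) * v J"] by (simp add: x_def norm_mult)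
  moreover have "0 \<le> M I J * (x I * x J - Re (cnj (v I) * v J))" if "J \<in> S" for J
    using M[OF IJ(1) that] le[of J] by simp
  ultimately have "\<forall>J\<in>S. M I J * (x I * x J - Re (cnj (v I) * v J)) = 0"
    using sum_nonneg_eq_0_iff[OF S(1), of "\<lambda>J. M I J * (x I * x J - Re (cnj (v I) * v J))"] by blast
  then have "M I J * (x I * x J - Re (cnj (v I) * v J)) = 0" using IJ(2) by blast
  then have re: "Re (cnj (v I) * v J) = cmod (cnj (v I) * v J)"
    using IJ(3) by (simp add: x_def norm_mult)
  then have "Im (cnj (v I) * v J) = 0"
    using cmod_power2[of "cnj (v I) * v J"] by (simp del: complex_mod_cnj norm_mult)
  then have "cnj (v I) * v J = of_real (cmod (cnj (v I) * v J))"
    using re by (simp add: complex_eq_iff del: norm_mult)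
  then show ?thesis using vI by (simp add: v_def norm_mult)
qed

section \<open>Functional calculus and compound matrices\<close>

text \<open>Entry of \<open>g\<close> times \<open>diag \<mu>\<close> times the adjoint of
  \<open>g\<close>. With the eigenvalues as an argument, powers, shifts and spectral projections of
  one matrix differ only in \<open>\<mu>\<close> and share \<open>g\<close>.\<close>

definition udiag :: "nat \<Rightarrow> complex mat \<Rightarrow> (nat \<Rightarrow> real) \<Rightarrow> nat \<Rightarrow> nat \<Rightarrow> complex" where
  "udiag n g \<mu> i j = (\<Sum>l<n. g $$ (i, l) * of_real (\<mu> l) * cnj (g $$ (j, l)))"

lemma conj_diag_carrier: "g \<in> carrier_mat n n \<Longrightarrow> conj_diag n lam g \<in> carrier_mat n n"
  by (auto simp: conj_diag_def)

lemma conj_diag_index: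
  assumes g: "g \<in> carrier_mat n n" and ij: "i < n" "j < n"
  shows "conj_diag n lam g $$ (i, j) = \<i> * udiag n g (\<lambda>l. lam $ l) i j"
proof -
  let ?D = "\<i> \<cdot>\<^sub>m mat_diag n (\<lambda>i. complex_of_real (lam $ i))"
  have D: "?D \<in> carrier_mat n n" by simp
  have gD: "(g * ?D) $$ (i, l) = \<i> * (g $$ (i, l) * of_real (lam $ l))" if "l < n" for l
  proof -
    have "g * ?D = \<i> \<cdot>\<^sub>m (g * mat_diag n (\<lambda>i. complex_of_real (lam $ i)))"
      by (rule mult_smult_distrib[OF g mat_diag_dim])
    then show ?thesis using that ij g by (simp add: mat_diag_mult_right[OF g])
  qed
  have gDc: "g * ?D \<in> carrier_mat n n" using g D by (rule mult_carrier_mat)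
  have "conj_diag n lam g $$ (i, j) = (\<Sum>l<n. (g * ?D) $$ (i, l) * mat_adjoint g $$ (l, j))"
    unfolding conj_diag_def by (rule index_mult_sum[OF gDc mat_adjoint_carrier[OF g] ij])
  also have "\<dots> = (\<Sum>l<n. \<i> * (g $$ (i, l) * of_real (lam $ l) * cnj (g $$ (j, l))))"
    using ij g gD by (intro sum.cong) (simp_all add: mult.assoc)
  finally show ?thesis by (simp add: udiag_def sum_distrib_left)
qed

lemma smult_eq_conj_diag_iff:
  assumes L: "L \<in> carrier_mat n n" and g: "g \<in> carrier_mat n n"
  shows "\<i> \<cdot>\<^sub>m L = conj_diag n lam g \<longleftrightarrow> (\<forall>i<n. \<forall>j<n. L $$ (i, j) = udiag n g (\<lambda>l. lam $ l) i j)"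
proof -
  have "\<i> \<cdot>\<^sub>m L = conj_diag n lam g \<longleftrightarrow> (\<forall>i<n. \<forall>j<n. \<i> * L $$ (i, j) = \<i> * udiag n g (\<lambda>l. lam $ l) i j)"
    using L conj_diag_carrier[OF g, of lam] conj_diag_index[OF g]
    by (auto simp: mat_eq_iff)
  then show ?thesis by simp
qed

lemma udiag_mult:
  assumes g: "g \<in> unitary_group n"
  shows "(\<Sum>m<n. udiag n g \<mu> i m * udiag n g \<nu> m j) = udiag n g (\<lambda>l. \<mu> l * \<nu> l) i j"
proof -
  have "(\<Sum>m<n. udiag n g \<mu> i m * udiag n g \<nu> m j) =
     (\<Sum>m<n. \<Sum>k<n. \<Sum>l<n. g $$ (i, k) * of_real (\<mu> k) * (cnj (g $$ (m, k)) * g $$ (m, l)) * (of_real (\<nu> l) * cnj (g $$ (j, l))))"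
    unfolding udiag_def sum_product by (simp add: mult.assoc)
  also have "\<dots> = (\<Sum>k<n. \<Sum>m<n. \<Sum>l<n. g $$ (i, k) * of_real (\<mu> k) * (cnj (g $$ (m, k)) * g $$ (m, l)) * (of_real (\<nu> l) * cnj (g $$ (j, l))))"
    by (rule sum.swap)
  also have "\<dots> = (\<Sum>k<n. \<Sum>l<n. \<Sum>m<n. g $$ (i, k) * of_real (\<mu> k) * (cnj (g $$ (m, k)) * g $$ (m, l)) * (of_real (\<nu> l) * cnj (g $$ (j, l))))"
    by (intro sum.cong refl sum.swap)
  also have "\<dots> = (\<Sum>k<n. \<Sum>l<n. g $$ (i, k) * of_real (\<mu> k) * (\<Sum>m<n. cnj (g $$ (m, k)) * g $$ (m, l)) * (of_real (\<nu> l) * cnj (g $$ (j, l))))"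
    by (simp add: sum_distrib_left sum_distrib_right)
  also have "\<dots> = (\<Sum>k<n. \<Sum>l<n. if k = l then g $$ (i, k) * of_real (\<mu> k) * (of_real (\<nu> l) * cnj (g $$ (j, l))) else 0)"
    by (intro sum.cong refl) (simp add: unitary_cols[OF g])
  also have "\<dots> = udiag n g (\<lambda>l. \<mu> l * \<nu> l) i j"
    unfolding udiag_def by (intro sum.cong) simp_all
  finally show ?thesis .
qed

lemma udiag_power:
  assumes g: "g \<in> unitary_group n" and L: "L \<in> carrier_mat n n"
    and eq: "\<And>i j. i < n \<Longrightarrow> j < n \<Longrightarrow> L $$ (i, j) = udiag n g \<mu> i j"
  shows "i < n \<Longrightarrow> j < n \<Longrightarrow> (L ^\<^sub>m m) $$ (i, j) = udiag n g (\<lambda>l. \<mu> l ^ m) i j"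
proof (induction m arbitrary: i j)
  case 0
  then show ?case using L unitary_rows[OF g 0] by (simp add: udiag_def)
next
  case (Suc m)
  have "(L ^\<^sub>m Suc m) $$ (i, j) = (\<Sum>l<n. (L ^\<^sub>m m) $$ (i, l) * L $$ (l, j))"
    using index_mult_sum[OF pow_carrier_mat[OF L] L Suc.prems] by simp
  also have "\<dots> = (\<Sum>l<n. udiag n g (\<lambda>l. \<mu> l ^ m) i l * udiag n g \<mu> l j)"
    using Suc eq by (intro sum.cong) simp_all
  finally show ?case unfolding udiag_mult[OF g] by (simp add: mult.commute)
qed

text \<open>Diagonalisation of the \<open>k\<close>-th compound matrix: its eigenvectors are the
  columns of the compound of \<open>g\<close>, its eigenvalues the products of \<open>k\<close> of
  the \<open>\<mu>\<close>.\<close>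

lemma minor_udiag:
  "fdet k (\<lambda>a b. udiag n g \<mu> (r a) (c b)) = (\<Sum>K\<in>ksub n k. fdet k (\<lambda>a b. g $$ (r a, pick K b)) *
     of_real (\<Prod>b<k. \<mu> (pick K b)) * cnj (fdet k (\<lambda>a b. g $$ (c a, pick K b))))"
proof -
  have "fdet k (\<lambda>a b. udiag n g \<mu> (r a) (c b)) = (\<Sum>K\<in>ksub n k.
     fdet k (\<lambda>a b. g $$ (r a, pick K b) * of_real (\<mu> (pick K b))) * fdet k (\<lambda>a b. cnj (g $$ (c b, pick K a))))"
    unfolding udiag_def by (rule Cauchy_Binet)
  also have "\<dots> = (\<Sum>K\<in>ksub n k. fdet k (\<lambda>a b. g $$ (r a, pick K b)) *
     of_real (\<Prod>b<k. \<mu> (pick K b)) * cnj (fdet k (\<lambda>a b. g $$ (c a, pick K b))))"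
  proof (rule sum.cong[OF refl])
    fix K
    have "fdet k (\<lambda>a b. cnj (g $$ (c b, pick K a))) = cnj (fdet k (\<lambda>a b. g $$ (c a, pick K b)))"
      unfolding fdet_cnj by (rule fdet_transpose[of k "\<lambda>a b. cnj (g $$ (c a, pick K b))"])
    then show "fdet k (\<lambda>a b. g $$ (r a, pick K b) * of_real (\<mu> (pick K b))) * fdet k (\<lambda>a b. cnj (g $$ (c b, pick K a)))
      = fdet k (\<lambda>a b. g $$ (r a, pick K b)) * of_real (\<Prod>b<k. \<mu> (pick K b)) * cnj (fdet k (\<lambda>a b. g $$ (c a, pick K b)))"
      by (simp add: fdet_scale_cols[of k "\<lambda>a b. g $$ (r a, pick K b)"])
  qed
  finally show ?thesis .
qed

text \<open>The compound of the identity is the identity: if \<open>I\<close> and \<open>J\<close>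
  differ, an index in \<open>I\<close> but not in \<open>J\<close> gives a zero row.\<close>

lemma fdet_delta:
  assumes "I \<in> ksub n k" "J \<in> ksub n k"
  shows "fdet k (\<lambda>a b. if pick I a = pick J b then 1 else 0) = (if I = J then 1 else (0::'a::comm_ring_1))"
proof (cases "I = J")
  case True
  have "pick J a = pick J b \<longleftrightarrow> a = b" if "a < k" "b < k" for a b
    using incr_inj[OF incr_pick[OF assms(2)]] that by (auto simp: inj_on_def)
  then have "fdet k (\<lambda>a b. if pick I a = pick J b then 1 else 0) = fdet k (\<lambda>a b. if a = b then 1 else (0::'a))"
    using True by (intro fdet_cong) simp
  also have "\<dots> = (\<Prod>a<k. 1)" by (subst fdet_upper_triangular) simp_all
  finally show ?thesis using True by simp
next
  case False
  have "\<not> I \<subseteq> J" using False card_subset_eq[of J I] ksubD[OF assms(1)] ksubD[OF assms(2)] by auto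
  then obtain i where i: "i \<in> I" "i \<notin> J" by blast
  then obtain a where a: "a < k" "i = pick I a" using pick_image_ksub[OF assms(1)] by blast
  have "fdet k (\<lambda>a b. if pick I a = pick J b then 1 else 0) = (0::'a)"
    by (rule fdet_zero_row[OF a(1)]) (use a i pick_in_ksub[OF assms(2)] in auto)
  then show ?thesis using False by simp
qed

text \<open>The compound of a unitary matrix is unitary; this is \<open>minor_udiag\<close> with all
  eigenvalues equal to 1.\<close>

lemma compound_rows:
  assumes g: "g \<in> unitary_group n" and IJ: "I \<in> ksub n k" "J \<in> ksub n k"
  shows "(\<Sum>K\<in>ksub n k. fdet k (\<lambda>a b. g $$ (pick I a, pick K b)) * cnj (fdet k (\<lambda>a b. g $$ (pick J a, pick K b))))
    = (if I = J then 1 else 0)"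
proof -
  have "fdet k (\<lambda>a b. udiag n g (\<lambda>_. 1) (pick I a) (pick J b)) = fdet k (\<lambda>a b. if pick I a = pick J b then 1 else 0)"
    by (rule fdet_cong) (use unitary_rows[OF g] pick_less IJ in \<open>simp add: udiag_def\<close>)
  then show ?thesis unfolding minor_udiag fdet_delta[OF IJ] by simp
qed

lemma compound_cols:
  assumes g: "g \<in> unitary_group n" and K: "K \<in> ksub n k" "K' \<in> ksub n k"
  shows "(\<Sum>I\<in>ksub n k. cnj (fdet k (\<lambda>a b. g $$ (pick I a, pick K b))) * fdet k (\<lambda>a b. g $$ (pick I a, pick K' b)))
    = (if K = K' then 1 else 0)"
proof -
  have "fdet k (\<lambda>a b. \<Sum>l<n. cnj (g $$ (l, pick K a)) * g $$ (l, pick K' b)) = fdet k (\<lambda>a b. if pick K a = pick K' b then 1 else 0)"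
    by (rule fdet_cong) (use unitary_cols[OF g] pick_less K in simp)
  moreover have "fdet k (\<lambda>a b. cnj (g $$ (pick I b, pick K a))) = cnj (fdet k (\<lambda>a b. g $$ (pick I a, pick K b)))" for I
    unfolding fdet_cnj by (rule fdet_transpose[of k "\<lambda>a b. cnj (g $$ (pick I a, pick K b))"])
  ultimately show ?thesis unfolding Cauchy_Binet fdet_delta[OF K] by simp
qed

lemma prod_pick_le:
  fixes \<mu> :: "nat \<Rightarrow> real"
  assumes decr: "\<And>i j. i < j \<Longrightarrow> j < n \<Longrightarrow> \<mu> j \<le> \<mu> i" and nn: "\<And>i. i < n \<Longrightarrow> 0 \<le> \<mu> i"
    and K: "K \<in> ksub n k"
  shows "(\<Prod>b<k. \<mu> (pick K b)) \<le> (\<Prod>b<k. \<mu> b)"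
proof (rule prod_mono)
  fix b assume b: "b \<in> {..<k}"
  have "b \<le> pick K b" "pick K b < n" using incr_ge[OF incr_pick[OF K]] pick_less[OF K] b by auto
  then show "0 \<le> \<mu> (pick K b) \<and> \<mu> (pick K b) \<le> \<mu> b"
    using nn decr[of b "pick K b"] by (cases "b = pick K b") auto
qed

text \<open>This is \<open>top_eigenvector_phases\<close> for the compound matrix. The top index is
  \<open>{..<k}\<close>, since the eigenvalues decrease and are nonnegative. Strict positivity is
  asked for the one pair \<open>I\<close>, \<open>J\<close>, so compounds with zero entries are
  covered as well.\<close>

lemma left_minor_phases:
  assumes g: "g \<in> unitary_group n" and k: "k \<le> n"
    and decr: "\<And>i j. i < j \<Longrightarrow> j < n \<Longrightarrow> \<mu> j \<le> \<mu> i" and nn: "\<And>i. i < n \<Longrightarrow> 0 \<le> \<mu> i"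
    and N: "\<And>I J. I \<in> ksub n k \<Longrightarrow> J \<in> ksub n k \<Longrightarrow> 0 \<le> fdet k (\<lambda>a b. udiag n g \<mu> (pick I a) (pick J b))"
    and IJ: "I \<in> ksub n k" "J \<in> ksub n k" "0 < fdet k (\<lambda>a b. udiag n g \<mu> (pick I a) (pick J b))"
      "fdet k (\<lambda>a b. g $$ (pick J a, b)) \<noteq> 0"
  shows "fdet k (\<lambda>a b. g $$ (pick I a, b)) \<noteq> 0 \<and>
    cnj (fdet k (\<lambda>a b. g $$ (pick I a, b))) * fdet k (\<lambda>a b. g $$ (pick J a, b)) =
    of_real (cmod (fdet k (\<lambda>a b. g $$ (pick I a, b))) * cmod (fdet k (\<lambda>a b. g $$ (pick J a, b))))"
proof -
  define C where "C I K = fdet k (\<lambda>a b. g $$ (pick I a, pick K b))" for I K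
  define \<rho> where "\<rho> K = (\<Prod>b<k. \<mu> (pick K b))" for K
  define M where "M I J = Re (fdet k (\<lambda>a b. udiag n g \<mu> (pick I a) (pick J b)))" for I J
  have M: "of_real (M I J) = fdet k (\<lambda>a b. udiag n g \<mu> (pick I a) (pick J b))" "0 \<le> M I J"
    if "I \<in> ksub n k" "J \<in> ksub n k" for I J
    using N[OF that] by (auto simp: M_def less_eq_complex_def complex_eq_iff)
  have C0: "C I {..<k} = fdet k (\<lambda>a b. g $$ (pick I a, b))" for I
    unfolding C_def by (rule fdet_cong) (simp add: pick_lessThan)
  have \<rho>0: "\<rho> {..<k} = (\<Prod>b<k. \<mu> b)" unfolding \<rho>_def by (rule prod.cong) (simp_all add: pick_lessThan)
  have "C I {..<k} \<noteq> 0 \<and> cnj (C I {..<k}) * C J {..<k} = of_real (cmod (C I {..<k}) * cmod (C J {..<k}))"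
  proof (rule top_eigenvector_phases[where M=M and \<rho>=\<rho> and S="ksub n k"])
    show "\<rho> K \<le> \<rho> {..<k}" if "K \<in> ksub n k" for K
      unfolding \<rho>0 unfolding \<rho>_def by (rule prod_pick_le[OF decr nn that])
    show "complex_of_real (M I J) = (\<Sum>K\<in>ksub n k. C I K * of_real (\<rho> K) * cnj (C J K))"
      if "I \<in> ksub n k" "J \<in> ksub n k" for I J
      unfolding M(1)[OF that] minor_udiag C_def \<rho>_def ..
    show "0 < M I J" using IJ(3) by (simp add: M_def less_complex_def)
    show "C J {..<k} \<noteq> 0" using IJ(4) by (simp add: C0)
    show "(\<Sum>K\<in>ksub n k. C I K * cnj (C J K)) = (if I = J then 1 else 0)"
      if "I \<in> ksub n k" "J \<in> ksub n k" for I J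
      unfolding C_def by (rule compound_rows[OF g that])
    show "(\<Sum>I\<in>ksub n k. cnj (C I K) * C I K') = (if K = K' then 1 else 0)"
      if "K \<in> ksub n k" "K' \<in> ksub n k" for K K'
      unfolding C_def by (rule compound_cols[OF g that])
  qed (fact finite_ksub lessThan_ksub[OF k] M(2) IJ(1,2))+
  then show ?thesis unfolding C0 .
qed

text \<open>The left-justified minors of order \<open>k\<close> form a column of the compound of
  \<open>g\<close>, which is a unit vector.\<close>

lemma left_minor_nonzero:
  assumes g: "g \<in> unitary_group n" and k: "k \<le> n"
  shows "\<exists>J\<in>ksub n k. fdet k (\<lambda>a b. g $$ (pick J a, b)) \<noteq> 0"
proof (rule ccontr)
  assume "\<not> ?thesis"
  then have "fdet k (\<lambda>a b. g $$ (pick J a, pick {..<k} b)) = 0" if "J \<in> ksub n k" for J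
    using that left_minors_cong[OF k that, of "\<lambda>i j. g $$ (i, j)"] by simp
  then show False using compound_cols[OF g lessThan_ksub[OF k] lessThan_ksub[OF k]] by simp
qed

text \<open>The phases are absorbed by rescaling the columns of \<open>g\<close>, which does not change \<open>udiag\<close>.\<close>

lemma totally_pos_udiag_imp_U_pos:
  assumes g: "g \<in> unitary_group n"
    and decr: "\<And>i j. i < j \<Longrightarrow> j < n \<Longrightarrow> \<mu> j \<le> \<mu> i" and nn: "\<And>i. i < n \<Longrightarrow> 0 \<le> \<mu> i"
    and tp: "totally_pos n (udiag n g \<mu>)"
  shows "\<exists>g'\<in>U_pos n. \<forall>\<nu>. \<forall>i<n. \<forall>j<n. udiag n g' \<nu> i j = udiag n g \<nu> i j"
proof -
  define V where "V k I = fdet k (\<lambda>a b. g $$ (pick I a, b))" for k I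
  have N: "0 < fdet k (\<lambda>a b. udiag n g \<mu> (pick I a) (pick J b))" if "k \<le> n" "I \<in> ksub n k" "J \<in> ksub n k" for k I J
    using tp that unfolding totally_pos_def by blast
  have ph: "V k I \<noteq> 0 \<and> cnj (V k I) * V k J = of_real (cmod (V k I) * cmod (V k J))"
    if k: "k \<le> n" and I: "I \<in> ksub n k" and J: "J \<in> ksub n k" and nz: "V k J \<noteq> 0" for k I J
    using left_minor_phases[OF g k decr nn less_imp_le[OF N[OF k]] I J N[OF k I J] nz[unfolded V_def]]
    unfolding V_def by blast
  have Vnz: "V k I \<noteq> 0" if "k \<le> n" "I \<in> ksub n k" for k I
    using left_minor_nonzero[OF g that(1)] ph[OF that] unfolding V_def by blast
  define c where "c k = sgn (V k {..<k})" for k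
  have c1: "cnj (c k) * c k = 1" if "k \<le> n" for k
  proof -
    have "cmod (c k) = 1" using Vnz[OF that lessThan_ksub[OF that]] by (simp add: c_def norm_sgn)
    then show ?thesis using complex_norm_square[of "c k"] by (simp add: mult.commute)
  qed
  have pos: "0 < V k I * cnj (c k)" if "k \<le> n" "I \<in> ksub n k" for k I
  proof -
    note l = lessThan_ksub[OF that(1)]
    have "cnj (V k {..<k}) * V k I = of_real (cmod (V k {..<k}) * cmod (V k I))"
      using ph[OF that(1) l that(2) Vnz[OF that]] by blast
    then have "V k I * cnj (c k) = of_real (cmod (V k I))"
      using Vnz[OF that(1) l] by (simp add: c_def sgn_eq field_simps)
    then show ?thesis using Vnz[OF that] by simp
  qed
  \<comment> \<open>The phase \<open>c k\<close> is common to all left minors of order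
    \<open>k\<close>. The column factors \<open>D\<close> are chosen so that their product over the
    first \<open>k\<close> columns telescopes to \<open>cnj (c k)\<close>; this starts correctly
    because the empty minor gives \<open>c 0 = 1\<close>.\<close>
  define D where "D j = c j * cnj (c (Suc j))" for j
  have D1: "cnj (D j) * D j = 1" if "j < n" for j
  proof -
    have "cnj (D j) * D j = (cnj (c j) * c j) * (cnj (c (Suc j)) * c (Suc j))" by (simp add: D_def mult_ac)
    then show ?thesis using c1[of j] c1[of "Suc j"] that by simp
  qed
  have prodD: "k \<le> n \<Longrightarrow> (\<Prod>j<k. D j) = cnj (c k)" for k
  proof (induction k)
    case 0
    then show ?case by (simp add: c_def V_def)
  next
    case (Suc k)
    then show ?case using c1[of k] by (simp add: D_def flip: mult.assoc)
  qed
  note gc = unitary_carrier[OF g]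
  define g' where "g' = mat n n (\<lambda>(i, j). g $$ (i, j) * D j)"
  have "g' \<in> unitary_group n"
    unfolding unitary_iff
  proof (intro conjI allI impI)
    fix i j assume ij: "i < n" "j < n"
    have "(\<Sum>l<n. cnj (g' $$ (l, i)) * g' $$ (l, j)) = cnj (D i) * D j * (\<Sum>l<n. cnj (g $$ (l, i)) * g $$ (l, j))"
      using ij by (simp add: g'_def sum_distrib_left mult_ac)
    then show "(\<Sum>l<n. cnj (g' $$ (l, i)) * g' $$ (l, j)) = (if i = j then 1 else 0)"
      using unitary_cols[OF g ij] D1 ij by simp
  qed (simp add: g'_def)
  moreover have "left_pos n (\<lambda>i j. g' $$ (i, j))"
    unfolding left_pos_def
  proof (intro allI impI ballI)
    fix k I assume k: "k \<le> n" "I \<in> ksub n k"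
    have "fdet k (\<lambda>a b. g' $$ (pick I a, b)) = fdet k (\<lambda>a b. g $$ (pick I a, b) * D b)"
      by (rule fdet_cong) (use k pick_less in \<open>simp add: g'_def\<close>)
    also have "\<dots> = V k I * cnj (c k)"
      unfolding fdet_scale_cols[of k "\<lambda>a b. g $$ (pick I a, b)"] V_def prodD[OF k(1)] ..
    finally show "0 < fdet k (\<lambda>a b. g' $$ (pick I a, b))" using pos[OF k] by simp
  qed
  moreover have "udiag n g' \<nu> i j = udiag n g \<nu> i j" if "i < n" "j < n" for \<nu> i j
    unfolding udiag_def
  proof (rule sum.cong[OF refl])
    fix l assume "l \<in> {..<n}"
    then show "g' $$ (i, l) * of_real (\<nu> l) * cnj (g' $$ (j, l)) = g $$ (i, l) * of_real (\<nu> l) * cnj (g $$ (j, l))"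
      using that D1[of l] by (simp add: g'_def mult_ac)
  qed
  ultimately show ?thesis by (intro bexI[of _ g'] allI impI) (simp_all add: U_pos_iff)
qed

section \<open>Closures and compactness\<close>

text \<open>Only finitely many entries are involved, so boxes with one common radius form a
  neighbourhood base of the pulled-back product topology.\<close>

lemma mat_closure_iff:
  assumes S: "S \<subseteq> carrier_mat n n"
  shows "X \<in> mat_topology n closure_of S \<longleftrightarrow> X \<in> carrier_mat n n \<and>
    (\<forall>\<epsilon>>0. \<exists>Y\<in>S. \<forall>i<n. \<forall>j<n. dist (Y $$ (i, j)) (X $$ (i, j)) < \<epsilon>)"
proof -
  let ?E = "{..<n} \<times> {..<n}"
  let ?f = "\<lambda>A::complex mat. restrict (\<lambda>ij. A $$ ij) ?E"
  let ?T = "product_topology (\<lambda>_. euclidean :: complex topology) ?E"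
  have finE: "finite ?E" by simp
  have top: "topspace (mat_topology n) = carrier_mat n n"
    by (auto simp: mat_topology_def topspace_pullback_topology)
  show ?thesis
  proof (intro iffI conjI allI impI)
    assume X: "X \<in> mat_topology n closure_of S"
    then show Xc: "X \<in> carrier_mat n n" using top by (simp add: in_closure_of)
    fix \<epsilon> :: real assume e: "0 < \<epsilon>"
    let ?U = "PiE ?E (\<lambda>ij. {y. dist (X $$ ij) y < \<epsilon>})"
    have "openin ?T ?U" by (simp add: openin_PiE[OF finE] open_ball)
    then have op: "openin (mat_topology n) (?f -` ?U \<inter> carrier_mat n n)"
      unfolding mat_topology_def openin_pullback_topology by blast
    have mem: "X \<in> ?f -` ?U \<inter> carrier_mat n n" using e Xc by simp
    have cl: "\<exists>y. y \<in> S \<and> y \<in> W" if "X \<in> W" "openin (mat_topology n) W" for W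
      using X that unfolding in_closure_of by simp
    obtain Y where Y: "Y \<in> S" "Y \<in> ?f -` ?U \<inter> carrier_mat n n" using cl[OF mem op] by (elim exE conjE)
    have YU: "?f Y \<in> ?U" by (rule IntD1[OF Y(2), unfolded vimage_eq])
    have "dist (X $$ ij) (Y $$ ij) < \<epsilon>" if "ij \<in> ?E" for ij
      using PiE_mem[OF YU that] that by simp
    then have "dist (Y $$ (i, j)) (X $$ (i, j)) < \<epsilon>" if "i < n" "j < n" for i j
      using that by (simp add: dist_commute)
    then show "\<exists>Y\<in>S. \<forall>i<n. \<forall>j<n. dist (Y $$ (i, j)) (X $$ (i, j)) < \<epsilon>"
      using Y(1) by blast
  next
    assume X: "X \<in> carrier_mat n n \<and>
      (\<forall>\<epsilon>>0. \<exists>Y\<in>S. \<forall>i<n. \<forall>j<n. dist (Y $$ (i, j)) (X $$ (i, j)) < \<epsilon>)"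
    show "X \<in> mat_topology n closure_of S"
      unfolding in_closure_of
    proof (intro conjI allI impI)
      show "X \<in> topspace (mat_topology n)" using X top by simp
      fix W assume W: "X \<in> W \<and> openin (mat_topology n) W"
      then have "\<exists>U. openin ?T U \<and> W = ?f -` U \<inter> carrier_mat n n"
        unfolding mat_topology_def openin_pullback_topology by simp
      then obtain U where U: "openin ?T U" "W = ?f -` U \<inter> carrier_mat n n" by (elim exE conjE)
      then have "?f X \<in> U" using W by simp
      then obtain B where B: "\<forall>ij\<in>?E. openin euclidean (B ij)" "?f X \<in> PiE ?E B" "PiE ?E B \<subseteq> U"
        using U(1)[unfolded openin_product_topology_alt, rule_format, OF \<open>?f X \<in> U\<close>]
        by (elim exE conjE) simp
      have "\<exists>e>0. \<forall>y. dist y (X $$ ij) < e \<longrightarrow> y \<in> B ij" if "ij \<in> ?E" for ij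
      proof -
        have "open (B ij)" using bspec[OF B(1) that] by simp
        moreover have "X $$ ij \<in> B ij" using PiE_mem[OF B(2) that] that by simp
        ultimately show ?thesis unfolding open_dist by blast
      qed
      then obtain e where e: "\<And>ij. ij \<in> ?E \<Longrightarrow> 0 < e ij"
        "\<And>ij y. ij \<in> ?E \<Longrightarrow> dist y (X $$ ij) < e ij \<Longrightarrow> y \<in> B ij"
        by metis
      \<comment> \<open>The extra \<open>1\<close> keeps the minimum meaningful for
        \<open>n = 0\<close>.\<close>
      define \<epsilon> where "\<epsilon> = Min (insert 1 (e ` ?E))"
      have "0 < \<epsilon>" unfolding \<epsilon>_def using e(1) by (subst Min_gr_iff) auto
      then obtain Y where Y: "Y \<in> S" "\<forall>i<n. \<forall>j<n. dist (Y $$ (i, j)) (X $$ (i, j)) < \<epsilon>" using X by blast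
      have "Y $$ ij \<in> B ij" if "ij \<in> ?E" for ij
      proof -
        have "\<epsilon> \<le> e ij" unfolding \<epsilon>_def using that by (intro Min_le) auto
        moreover have "dist (Y $$ ij) (X $$ ij) < \<epsilon>" using Y(2) that by auto
        ultimately show ?thesis using e(2)[OF that] by simp
      qed
      then have "?f Y \<in> PiE ?E B" by simp
      then have "?f Y \<in> U" "Y \<in> carrier_mat n n" using B(3) S Y(1) by (simp_all only: subsetD)
      then have "Y \<in> W" unfolding U(2) by simp
      then show "\<exists>y. y \<in> S \<and> y \<in> W" using Y(1) by blast
    qed
  qed
qed

lemma mat_closure_seqI:
  assumes S: "S \<subseteq> carrier_mat n n" and X: "X \<in> carrier_mat n n" and Y: "\<And>m. Y m \<in> S"
    and lim: "\<And>i j. i < n \<Longrightarrow> j < n \<Longrightarrow> (\<lambda>m::nat. Y m $$ (i, j)) \<longlonglongrightarrow> X $$ (i, j)"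
  shows "X \<in> mat_topology n closure_of S"
  unfolding mat_closure_iff[OF S]
proof (intro conjI X allI impI)
  fix \<epsilon> :: real assume e: "0 < \<epsilon>"
  have "\<forall>\<^sub>F m in sequentially. \<forall>i\<in>{..<n}. \<forall>j\<in>{..<n}. dist (Y m $$ (i, j)) (X $$ (i, j)) < \<epsilon>"
    by (intro eventually_ball_finite ballI finite_lessThan tendstoD[OF lim e]) auto
  then obtain m where "\<forall>i\<in>{..<n}. \<forall>j\<in>{..<n}. dist (Y m $$ (i, j)) (X $$ (i, j)) < \<epsilon>"
    using eventually_happens'[OF sequentially_bot] by blast
  then show "\<exists>Y\<in>S. \<forall>i<n. \<forall>j<n. dist (Y $$ (i, j)) (X $$ (i, j)) < \<epsilon>" using Y by blast
qed

lemma mat_closure_seqD: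
  assumes S: "S \<subseteq> carrier_mat n n" and X: "X \<in> mat_topology n closure_of S"
  shows "\<exists>Y. (\<forall>m. Y m \<in> S) \<and> (\<forall>i<n. \<forall>j<n. (\<lambda>m::nat. Y m $$ (i, j)) \<longlonglongrightarrow> X $$ (i, j))"
proof -
  have "\<forall>m::nat. \<exists>Y\<in>S. \<forall>i<n. \<forall>j<n. dist (Y $$ (i, j)) (X $$ (i, j)) < inverse (real (Suc m))"
    using X unfolding mat_closure_iff[OF S] by simp
  then obtain Y where Y: "\<And>m. Y m \<in> S"
    "\<And>m i j. i < n \<Longrightarrow> j < n \<Longrightarrow> dist (Y m $$ (i, j)) (X $$ (i, j)) < inverse (real (Suc m))"
    by metis
  have "(\<lambda>m. Y m $$ (i, j)) \<longlonglongrightarrow> X $$ (i, j)" if "i < n" "j < n" for i j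
  proof (rule metric_tendsto_imp_tendsto[OF LIMSEQ_inverse_real_of_nat])
    show "\<forall>\<^sub>F m in sequentially. dist (Y m $$ (i, j)) (X $$ (i, j)) \<le> dist (inverse (real (Suc m))) 0"
      using Y(2)[OF that] by (intro always_eventually allI) (simp add: less_imp_le)
  qed
  then show ?thesis using Y(1) by blast
qed

text \<open>Bolzano--Weierstrass one coordinate at a time: each new coordinate has a monotone
  subsequence, and refining preserves the limits already obtained.\<close>

lemma finite_bounded_subseq:
  fixes f :: "nat \<Rightarrow> 'i \<Rightarrow> real"
  assumes "finite E" "\<And>i m. i \<in> E \<Longrightarrow> \<bar>f m i\<bar> \<le> B"
  shows "\<exists>r l. strict_mono r \<and> (\<forall>i\<in>E. (\<lambda>m. f (r m) i) \<longlonglongrightarrow> l i)"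
  using assms
proof (induction E rule: finite_induct)
  case empty
  show ?case by (rule exI[of _ id]) (simp add: strict_mono_def)
next
  case (insert x E)
  then obtain r l where r: "strict_mono (r :: nat \<Rightarrow> nat)" "\<forall>i\<in>E. (\<lambda>m. f (r m) i) \<longlonglongrightarrow> l i" by blast
  obtain s where s: "strict_mono (s :: nat \<Rightarrow> nat)" "monoseq (\<lambda>m. f (r (s m)) x)"
    using seq_monosub[of "\<lambda>m. f (r m) x"] by blast
  have "Bseq (\<lambda>m. f (r (s m)) x)"
    using insert.prems[of x] by (intro BseqI'[where K=B]) simp
  then obtain y where y: "(\<lambda>m. f (r (s m)) x) \<longlonglongrightarrow> y"
    using Bseq_monoseq_convergent[OF _ s(2)] unfolding convergent_def by blast
  have "(\<lambda>m. f (r (s m)) i) \<longlonglongrightarrow> l i" if "i \<in> E" for i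
    using LIMSEQ_subseq_LIMSEQ[OF r(2)[rule_format, OF that] s(1)] by (simp add: o_def)
  then have "\<forall>i\<in>insert x E. (\<lambda>m. f ((r \<circ> s) m) i) \<longlonglongrightarrow> (if i = x then y else l i)"
    using y insert.hyps by auto
  moreover have "strict_mono (r \<circ> s)" using r(1) s(1) by (rule strict_mono_o)
  ultimately show ?case by (intro exI[of _ "r \<circ> s"] exI[of _ "\<lambda>i. if i = x then y else l i"]) blast
qed

lemma finite_bounded_subseq_complex:
  fixes f :: "nat \<Rightarrow> 'i \<Rightarrow> complex"
  assumes "finite E" "\<And>i m. i \<in> E \<Longrightarrow> cmod (f m i) \<le> B"
  shows "\<exists>r l. strict_mono r \<and> (\<forall>i\<in>E. (\<lambda>m. f (r m) i) \<longlonglongrightarrow> l i)"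
proof -
  define F where "F m ib = (if snd ib then Re (f m (fst ib)) else Im (f m (fst ib)))" for m and ib :: "'i \<times> bool"
  have "\<bar>F m ib\<bar> \<le> B" if "ib \<in> E \<times> UNIV" for m ib
  proof -
    have "cmod (f m (fst ib)) \<le> B" using assms(2) that by auto
    then show ?thesis
      using abs_Re_le_cmod[of "f m (fst ib)"] abs_Im_le_cmod[of "f m (fst ib)"] by (simp add: F_def)
  qed
  then obtain r l where r: "strict_mono (r :: nat \<Rightarrow> nat)" "\<forall>ib\<in>E \<times> UNIV. (\<lambda>m. F (r m) ib) \<longlonglongrightarrow> l ib"
    using finite_bounded_subseq[of "E \<times> UNIV" F B] assms(1) by auto
  have "(\<lambda>m. f (r m) i) \<longlonglongrightarrow> Complex (l (i, True)) (l (i, False))" if "i \<in> E" for i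
  proof -
    have "(\<lambda>m. Re (f (r m) i)) \<longlonglongrightarrow> l (i, True)" "(\<lambda>m. Im (f (r m) i)) \<longlonglongrightarrow> l (i, False)"
      using r(2)[rule_format, of "(i, True)"] r(2)[rule_format, of "(i, False)"] that by (simp_all add: F_def)
    then show ?thesis by (simp add: tendsto_complex_iff)
  qed
  then show ?thesis using r(1) by (intro exI[of _ r] exI[of _ "\<lambda>i. Complex (l (i, True)) (l (i, False))"]) blast
qed

lemma tendsto_fdet:
  fixes h :: "'m \<Rightarrow> nat \<Rightarrow> nat \<Rightarrow> 'b::real_normed_field"
  assumes "\<And>a b. a < k \<Longrightarrow> b < k \<Longrightarrow> ((\<lambda>m. h m a b) \<longlongrightarrow> h' a b) F"
  shows "((\<lambda>m. fdet k (h m)) \<longlongrightarrow> fdet k h') F"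
  unfolding fdet_expand
proof (intro tendsto_sum tendsto_mult tendsto_const tendsto_prod)
  fix p a assume "p \<in> {p. p permutes {..<k}}" "a \<in> {..<k}"
  then have "p a < k" using permutes_in_image[of p "{..<k}" a] by auto
  then show "((\<lambda>m. h m a (p a)) \<longlongrightarrow> h' a (p a)) F" using assms \<open>a \<in> {..<k}\<close> by simp
qed

lemma tendsto_nonneg_complex:
  assumes "f \<longlonglongrightarrow> (l::complex)" "\<And>m. 0 \<le> f m"
  shows "0 \<le> l"
proof -
  have f: "0 \<le> Re (f m)" "Im (f m) = 0" for m using assms(2)[of m] by (auto simp: less_eq_complex_def)
  have "(\<lambda>m. Im (f m)) \<longlonglongrightarrow> Im l" using assms(1) by (rule tendsto_Im)
  then have "Im l = 0" using f(2) by (simp add: LIMSEQ_const_iff)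
  moreover have "(\<lambda>m. Re (f m)) \<longlonglongrightarrow> Re l" using assms(1) by (rule tendsto_Re)
  then have "0 \<le> Re l" using f(1) by (intro LIMSEQ_le_const[of "\<lambda>m. Re (f m)"]) auto
  ultimately show ?thesis by (simp add: less_eq_complex_def)
qed

definition left_nonneg :: "nat \<Rightarrow> (nat \<Rightarrow> nat \<Rightarrow> complex) \<Rightarrow> bool" where
  "left_nonneg n A \<longleftrightarrow> (\<forall>k\<le>n. \<forall>I\<in>ksub n k. 0 \<le> fdet k (\<lambda>a b. A (pick I a) b))"

lemma unitary_entry_le:
  assumes g: "g \<in> unitary_group n" "i < n" "j < n"
  shows "cmod (g $$ (i, j)) \<le> 1"
proof -
  have "complex_of_real (\<Sum>l<n. (cmod (g $$ (i, l)))\<^sup>2) = (\<Sum>l<n. g $$ (i, l) * cnj (g $$ (i, l)))"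
    by (simp only: of_real_sum complex_norm_square)
  also have "\<dots> = of_real 1" using unitary_rows[OF g(1,2,2)] by simp
  finally have "(\<Sum>l<n. (cmod (g $$ (i, l)))\<^sup>2) = 1" using of_real_eq_iff by blast
  moreover have "(cmod (g $$ (i, j)))\<^sup>2 \<le> (\<Sum>l<n. (cmod (g $$ (i, l)))\<^sup>2)"
    using g by (intro member_le_sum) auto
  ultimately show ?thesis by (simp add: power_le_one_iff abs_square_le_1)
qed

lemma unitary_limit:
  assumes g: "\<And>m::nat. g m \<in> unitary_group n" and h: "h \<in> carrier_mat n n"
    and lim: "\<And>i j. i < n \<Longrightarrow> j < n \<Longrightarrow> (\<lambda>m. g m $$ (i, j)) \<longlonglongrightarrow> h $$ (i, j)"
  shows "h \<in> unitary_group n"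
  unfolding unitary_iff
proof (intro conjI h allI impI)
  fix i j assume ij: "i < n" "j < n"
  have "(\<lambda>m. \<Sum>l<n. cnj (g m $$ (l, i)) * g m $$ (l, j)) \<longlonglongrightarrow> (\<Sum>l<n. cnj (h $$ (l, i)) * h $$ (l, j))"
    by (intro tendsto_intros lim) (use ij in auto)
  then show "(\<Sum>l<n. cnj (h $$ (l, i)) * h $$ (l, j)) = (if i = j then 1 else 0)"
    using unitary_cols[OF g ij] by (simp add: LIMSEQ_const_iff)
qed

text \<open>Unitary entries have modulus at most 1, so a subsequence converges entrywise. Unitarity
  survives the limit, while positive minors become nonnegative.\<close>

lemma U_pos_subseq:
  assumes g: "\<And>m::nat. g m \<in> U_pos n"
  shows "\<exists>r h. strict_mono r \<and> h \<in> unitary_group n \<and> left_nonneg n (\<lambda>i j. h $$ (i, j)) \<and>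
    (\<forall>i<n. \<forall>j<n. (\<lambda>m. g (r m) $$ (i, j)) \<longlonglongrightarrow> h $$ (i, j))"
proof -
  note gu = U_pos_imp[OF g]
  have "\<exists>r l. strict_mono r \<and> (\<forall>ij\<in>{..<n} \<times> {..<n}. (\<lambda>m. g (r m) $$ ij) \<longlonglongrightarrow> l ij)"
  proof (rule finite_bounded_subseq_complex)
    show "cmod (g m $$ ij) \<le> 1" if "ij \<in> {..<n} \<times> {..<n}" for ij m
      using unitary_entry_le[OF gu(1)] that by auto
  qed simp
  then obtain r l where r: "strict_mono r" "\<forall>ij\<in>{..<n} \<times> {..<n}. (\<lambda>m. g (r m) $$ ij) \<longlonglongrightarrow> l ij" by blast
  define h where "h = mat n n l"
  have lim: "(\<lambda>m. g (r m) $$ (i, j)) \<longlonglongrightarrow> h $$ (i, j)" if "i < n" "j < n" for i j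
    using r(2) that by (simp add: h_def)
  have "h \<in> unitary_group n"
    by (rule unitary_limit[OF gu(1) _ lim]) (simp_all add: h_def)
  moreover have "left_nonneg n (\<lambda>i j. h $$ (i, j))"
    unfolding left_nonneg_def
  proof (intro allI impI ballI)
    fix k I assume k: "k \<le> n" "I \<in> ksub n k"
    have "(\<lambda>m. fdet k (\<lambda>a b. g (r m) $$ (pick I a, b))) \<longlonglongrightarrow> fdet k (\<lambda>a b. h $$ (pick I a, b))"
      by (rule tendsto_fdet, rule lim) (use k pick_less in auto)
    moreover have "0 \<le> fdet k (\<lambda>a b. g (r m) $$ (pick I a, b))" for m
      using gu(2)[of "r m"] k unfolding left_pos_def by (simp add: less_imp_le)
    ultimately show "0 \<le> fdet k (\<lambda>a b. h $$ (pick I a, b))" by (rule tendsto_nonneg_complex)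
  qed
  ultimately show ?thesis using r(1) lim by blast
qed

lemma tendsto_udiag:
  assumes "\<And>i j. i < n \<Longrightarrow> j < n \<Longrightarrow> ((\<lambda>m. g m $$ (i, j)) \<longlongrightarrow> h $$ (i, j)) F"
    "\<And>l. l < n \<Longrightarrow> ((\<lambda>m. \<mu> m l) \<longlongrightarrow> \<nu> l) F" "i < n" "j < n"
  shows "((\<lambda>m. udiag n (g m) (\<mu> m) i j) \<longlongrightarrow> udiag n h \<nu> i j) F"
  unfolding udiag_def by (intro tendsto_intros assms(1,2)) (use assms(3,4) in auto)

lemma orbit_pos_carrier: "orbit_pos n lam \<subseteq> carrier_mat n n"
  unfolding orbit_pos_def using conj_diag_carrier U_pos_imp(1) unitary_carrier by blast

lemma orbit_pos_iff:
  assumes L: "L \<in> carrier_mat n n"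
  shows "\<i> \<cdot>\<^sub>m L \<in> orbit_pos n lam \<longleftrightarrow>
    (\<exists>g\<in>U_pos n. \<forall>i<n. \<forall>j<n. L $$ (i, j) = udiag n g (\<lambda>l. lam $ l) i j)"
  unfolding orbit_pos_def
  using smult_eq_conj_diag_iff[OF L unitary_carrier[OF U_pos_imp(1)]] by blast

lemma orbit_iff:
  assumes L: "L \<in> carrier_mat n n"
  shows "\<i> \<cdot>\<^sub>m L \<in> orbit n lam \<longleftrightarrow>
    (\<exists>g\<in>unitary_group n. \<forall>i<n. \<forall>j<n. L $$ (i, j) = udiag n g (\<lambda>l. lam $ l) i j)"
  unfolding orbit_def
  using smult_eq_conj_diag_iff[OF L unitary_carrier] by blast

text \<open>The approximation takes place in the orbit, but the limit is taken among the
  diagonalising matrices, where compactness applies; continuity of the conjugation identifies the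
  result.\<close>

lemma orbit_nonneg_udiag:
  assumes L: "L \<in> carrier_mat n n" and X: "\<i> \<cdot>\<^sub>m L \<in> orbit_nonneg n lam"
  shows "\<exists>h\<in>unitary_group n. left_nonneg n (\<lambda>i j. h $$ (i, j)) \<and>
    (\<forall>i<n. \<forall>j<n. L $$ (i, j) = udiag n h (\<lambda>l. lam $ l) i j)"
proof -
  obtain Y where Y: "\<And>m::nat. Y m \<in> orbit_pos n lam"
    "\<And>i j. i < n \<Longrightarrow> j < n \<Longrightarrow> (\<lambda>m. Y m $$ (i, j)) \<longlonglongrightarrow> (\<i> \<cdot>\<^sub>m L) $$ (i, j)"
    using mat_closure_seqD[OF orbit_pos_carrier X[unfolded orbit_nonneg_def]] by blast
  have "\<forall>m. \<exists>g\<in>U_pos n. Y m = conj_diag n lam g" using Y(1) by (auto simp: orbit_pos_def)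
  then obtain g where g: "\<And>m. g m \<in> U_pos n" "\<And>m. Y m = conj_diag n lam (g m)" by metis
  obtain r h where r: "strict_mono r" and h: "h \<in> unitary_group n" "left_nonneg n (\<lambda>i j. h $$ (i, j))"
    "\<And>i j. i < n \<Longrightarrow> j < n \<Longrightarrow> (\<lambda>m. g (r m) $$ (i, j)) \<longlonglongrightarrow> h $$ (i, j)"
    using U_pos_subseq[of g n, OF g(1)] by blast
  have "L $$ (i, j) = udiag n h (\<lambda>l. lam $ l) i j" if ij: "i < n" "j < n" for i j
  proof -
    have "(\<lambda>m. Y (r m) $$ (i, j)) \<longlonglongrightarrow> (\<i> \<cdot>\<^sub>m L) $$ (i, j)"
      using LIMSEQ_subseq_LIMSEQ[OF Y(2)[OF ij] r] by (simp add: o_def)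
    moreover have "Y (r m) $$ (i, j) = \<i> * udiag n (g (r m)) (\<lambda>l. lam $ l) i j" for m
      unfolding g(2) by (rule conj_diag_index[OF unitary_carrier[OF U_pos_imp(1)[OF g(1)]] ij])
    moreover have "(\<lambda>m. \<i> * udiag n (g (r m)) (\<lambda>l. lam $ l) i j) \<longlonglongrightarrow> \<i> * udiag n h (\<lambda>l. lam $ l) i j"
      by (intro tendsto_mult tendsto_const tendsto_udiag h(3) ij)
    ultimately have "(\<i> \<cdot>\<^sub>m L) $$ (i, j) = \<i> * udiag n h (\<lambda>l. lam $ l) i j"
      by (simp only: LIMSEQ_unique)
    then show ?thesis using L ij by simp
  qed
  then show ?thesis using h by blast
qed

lemma orbit_nonnegI:
  assumes L: "L \<in> carrier_mat n n" and g: "\<And>m::nat. g m \<in> U_pos n"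
    and lim: "\<And>i j. i < n \<Longrightarrow> j < n \<Longrightarrow> (\<lambda>m. g m $$ (i, j)) \<longlonglongrightarrow> h $$ (i, j)"
    and eq: "\<And>i j. i < n \<Longrightarrow> j < n \<Longrightarrow> L $$ (i, j) = udiag n h (\<lambda>l. lam $ l) i j"
  shows "\<i> \<cdot>\<^sub>m L \<in> orbit_nonneg n lam"
  unfolding orbit_nonneg_def
proof (rule mat_closure_seqI[OF orbit_pos_carrier])
  show "conj_diag n lam (g m) \<in> orbit_pos n lam" for m using g by (simp add: orbit_pos_def)
  fix i j assume ij: "i < n" "j < n"
  have "conj_diag n lam (g m) $$ (i, j) = \<i> * udiag n (g m) (\<lambda>l. lam $ l) i j" for m
    by (rule conj_diag_index[OF unitary_carrier[OF U_pos_imp(1)[OF g]] ij])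
  moreover have "(\<lambda>m. \<i> * udiag n (g m) (\<lambda>l. lam $ l) i j) \<longlonglongrightarrow> \<i> * udiag n h (\<lambda>l. lam $ l) i j"
    by (intro tendsto_mult tendsto_const tendsto_udiag lim ij)
  ultimately show "(\<lambda>m. conj_diag n lam (g m) $$ (i, j)) \<longlonglongrightarrow> (\<i> \<cdot>\<^sub>m L) $$ (i, j)"
    using L ij eq by simp
qed (use L in simp)

section \<open>Eventual positivity and the spectral theorem\<close>

lemma totally_pos_cong:
  assumes "\<And>i j. i < n \<Longrightarrow> j < n \<Longrightarrow> A i j = B i j"
  shows "totally_pos n A \<longleftrightarrow> totally_pos n B"
proof -
  have "fdet k (\<lambda>a b. A (pick I a) (pick J b)) = fdet k (\<lambda>a b. B (pick I a) (pick J b))"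
    if "I \<in> ksub n k" "J \<in> ksub n k" for k I J
    by (rule fdet_cong) (use assms pick_less that in simp)
  then show ?thesis by (simp add: totally_pos_def)
qed

text \<open>The spectral gap of the compound matrix: in some position \<open>c\<close> the index
  \<open>pick K c\<close> is strictly larger than \<open>c\<close>, and the factor there strictly
  drops.\<close>

lemma prod_pick_less:
  fixes \<mu> :: "nat \<Rightarrow> real"
  assumes decr: "\<And>i j. i < j \<Longrightarrow> j < n \<Longrightarrow> \<mu> j < \<mu> i" and pos: "\<And>i. i < n \<Longrightarrow> 0 < \<mu> i"
    and k: "k \<le> n" and K: "K \<in> ksub n k" "K \<noteq> {..<k}"
  shows "(\<Prod>b<k. \<mu> (pick K b)) < (\<Prod>b<k. \<mu> b)"
proof -
  have ge: "b \<le> pick K b" "pick K b < n" if "b < k" for b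
    using incr_ge[OF incr_pick[OF K(1)] that] pick_less[OF K(1) that] by auto
  have "\<exists>b<k. b < pick K b"
  proof (rule ccontr)
    assume "\<not> ?thesis"
    then have "pick K b \<le> b" if "b < k" for b using that by (meson not_le)
    then have "(\<Sum>b<k. pick K b) \<le> (\<Sum>b<k. b)" by (intro sum_mono) simp
    then show False using sum_pick_gt[OF K] by simp
  qed
  then obtain c where c: "c < k" "c < pick K c" by blast
  have le: "\<mu> (pick K b) \<le> \<mu> b" if "b < k" for b
    using decr[of b "pick K b"] ge[OF that] by (cases "b = pick K b") auto
  have "(\<Prod>b<k. \<mu> (pick K b)) = \<mu> (pick K c) * (\<Prod>b\<in>{..<k} - {c}. \<mu> (pick K b))"
    using c by (simp add: prod.remove)
  also have "\<dots> \<le> \<mu> (pick K c) * (\<Prod>b\<in>{..<k} - {c}. \<mu> b)"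
    using ge pos le c by (intro mult_left_mono prod_mono) (auto simp: less_imp_le)
  also have "\<dots> < \<mu> c * (\<Prod>b\<in>{..<k} - {c}. \<mu> b)"
    using decr[OF c(2)] ge[OF c(1)] pos k by (intro mult_strict_right_mono prod_pos) auto
  also have "\<dots> = (\<Prod>b<k. \<mu> b)" using c by (simp add: prod.remove[of "{..<k}" c])
  finally show ?thesis .
qed

text \<open>Power iteration on the compound matrix. After division by the \<open>m\<close>-th power
  of its top eigenvalue, the minor for \<open>I\<close> and \<open>J\<close> converges to the
  product of the left minors of \<open>g\<close> with row sets \<open>I\<close> and
  \<open>J\<close>, which is positive.\<close>

lemma eventually_totally_pos_udiag_power:
  assumes g: "g \<in> U_pos n"
    and decr: "\<And>i j. i < j \<Longrightarrow> j < n \<Longrightarrow> \<mu> j < \<mu> i" and pos: "\<And>i. i < n \<Longrightarrow> 0 < \<mu> i"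
  shows "\<forall>\<^sub>F m in sequentially. totally_pos n (udiag n g (\<lambda>l. \<mu> l ^ m))"
  unfolding totally_pos_def
proof (rule eventually_all_minors)
  fix k I J assume k: "k \<le> n" and I: "I \<in> ksub n k" and J: "J \<in> ksub n k"
  note gu = U_pos_imp[OF g]
  define R where "R i j = Re (g $$ (i, j))" for i j
  define C where "C I K = fdet k (\<lambda>a b. R (pick I a) (pick K b))" for I K
  define \<rho> where "\<rho> K = (\<Prod>b<k. \<mu> (pick K b))" for K
  define F where "F m = (\<Sum>K\<in>ksub n k. C I K * C J K * (\<rho> K / \<rho> {..<k}) ^ m)" for m :: nat
  have gR: "g $$ (i, j) = complex_of_real (R i j)" if "i < n" "j < n" for i j
    using left_pos_unitary_real[OF gu that] by (simp add: R_def complex_eq_iff)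
  have CR: "fdet k (\<lambda>a b. g $$ (pick I a, pick K b)) = of_real (C I K)" if "I \<in> ksub n k" "K \<in> ksub n k" for I K
    unfolding C_def fdet_of_real by (rule fdet_cong) (use gR pick_less that in simp)
  have C0: "0 < C I {..<k}" if "I \<in> ksub n k" for I
  proof -
    have "0 < complex_of_real (C I {..<k})"
      using gu(2) k that unfolding CR[OF that lessThan_ksub[OF k], symmetric] left_pos_def
        left_minors_cong[OF k that, of "\<lambda>i j. g $$ (i, j)"] by blast
    then show ?thesis by simp
  qed
  have \<rho>0: "\<rho> {..<k} = (\<Prod>b<k. \<mu> b)" unfolding \<rho>_def by (rule prod.cong) (simp_all add: pick_lessThan)
  have \<rho>pos: "0 < \<rho> K" if "K \<in> ksub n k" for K
    unfolding \<rho>_def by (intro prod_pos) (use pos pick_less[OF that] in auto)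
  note \<rho>0pos = \<rho>pos[OF lessThan_ksub[OF k]]
  have eq: "fdet k (\<lambda>a b. udiag n g (\<lambda>l. \<mu> l ^ m) (pick I a) (pick J b)) = of_real (\<rho> {..<k} ^ m * F m)" for m
  proof -
    have "fdet k (\<lambda>a b. udiag n g (\<lambda>l. \<mu> l ^ m) (pick I a) (pick J b)) =
      (\<Sum>K\<in>ksub n k. of_real (C I K * \<rho> K ^ m * C J K))"
      unfolding minor_udiag
      by (intro sum.cong refl) (simp add: CR I J \<rho>_def prod_power_distrib)
    also have "\<dots> = (\<Sum>K\<in>ksub n k. of_real (\<rho> {..<k} ^ m * (C I K * C J K * (\<rho> K / \<rho> {..<k}) ^ m)))"
      using \<rho>0pos by (intro sum.cong refl arg_cong[where f=of_real]) (simp add: power_divide)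
    finally show ?thesis by (simp add: F_def sum_distrib_left)
  qed
  have "F \<longlonglongrightarrow> (\<Sum>K\<in>ksub n k. C I K * C J K * (if K = {..<k} then 1 else 0))"
    unfolding F_def
  proof (intro tendsto_sum tendsto_mult tendsto_const)
    fix K assume K: "K \<in> ksub n k"
    show "(\<lambda>m. (\<rho> K / \<rho> {..<k}) ^ m) \<longlonglongrightarrow> (if K = {..<k} then 1 else 0)"
    proof (cases "K = {..<k}")
      case False
      have "\<rho> K < \<rho> {..<k}" unfolding \<rho>0 unfolding \<rho>_def by (rule prod_pick_less[OF decr pos k K False])
      then show ?thesis using False \<rho>pos[OF K] \<rho>0pos by (simp add: LIMSEQ_realpow_zero)
    qed (use \<rho>0pos in simp)
  qed
  also have "(\<Sum>K\<in>ksub n k. C I K * C J K * (if K = {..<k} then 1 else 0)) = C I {..<k} * C J {..<k}"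
    using lessThan_ksub[OF k] by (simp add: if_distrib[where f="\<lambda>x. _ * x"] cong: if_cong)
  finally have "\<forall>\<^sub>F m in sequentially. 0 < F m"
    by (rule order_tendstoD) (use C0 I J in simp)
  then show "\<forall>\<^sub>F m in sequentially. 0 < fdet k (\<lambda>a b. udiag n g (\<lambda>l. \<mu> l ^ m) (pick I a) (pick J b))"
    by eventually_elim (use \<rho>0pos in \<open>simp add: eq del: of_real_mult of_real_power\<close>)
qed

text \<open>For the way back, total positivity of a power suffices: the corrected diagonalising
  matrix represents every function of \<open>L\<close> as before, so in particular \<open>L\<close>
  itself.\<close>

lemma orbit_pos_iff_eventually_totally_pos:
  assumes L: "L \<in> carrier_mat n n" and orb: "\<i> \<cdot>\<^sub>m L \<in> orbit n lam"
    and decr: "\<And>i j. i < j \<Longrightarrow> j < n \<Longrightarrow> lam $ j < lam $ i" and pos: "\<And>i. i < n \<Longrightarrow> 0 < lam $ i"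
  shows "\<i> \<cdot>\<^sub>m L \<in> orbit_pos n lam \<longleftrightarrow> (\<exists>m>0. L ^\<^sub>m m \<in> GL_pos_complex n)"
proof
  assume "\<i> \<cdot>\<^sub>m L \<in> orbit_pos n lam"
  then obtain g where g: "g \<in> U_pos n" "\<forall>i<n. \<forall>j<n. L $$ (i, j) = udiag n g (\<lambda>l. lam $ l) i j"
    unfolding orbit_pos_iff[OF L] by blast
  have "\<forall>\<^sub>F m in sequentially. 0 < m \<and> totally_pos n (udiag n g (\<lambda>l. (lam $ l) ^ m))"
    by (intro eventually_conj eventually_gt_at_top eventually_totally_pos_udiag_power g decr pos)
  then obtain m where m: "0 < m" "totally_pos n (udiag n g (\<lambda>l. (lam $ l) ^ m))"
    using eventually_happens'[OF sequentially_bot] by blast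
  have "totally_pos n (\<lambda>i j. (L ^\<^sub>m m) $$ (i, j))"
    using m(2) g(2) udiag_power[OF U_pos_imp(1)[OF g(1)] L, of "\<lambda>l. lam $ l"]
    by (subst totally_pos_cong[of n _ "udiag n g (\<lambda>l. (lam $ l) ^ m)"]) auto
  then show "\<exists>m>0. L ^\<^sub>m m \<in> GL_pos_complex n"
    using m(1) pow_carrier_mat[OF L] unfolding GL_pos_complex_iff by blast
next
  assume "\<exists>m>0. L ^\<^sub>m m \<in> GL_pos_complex n"
  then obtain m where m: "totally_pos n (\<lambda>i j. (L ^\<^sub>m m) $$ (i, j))" unfolding GL_pos_complex_iff by blast
  obtain g where g: "g \<in> unitary_group n" "\<forall>i<n. \<forall>j<n. L $$ (i, j) = udiag n g (\<lambda>l. lam $ l) i j"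
    using orb unfolding orbit_iff[OF L] by blast
  have tp: "totally_pos n (udiag n g (\<lambda>l. (lam $ l) ^ m))"
    using m g(2) udiag_power[OF g(1) L, of "\<lambda>l. lam $ l"]
    by (subst totally_pos_cong[of n _ "\<lambda>i j. (L ^\<^sub>m m) $$ (i, j)"]) auto
  have "\<exists>g'\<in>U_pos n. \<forall>\<nu>. \<forall>i<n. \<forall>j<n. udiag n g' \<nu> i j = udiag n g \<nu> i j"
  proof (rule totally_pos_udiag_imp_U_pos[OF g(1) _ _ tp])
    show "(lam $ j) ^ m \<le> (lam $ i) ^ m" if "i < j" "j < n" for i j
      using decr[OF that] pos[of j] that by (intro power_mono) auto
    show "0 \<le> (lam $ i) ^ m" if "i < n" for i using pos[OF that] by simp
  qed
  then show "\<i> \<cdot>\<^sub>m L \<in> orbit_pos n lam" unfolding orbit_pos_iff[OF L] using g(2) by metis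
qed

section \<open>Ky Fan inequality and spectral theorem\<close>

lemma udiag_herm: "udiag n g \<mu> j i = cnj (udiag n g \<mu> i j)"
  by (simp add: udiag_def mult_ac)

lemma udiag_conj:
  assumes w: "w \<in> carrier_mat n n" and h: "h \<in> carrier_mat n n" and ij: "i < n" "j < n"
  shows "(\<Sum>a<n. \<Sum>b<n. cnj (w $$ (a, i)) * udiag n h \<nu> a b * w $$ (b, j)) = udiag n (mat_adjoint w * h) \<nu> i j"
proof -
  have u: "(mat_adjoint w * h) $$ (i, l) = (\<Sum>a<n. cnj (w $$ (a, i)) * h $$ (a, l))" if "i < n" "l < n" for i l
    using index_mult_sum[OF mat_adjoint_carrier[OF w] h that] w that by (simp del: index_mult_mat(1))
  have "(\<Sum>a<n. \<Sum>b<n. cnj (w $$ (a, i)) * udiag n h \<nu> a b * w $$ (b, j)) =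
     (\<Sum>a<n. \<Sum>b<n. \<Sum>l<n. (cnj (w $$ (a, i)) * h $$ (a, l)) * of_real (\<nu> l) * (w $$ (b, j) * cnj (h $$ (b, l))))"
    by (simp add: udiag_def sum_distrib_left sum_distrib_right mult_ac)
  also have "\<dots> = (\<Sum>a<n. \<Sum>l<n. \<Sum>b<n. (cnj (w $$ (a, i)) * h $$ (a, l)) * of_real (\<nu> l) * (w $$ (b, j) * cnj (h $$ (b, l))))"
    by (intro sum.cong refl sum.swap)
  also have "\<dots> = (\<Sum>l<n. \<Sum>a<n. \<Sum>b<n. (cnj (w $$ (a, i)) * h $$ (a, l)) * of_real (\<nu> l) * (w $$ (b, j) * cnj (h $$ (b, l))))"
    by (rule sum.swap)
  also have "\<dots> = (\<Sum>l<n. (\<Sum>a<n. cnj (w $$ (a, i)) * h $$ (a, l)) * of_real (\<nu> l) * (\<Sum>b<n. w $$ (b, j) * cnj (h $$ (b, l))))"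
    unfolding sum_distrib_right unfolding sum_distrib_left ..
  also have "\<dots> = udiag n (mat_adjoint w * h) \<nu> i j"
    unfolding udiag_def by (intro sum.cong refl) (simp add: u ij del: index_mult_mat(1))
  finally show ?thesis .
qed

lemma udiag_one:
  assumes "i < n" "j < n"
  shows "udiag n (1\<^sub>m n) \<mu> i j = (if i = j then of_real (\<mu> i) else 0)"
proof -
  have "udiag n (1\<^sub>m n) \<mu> i j = (\<Sum>l<n. if i = l then (if i = j then of_real (\<mu> i) else 0) else 0)"
    unfolding udiag_def by (intro sum.cong refl) (use assms in auto)
  then show ?thesis using assms by simp
qed

lemma unitary_adjoint_mult:
  assumes "w \<in> unitary_group n" "h \<in> unitary_group n"
  shows "mat_adjoint w * h \<in> unitary_group n"
proof -
  note c = unitary_carrier[OF assms(1)] unitary_carrier[OF assms(2)]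
  note u = index_mult_sum[OF mat_adjoint_carrier[OF c(1)] c(2)]
  show ?thesis unfolding unitary_iff
  proof (intro conjI allI impI)
    fix i j assume ij: "i < n" "j < n"
    have "(\<Sum>l<n. cnj ((mat_adjoint w * h) $$ (l, i)) * (mat_adjoint w * h) $$ (l, j)) =
      (\<Sum>l<n. \<Sum>a<n. \<Sum>b<n. (w $$ (a, l) * cnj (w $$ (b, l))) * (cnj (h $$ (a, i)) * h $$ (b, j)))"
      using ij c by (intro sum.cong refl) (simp add: u sum_product del: index_mult_mat(1), simp only: mult_ac)
    also have "\<dots> = (\<Sum>a<n. \<Sum>l<n. \<Sum>b<n. (w $$ (a, l) * cnj (w $$ (b, l))) * (cnj (h $$ (a, i)) * h $$ (b, j)))"
      by (rule sum.swap)
    also have "\<dots> = (\<Sum>a<n. \<Sum>b<n. \<Sum>l<n. (w $$ (a, l) * cnj (w $$ (b, l))) * (cnj (h $$ (a, i)) * h $$ (b, j)))"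
      by (intro sum.cong refl sum.swap)
    also have "\<dots> = (\<Sum>a<n. \<Sum>b<n. (\<Sum>l<n. w $$ (a, l) * cnj (w $$ (b, l))) * (cnj (h $$ (a, i)) * h $$ (b, j)))"
      by (simp add: sum_distrib_right)
    also have "\<dots> = (\<Sum>a<n. \<Sum>b<n. if a = b then cnj (h $$ (a, i)) * h $$ (b, j) else 0)"
      by (intro sum.cong refl) (simp add: unitary_rows[OF assms(1)])
    also have "\<dots> = (\<Sum>a<n. cnj (h $$ (a, i)) * h $$ (a, j))" by simp
    finally show "(\<Sum>l<n. cnj ((mat_adjoint w * h) $$ (l, i)) * (mat_adjoint w * h) $$ (l, j)) = (if i = j then 1 else 0)"
      using unitary_cols[OF assms(2) ij] by simp
  qed (use c in auto)
qed

text \<open>An identity with explicit remainder, because the equality case is exploited in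
  \<open>tridiagonal_nonzero\<close>. Here \<open>t j\<close> is the squared length of the first
  \<open>Suc k\<close> entries of column \<open>j\<close>. Since the \<open>t j\<close> sum to
  \<open>Suc k\<close>, the last included eigenvalue \<open>\<nu> k\<close> can be subtracted as a
  pivot; for decreasing \<open>\<nu>\<close> both remainder sums are then nonnegative.\<close>

lemma Ky_Fan:
  assumes g: "g \<in> unitary_group n" and k: "k < n"
  defines "t \<equiv> \<lambda>j. \<Sum>a<Suc k. (cmod (g $$ (a, j)))\<^sup>2"
  shows "(\<Sum>a<Suc k. Re (udiag n g \<nu> a a)) = (\<Sum>j<Suc k. \<nu> j) -
      ((\<Sum>j<Suc k. (\<nu> j - \<nu> k) * (1 - t j)) + (\<Sum>j\<in>{Suc k..<n}. (\<nu> k - \<nu> j) * t j))"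
    and "\<And>j. j < n \<Longrightarrow> 0 \<le> t j \<and> t j \<le> 1"
proof -
  have sq: "x * cnj x = of_real ((cmod x)\<^sup>2)" for x by (simp only: complex_norm_square)
  have d: "Re (udiag n g \<nu> a a) = (\<Sum>j<n. \<nu> j * (cmod (g $$ (a, j)))\<^sup>2)" for a
  proof -
    have "udiag n g \<nu> a a = (\<Sum>j<n. of_real (\<nu> j) * (g $$ (a, j) * cnj (g $$ (a, j))))"
      unfolding udiag_def by (intro sum.cong refl) (simp add: mult_ac)
    then show ?thesis unfolding sq by simp
  qed
  have "(\<Sum>a<Suc k. Re (udiag n g \<nu> a a)) = (\<Sum>j<n. \<nu> j * t j)"
    unfolding d t_def by (subst sum.swap) (simp only: sum_distrib_left)
  moreover have tsum: "(\<Sum>j<n. t j) = real (Suc k)"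
  proof -
    have "(\<Sum>j<n. (cmod (g $$ (a, j)))\<^sup>2) = 1" if "a < Suc k" for a
    proof -
      have "complex_of_real (\<Sum>l<n. (cmod (g $$ (a, l)))\<^sup>2) = of_real 1"
        using unitary_rows[OF g, of a a] that k by (simp only: of_real_sum sq[symmetric]) simp
      then show ?thesis using of_real_eq_iff by blast
    qed
    then have "(\<Sum>a<Suc k. \<Sum>j<n. (cmod (g $$ (a, j)))\<^sup>2) = (\<Sum>a<Suc k. 1)" by (intro sum.cong) auto
    then show ?thesis unfolding t_def by (subst sum.swap) simp
  qed
  moreover have split: "(\<Sum>j<n. f j) = (\<Sum>j<Suc k. f j) + (\<Sum>j\<in>{Suc k..<n}. f j)" for f :: "nat \<Rightarrow> real"
    using sum.atLeastLessThan_concat[of 0 "Suc k" n f] k by (simp add: atLeast0LessThan)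
  moreover have "(\<Sum>j<Suc k. (\<nu> j - \<nu> k) * (1 - t j)) =
      (\<Sum>j<Suc k. \<nu> j) - (\<Sum>j<Suc k. \<nu> j * t j) - \<nu> k * real (Suc k) + \<nu> k * (\<Sum>j<Suc k. t j)"
    by (simp add: algebra_simps sum.distrib sum_subtractf sum_distrib_left del: sum.lessThan_Suc)
  moreover have "(\<Sum>j\<in>{Suc k..<n}. (\<nu> k - \<nu> j) * t j) = \<nu> k * (\<Sum>j\<in>{Suc k..<n}. t j) - (\<Sum>j\<in>{Suc k..<n}. \<nu> j * t j)"
    by (simp add: algebra_simps sum_subtractf sum_distrib_left)
  moreover have "\<nu> k * (\<Sum>j<Suc k. t j) + \<nu> k * (\<Sum>j\<in>{Suc k..<n}. t j) = \<nu> k * real (Suc k)"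
    using tsum split[of t] by (simp only: distrib_left[symmetric])
  ultimately show "(\<Sum>a<Suc k. Re (udiag n g \<nu> a a)) = (\<Sum>j<Suc k. \<nu> j) -
      ((\<Sum>j<Suc k. (\<nu> j - \<nu> k) * (1 - t j)) + (\<Sum>j\<in>{Suc k..<n}. (\<nu> k - \<nu> j) * t j))"
    using split[of "\<lambda>j. \<nu> j * t j"] by linarith
  fix j assume j: "j < n"
  have "complex_of_real (\<Sum>l<n. (cmod (g $$ (l, j)))\<^sup>2) = (\<Sum>l<n. cnj (g $$ (l, j)) * g $$ (l, j))"
    unfolding of_real_sum sq[symmetric] by (simp only: mult.commute)
  also have "\<dots> = of_real 1" using unitary_cols[OF g j j] by simp
  finally have "(\<Sum>l<n. (cmod (g $$ (l, j)))\<^sup>2) = 1" using of_real_eq_iff by blast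
  moreover have "t j \<le> (\<Sum>l<n. (cmod (g $$ (l, j)))\<^sup>2)"
    unfolding t_def by (rule sum_mono2) (use k in auto)
  ultimately show "0 \<le> t j \<and> t j \<le> 1" by (simp add: t_def sum_nonneg)
qed

lemma Ky_Fan_le:
  assumes g: "g \<in> unitary_group n" and k: "k \<le> n"
    and decr: "\<And>i j. i < j \<Longrightarrow> j < n \<Longrightarrow> \<nu> j \<le> \<nu> i"
  shows "(\<Sum>a<k. Re (udiag n g \<nu> a a)) \<le> (\<Sum>j<k. \<nu> j)"
proof (cases k)
  case (Suc p)
  then have p: "p < n" using k by simp
  have le: "\<nu> p \<le> \<nu> j" if "j < Suc p" for j using decr[of j p] that p by (cases "j = p") auto
  note KF1 = Ky_Fan(1)[OF g p, where \<nu>=\<nu>] and KF2 = Ky_Fan(2)[OF g p]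
  define t where "t j = (\<Sum>a<Suc p. (cmod (g $$ (a, j)))\<^sup>2)" for j
  have t: "0 \<le> t j \<and> t j \<le> 1" if "j < n" for j using KF2[OF that] unfolding t_def .
  have "0 \<le> (\<Sum>j<Suc p. (\<nu> j - \<nu> p) * (1 - t j))"
    by (intro sum_nonneg mult_nonneg_nonneg) (use le t p in auto)
  moreover have "0 \<le> (\<Sum>j\<in>{Suc p..<n}. (\<nu> p - \<nu> j) * t j)"
    by (intro sum_nonneg mult_nonneg_nonneg) (use decr t p in auto)
  ultimately show ?thesis using KF1 unfolding Suc t_def by linarith
qed simp

text \<open>In the basis of the columns of \<open>g\<close> the matrix has diagonal
  \<open>\<mu>\<close>, to which the Ky Fan inequality for the eigenvalues \<open>\<nu>\<close>
  applies.\<close>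

lemma spectrum_le:
  assumes g: "g \<in> unitary_group n" and h: "h \<in> unitary_group n"
    and eq: "\<And>i j. i < n \<Longrightarrow> j < n \<Longrightarrow> udiag n g \<mu> i j = udiag n h \<nu> i j"
    and decr: "\<And>i j. i < j \<Longrightarrow> j < n \<Longrightarrow> \<nu> j \<le> \<nu> i" and k: "k \<le> n"
  shows "(\<Sum>j<k. \<mu> j) \<le> (\<Sum>j<k. \<nu> j)"
proof -
  note c = unitary_carrier[OF g] unitary_carrier[OF h]
  have one: "mat_adjoint g * g = 1\<^sub>m n" using g by (simp add: unitary_group_def)
  have "udiag n (mat_adjoint g * h) \<nu> i i = of_real (\<mu> i)" if "i < n" for i
  proof -
    have "udiag n (mat_adjoint g * h) \<nu> i i = (\<Sum>a<n. \<Sum>b<n. cnj (g $$ (a, i)) * udiag n g \<mu> a b * g $$ (b, i))"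
      unfolding udiag_conj[OF c that that, symmetric] by (intro sum.cong refl) (simp add: eq)
    also have "\<dots> = of_real (\<mu> i)"
      unfolding udiag_conj[OF c(1,1) that that] one using that by (simp add: udiag_one)
    finally show ?thesis .
  qed
  then have "(\<Sum>j<k. \<mu> j) = (\<Sum>a<k. Re (udiag n (mat_adjoint g * h) \<nu> a a))"
    using k by (intro sum.cong) simp_all
  then show ?thesis using Ky_Fan_le[OF unitary_adjoint_mult[OF g h] k, of \<nu>] decr by simp
qed

text \<open>By \<open>spectrum_le\<close> in both directions all partial sums agree, hence so do
  their differences.\<close>

lemma spectrum_unique:
  assumes g: "g \<in> unitary_group n" and h: "h \<in> unitary_group n"
    and eq: "\<And>i j. i < n \<Longrightarrow> j < n \<Longrightarrow> udiag n g \<mu> i j = udiag n h \<nu> i j"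
    and decr: "\<And>i j. i < j \<Longrightarrow> j < n \<Longrightarrow> \<mu> j \<le> \<mu> i" "\<And>i j. i < j \<Longrightarrow> j < n \<Longrightarrow> \<nu> j \<le> \<nu> i"
    and i: "i < n"
  shows "\<mu> i = \<nu> i"
proof -
  have s: "(\<Sum>j<k. \<mu> j) = (\<Sum>j<k. \<nu> j)" if "k \<le> n" for k
    using spectrum_le[OF g h eq decr(2) that] spectrum_le[OF h g eq[symmetric] decr(1) that] by linarith
  show ?thesis using s[of i] s[of "Suc i"] i by simp
qed

text \<open>From a triangularisation \<open>A = P * B * Q\<close>, the QR decomposition of
  \<open>P\<close> gives a unitary \<open>g\<close> whose leading columns span the same flag.
  Conjugating \<open>A\<close> by \<open>g\<close> therefore gives an upper triangular matrix; being
  Hermitian, it is diagonal with real entries.\<close>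

lemma Hermitian_Schur:
  assumes A: "A \<in> carrier_mat n n"
    and herm: "\<And>i j. i < n \<Longrightarrow> j < n \<Longrightarrow> A $$ (j, i) = cnj (A $$ (i, j))"
    and cp: "char_poly A = (\<Prod>e\<leftarrow>es. [:- e, 1:])" and len: "length es = n"
  shows "\<exists>g\<in>unitary_group n. (\<forall>i<n. es ! i = of_real (Re (es ! i))) \<and>
    (\<forall>i<n. \<forall>j<n. A $$ (i, j) = udiag n g (\<lambda>l. Re (es ! l)) i j)"
proof -
  obtain B P Q where "schur_decomposition A es = (B, P, Q)" by (cases "schur_decomposition A es")
  then have sim: "similar_mat_wit A B P Q" and up: "upper_triangular B" and dg: "diag_mat B = es"
    using schur_decomposition[OF A cp] by auto
  have c: "B \<in> carrier_mat n n" "P \<in> carrier_mat n n" "Q \<in> carrier_mat n n"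
    and PQ: "P * Q = 1\<^sub>m n" "Q * P = 1\<^sub>m n" and AB: "A = P * B * Q"
    using similar_mat_witD2[OF A sim] by auto
  \<comment> \<open>The condition for QR: if all minors on the first \<open>k\<close> columns of
    \<open>P\<close> vanished, Cauchy--Binet for \<open>Q * P = 1\<close> would give a zero leading
    minor of the identity.\<close>
  have "\<exists>r. (\<forall>a<k. r a < n) \<and> fdet k (\<lambda>a b. P $$ (r a, b)) \<noteq> 0" if k: "k \<le> n" for k
  proof (rule ccontr)
    assume no: "\<not> ?thesis"
    have "fdet k (\<lambda>a b. \<Sum>l<n. Q $$ (a, l) * P $$ (l, b)) = fdet k (\<lambda>a b. if a = b then 1 else 0)"
      using k PQ(2) by (intro fdet_cong) (simp add: index_mult_sum[OF c(3,2), symmetric] del: index_mult_mat(1))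
    also have "\<dots> = (\<Prod>a<k. 1)" by (subst fdet_upper_triangular) simp_all
    finally have "fdet k (\<lambda>a b. \<Sum>l<n. Q $$ (a, l) * P $$ (l, b)) = 1" by simp
    moreover have "fdet k (\<lambda>a b. P $$ (pick K a, b)) = 0" if "K \<in> ksub n k" for K
      using no pick_less[OF that] by blast
    ultimately show False by (simp add: Cauchy_Binet)
  qed
  then obtain g b where g: "g \<in> unitary_group n" and b: "upper_pos n b"
    and Pgb: "\<forall>a<n. \<forall>j<n. P $$ (a, j) = (\<Sum>i<n. g $$ (a, i) * b i j)"
    using QR_unitary[of n "\<lambda>i j. P $$ (i, j)"] by blast
  note gc = unitary_carrier[OF g]
  note ga = mat_adjoint_carrier[OF gc]
  define bm where "bm = mat n n (\<lambda>(i, j). b i j)"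
  define H where "H = mat_adjoint g * A * g"
  have bc: "bm \<in> carrier_mat n n" by (simp add: bm_def)
  have Hc: "H \<in> carrier_mat n n" unfolding H_def by (rule mult_carrier_mat[OF mult_carrier_mat[OF ga A] gc])
  have one: "mat_adjoint g * g = 1\<^sub>m n" "g * mat_adjoint g = 1\<^sub>m n"
    using g unitary_group_inverse(2)[OF g] gc by (simp_all add: unitary_group_def inverts_mat_def)
  have P: "P = g * bm"
    by (rule eq_matI) (use Pgb c(2) gc bc in \<open>auto simp: index_mult_sum[OF gc mat_carrier] bm_def simp del: index_mult_mat(1)\<close>)
  have AP: "A * P = P * B"
    unfolding AB assoc_mult_mat[OF mult_carrier_mat[OF c(2,1)] c(3,2)] PQ(2)
    by (rule right_mult_one_mat[OF mult_carrier_mat[OF c(2,1)]])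
  have AP': "A * (g * bm) = g * (bm * B)"
    using AP assoc_mult_mat[OF gc bc c(1)] by (simp only: P)
  have "H * bm = mat_adjoint g * (A * (g * bm))"
    unfolding H_def assoc_mult_mat[OF mult_carrier_mat[OF ga A] gc bc]
    by (rule assoc_mult_mat[OF ga A mult_carrier_mat[OF gc bc]])
  also have "\<dots> = (mat_adjoint g * g) * (bm * B)"
    unfolding AP'
    by (rule assoc_mult_mat[OF ga gc mult_carrier_mat[OF bc c(1)], symmetric])
  finally have HB: "H * bm = bm * B"
    unfolding one using left_mult_one_mat[OF mult_carrier_mat[OF bc c(1)]] by simp
  define cc where "cc i j = (\<Sum>l<n. b i l * B $$ (l, j))" for i j
  have HBij: "(\<Sum>l<n. H $$ (i, l) * b l j) = cc i j" if "i < n" "j < n" for i j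
    using arg_cong[OF HB, of "\<lambda>m. m $$ (i, j)"] that
    by (simp add: index_mult_sum[OF Hc mat_carrier] index_mult_sum[OF mat_carrier c(1)] cc_def bm_def
        del: index_mult_mat(1))
  have bup: "b i j = 0" if "j < i" "i < n" for i j using b that by (simp add: upper_pos_def)
  have bd: "b j j \<noteq> 0" if "j < n" for j using b that unfolding upper_pos_def by (metis less_irrefl)
  have Bup: "B $$ (i, j) = 0" if "j < i" "i < n" for i j using up c(1) that by (auto simp: upper_triangular_def)
  have cup: "cc i j = 0" if "j < i" "i < n" for i j
    unfolding cc_def
  proof (intro sum.neutral ballI)
    fix l assume "l \<in> {..<n}"
    then show "b i l * B $$ (l, j) = 0" using bup[of l i] Bup[of j l] that by (cases "l < i") auto
  qed
  have cd: "cc j j = b j j * B $$ (j, j)" if "j < n" for j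
  proof -
    have "cc j j = (\<Sum>l\<in>{j}. b j l * B $$ (l, j))"
      unfolding cc_def
    proof (rule sum.mono_neutral_right)
      show "\<forall>l\<in>{..<n} - {j}. b j l * B $$ (l, j) = 0"
      proof
        fix l assume "l \<in> {..<n} - {j}"
        then show "b j l * B $$ (l, j) = 0" using bup[of l j] Bup[of j l] that by (cases "l < j") auto
      qed
    qed (use that in auto)
    then show ?thesis by simp
  qed
  have Hup: "(\<forall>i<n. j < i \<longrightarrow> H $$ (i, j) = 0) \<and> H $$ (j, j) * b j j = cc j j" if "j < n" for j
    by (rule upper_factor[of n b cc "\<lambda>i j. H $$ (i, j)", OF bup bd cup HBij that])
  have es: "es ! j = B $$ (j, j)" if "j < n" for j
    using dg[symmetric] c(1) that by (simp add: diag_mat_def)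
  have Hd: "H $$ (j, j) = es ! j" if "j < n" for j
    using Hup[OF that] cd[OF that] bd[OF that] es[OF that] by simp
  have Hij: "H $$ (i, j) = (\<Sum>a<n. \<Sum>d<n. cnj (g $$ (a, i)) * A $$ (a, d) * g $$ (d, j))" if "i < n" "j < n" for i j
  proof -
    have "H $$ (i, j) = (\<Sum>d<n. (\<Sum>a<n. cnj (g $$ (a, i)) * A $$ (a, d)) * g $$ (d, j))"
      unfolding H_def using that gc A
      by (subst index_mult_sum[OF mult_carrier_mat[OF ga A] gc that], intro sum.cong refl arg_cong2[where f="(*)"])
        (simp add: index_mult_sum[OF ga A] del: index_mult_mat(1))
    also have "\<dots> = (\<Sum>d<n. \<Sum>a<n. cnj (g $$ (a, i)) * A $$ (a, d) * g $$ (d, j))"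
      by (simp add: sum_distrib_right)
    also have "\<dots> = (\<Sum>a<n. \<Sum>d<n. cnj (g $$ (a, i)) * A $$ (a, d) * g $$ (d, j))" by (rule sum.swap)
    finally show ?thesis .
  qed
  have Hherm: "H $$ (j, i) = cnj (H $$ (i, j))" if "i < n" "j < n" for i j
  proof -
    have "cnj (H $$ (i, j)) = (\<Sum>a<n. \<Sum>d<n. cnj (g $$ (d, j)) * A $$ (d, a) * g $$ (a, i))"
      unfolding Hij[OF that] cnj_sum
    proof (intro sum.cong refl)
      fix a d assume "a \<in> {..<n}" "d \<in> {..<n}"
      then have "A $$ (d, a) = cnj (A $$ (a, d))" by (intro herm) simp_all
      then show "cnj (cnj (g $$ (a, i)) * A $$ (a, d) * g $$ (d, j)) = cnj (g $$ (d, j)) * A $$ (d, a) * g $$ (a, i)"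
        by simp
    qed
    also have "\<dots> = H $$ (j, i)" unfolding Hij[OF that(2,1)] by (rule sum.swap)
    finally show ?thesis by (rule sym)
  qed
  have real: "es ! i = of_real (Re (es ! i))" if "i < n" for i
  proof -
    have "cnj (es ! i) = es ! i" using Hherm[OF that that] unfolding Hd[OF that] by (rule sym)
    then show ?thesis by (simp add: complex_eq_iff)
  qed
  have Hdiag: "H $$ (i, j) = (if i = j then of_real (Re (es ! i)) else 0)" if "i < n" "j < n" for i j
  proof -
    consider "i = j" | "j < i" | "i < j" by linarith
    then show ?thesis
    proof cases
      case 1 then show ?thesis using Hd[OF that(1)] real[OF that(1)] by simp
    next
      case 2 then show ?thesis using Hup[OF that(2)] that by simp
    next
      case 3
      then have "H $$ (j, i) = 0" using Hup[OF that(1)] that by simp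
      then show ?thesis using Hherm[OF that(2,1)] 3 by simp
    qed
  qed
  have "g * H = g * mat_adjoint g * A * g"
    unfolding H_def assoc_mult_mat[OF ga A gc] assoc_mult_mat[OF gc ga mult_carrier_mat[OF A gc], symmetric]
    by (rule assoc_mult_mat[OF mult_carrier_mat[OF gc ga] A gc, symmetric])
  then have gH: "g * H = A * g" unfolding one left_mult_one_mat[OF A] .
  have AgH: "A = g * H * mat_adjoint g"
    unfolding gH assoc_mult_mat[OF A gc ga] one right_mult_one_mat[OF A] ..
  have "A $$ (i, j) = udiag n g (\<lambda>l. Re (es ! l)) i j" if "i < n" "j < n" for i j
  proof -
    have "(g * H) $$ (i, l) = g $$ (i, l) * of_real (Re (es ! l))" if l: "l < n" for l
    proof -
      have "(g * H) $$ (i, l) = (\<Sum>m<n. if m = l then g $$ (i, l) * of_real (Re (es ! l)) else 0)"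
        unfolding index_mult_sum[OF gc Hc \<open>i < n\<close> l] by (intro sum.cong refl) (use Hdiag l in auto)
      then show ?thesis using l by simp
    qed
    then show ?thesis
      unfolding udiag_def by (subst AgH, subst index_mult_sum[OF mult_carrier_mat[OF gc Hc] ga that])
        (use that gc in \<open>simp del: index_mult_mat(1)\<close>)
  qed
  then show ?thesis using g real by blast
qed

text \<open>\<open>Hermitian_Schur\<close> is applied twice. The first use only shows that the roots
  are real; then they can be sorted, and the second use realises them in decreasing order.\<close>

lemma spectral_theorem:
  assumes A: "A \<in> carrier_mat n n"
    and herm: "\<And>i j. i < n \<Longrightarrow> j < n \<Longrightarrow> A $$ (j, i) = cnj (A $$ (i, j))"
  shows "\<exists>g\<in>unitary_group n. \<exists>\<mu>. (\<forall>i j. i < j \<longrightarrow> j < n \<longrightarrow> \<mu> j \<le> \<mu> i) \<and>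
    (\<forall>i<n. \<forall>j<n. A $$ (i, j) = udiag n g \<mu> i j)"
proof -
  obtain es where es: "char_poly A = (\<Prod>e\<leftarrow>es. [:- e, 1:])" "length es = n"
    using char_poly_factorized[OF A] by blast
  have "\<exists>g\<in>unitary_group n. (\<forall>i<n. es ! i = of_real (Re (es ! i))) \<and>
    (\<forall>i<n. \<forall>j<n. A $$ (i, j) = udiag n g (\<lambda>l. Re (es ! l)) i j)"
    by (rule Hermitian_Schur[OF A herm es])
  then have real: "\<forall>i<n. es ! i = of_real (Re (es ! i))" by (elim bexE conjE)
  define xs where "xs = rev (sort (map Re es))"
  have re: "map complex_of_real (map Re es) = es"
  proof (rule nth_equalityI)
    fix i assume "i < length (map complex_of_real (map Re es))"
    then show "map complex_of_real (map Re es) ! i = es ! i"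
      using real[rule_format, of i, symmetric] es(2) by (simp del: map_map)
  qed simp
  have "mset (map complex_of_real xs) = mset (map complex_of_real (map Re es))"
    unfolding xs_def by (simp only: mset_map mset_rev mset_sort)
  then have "mset (map complex_of_real xs) = mset es" unfolding re .
  then have "mset (map (\<lambda>e. [:- e, 1:]) (map complex_of_real xs)) = mset (map (\<lambda>e. [:- e, 1:]) es)"
    by (simp only: mset_map)
  then have "(\<Prod>e\<leftarrow>map complex_of_real xs. [:- e, 1:]) = (\<Prod>e\<leftarrow>es. [:- e, 1:])"
    by (simp only: prod_mset_prod_list[symmetric])
  then have cp: "char_poly A = (\<Prod>e\<leftarrow>map complex_of_real xs. [:- e, 1:])" using es by simp
  have len: "length xs = n" using es by (simp add: xs_def)
  have "\<exists>g\<in>unitary_group n. (\<forall>i<n. map complex_of_real xs ! i = of_real (Re (map complex_of_real xs ! i))) \<and>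
    (\<forall>i<n. \<forall>j<n. A $$ (i, j) = udiag n g (\<lambda>l. Re (map complex_of_real xs ! l)) i j)"
    by (rule Hermitian_Schur[OF A herm cp]) (simp_all add: len)
  then obtain g where g: "g \<in> unitary_group n"
    "\<forall>i<n. \<forall>j<n. A $$ (i, j) = udiag n g (\<lambda>l. Re (map complex_of_real xs ! l)) i j"
    by (elim bexE conjE)
  have "udiag n g (\<lambda>l. Re (map complex_of_real xs ! l)) i j = udiag n g (\<lambda>l. xs ! l) i j" for i j
    unfolding udiag_def using len by (intro sum.cong refl) simp
  then have "\<forall>i<n. \<forall>j<n. A $$ (i, j) = udiag n g (\<lambda>l. xs ! l) i j" using g(2) by simp
  moreover have "\<forall>i j. i < j \<longrightarrow> j < n \<longrightarrow> xs ! j \<le> xs ! i"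
    using len by (intro allI impI sorted_rev_nth_mono) (auto simp: xs_def)
  ultimately show ?thesis using g(1) by (intro bexI[of _ g] exI[of _ "\<lambda>l. xs ! l"] conjI)
qed

section \<open>Tridiagonal matrices\<close>

text \<open>Two entries that might collide either move in the same direction or are kept apart by
  their strictly ordered targets.\<close>

lemma incr_step_toward:
  assumes r: "incr k n r" and c: "incr k n c"
  defines "s \<equiv> \<lambda>a. if r a < c a then r a + 1 else if c a < r a then r a - 1 else r a"
  shows "incr k n s"
proof -
  have "s a < s b" if "a < b" "b < k" for a b
    using incr_mono[OF r that] incr_mono[OF c that] unfolding s_def by auto
  moreover have "s a < n" if "a < k" for a
    using incr_less[OF r that] incr_less[OF c that] unfolding s_def by auto
  ultimately show ?thesis by (auto simp: incr_def strict_mono_on_def)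
qed

text \<open>A row set is moved towards a column set one unit step at a time, and each unit step is
  realised by a positive minor of the tridiagonal factor.\<close>

lemma tridiagonal_power_minors:
  fixes P :: "nat \<Rightarrow> nat \<Rightarrow> real"
  assumes g: "g \<in> unitary_group n"
    and X: "\<And>i j. i < n \<Longrightarrow> j < n \<Longrightarrow> udiag n g \<mu> i j = of_real ((if i = j then 1 else 0) + q * P i j)"
    and off: "\<And>i. Suc i < n \<Longrightarrow> 0 < P i (Suc i) \<and> 0 < P (Suc i) i"
    and minors: "\<And>k I J. k \<le> n \<Longrightarrow> I \<in> ksub n k \<Longrightarrow> J \<in> ksub n k \<Longrightarrow>
      0 \<le> fdet k (\<lambda>a b. (if pick I a = pick J b then 1 else 0) + q * P (pick I a) (pick J b)) \<and>
      ((\<forall>a<k. pick I a = pick J a \<or> 0 < P (pick I a) (pick J a)) \<longrightarrow>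
        0 < fdet k (\<lambda>a b. (if pick I a = pick J b then 1 else 0) + q * P (pick I a) (pick J b)))"
  shows "k \<le> n \<Longrightarrow> I \<in> ksub n k \<Longrightarrow> J \<in> ksub n k \<Longrightarrow>
      0 \<le> fdet k (\<lambda>a b. udiag n g (\<lambda>l. \<mu> l ^ m) (pick I a) (pick J b)) \<and>
      ((\<forall>a<k. pick I a \<le> pick J a + m \<and> pick J a \<le> pick I a + m) \<longrightarrow>
        0 < fdet k (\<lambda>a b. udiag n g (\<lambda>l. \<mu> l ^ m) (pick I a) (pick J b)))"
\<comment> \<open>The first factor moves the row set, so \<open>I\<close> varies while
  \<open>J\<close> stays the target.\<close>
proof (induction m arbitrary: I)
  case 0
  have "fdet k (\<lambda>a b. udiag n g (\<lambda>l. \<mu> l ^ 0) (pick I a) (pick J b)) = (if I = J then 1 else 0)"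
    using fdet_delta[OF 0(2,3)] unitary_rows[OF g] pick_less[OF 0(2)] pick_less[OF 0(3)]
    by (subst fdet_cong[where h'="\<lambda>a b. if pick I a = pick J b then 1 else 0"]) (simp_all add: udiag_def)
  moreover have "I = J" if "\<forall>a<k. pick I a \<le> pick J a + 0 \<and> pick J a \<le> pick I a + 0"
  proof -
    have "pick I a = pick J a" if "a < k" for a
      using \<open>\<forall>a<k. pick I a \<le> pick J a + 0 \<and> pick J a \<le> pick I a + 0\<close> that by (simp add: le_antisym)
    then have "pick I ` {..<k} = pick J ` {..<k}" by simp
    then show ?thesis using pick_image_ksub[OF 0(2)] pick_image_ksub[OF 0(3)] by simp
  qed
  ultimately show ?case by (simp add: complex_zero_less_one less_imp_le)
next
  case (Suc m)
  note I = Suc.prems(2) and J = Suc.prems(3)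
  have Xm: "fdet k (\<lambda>a b. udiag n g \<mu> (pick I a) (pick K b)) =
      of_real (fdet k (\<lambda>a b. (if pick I a = pick K b then 1 else 0) + q * P (pick I a) (pick K b)))"
    if "K \<in> ksub n k" for K
    unfolding fdet_of_real by (rule fdet_cong) (use X pick_less I that in simp)
  have X0: "0 \<le> fdet k (\<lambda>a b. udiag n g \<mu> (pick I a) (pick K b))" if "K \<in> ksub n k" for K
    using minors[OF Suc.prems(1) I that] by (simp add: Xm[OF that])
  have eq: "fdet k (\<lambda>a b. udiag n g (\<lambda>l. \<mu> l ^ Suc m) (pick I a) (pick J b)) =
    (\<Sum>K\<in>ksub n k. fdet k (\<lambda>a b. udiag n g \<mu> (pick I a) (pick K b)) *
      fdet k (\<lambda>a b. udiag n g (\<lambda>l. \<mu> l ^ m) (pick K a) (pick J b)))"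
  proof -
    have "fdet k (\<lambda>a b. udiag n g (\<lambda>l. \<mu> l ^ Suc m) (pick I a) (pick J b)) =
      fdet k (\<lambda>a b. \<Sum>x<n. udiag n g \<mu> (pick I a) x * udiag n g (\<lambda>l. \<mu> l ^ m) x (pick J b))"
      by (simp only: udiag_mult[OF g] power_Suc)
    also have "\<dots> = (\<Sum>K\<in>ksub n k. fdet k (\<lambda>a b. udiag n g \<mu> (pick I a) (pick K b)) *
      fdet k (\<lambda>a b. udiag n g (\<lambda>l. \<mu> l ^ m) (pick K a) (pick J b)))"
      by (rule Cauchy_Binet)
    finally show ?thesis .
  qed
  have nn: "0 \<le> fdet k (\<lambda>a b. udiag n g \<mu> (pick I a) (pick K b)) *
      fdet k (\<lambda>a b. udiag n g (\<lambda>l. \<mu> l ^ m) (pick K a) (pick J b))" if "K \<in> ksub n k" for K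
    using X0[OF that] Suc.IH[OF Suc.prems(1) that J] by (intro mult_nonneg_nonneg) auto
  show ?case unfolding eq
  proof (intro conjI impI sum_nonneg nn)
    assume near: "\<forall>a<k. pick I a \<le> pick J a + Suc m \<and> pick J a \<le> pick I a + Suc m"
    define s where "s a = (if pick I a < pick J a then pick I a + 1 else if pick J a < pick I a then pick I a - 1 else pick I a)" for a
    have s: "incr k n s" unfolding s_def by (rule incr_step_toward[OF incr_pick[OF I] incr_pick[OF J]])
    define K where "K = s ` {..<k}"
    have K: "K \<in> ksub n k" unfolding K_def by (rule incr_image[OF s])
    have sK: "pick K a = s a" if "a < k" for a unfolding K_def using incr_eq_pick[OF s that] by simp
    have "pick I a = pick K a \<or> 0 < P (pick I a) (pick K a)" if a: "a < k" for a
    proof -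
      note l = pick_less[OF I a] pick_less[OF J a]
      consider "pick I a < pick J a" | "pick J a < pick I a" | "pick I a = pick J a" by linarith
      then show ?thesis
      proof cases
        case 1
        then show ?thesis using off[of "pick I a"] l sK[OF a] by (simp add: s_def)
      next
        case 2
        then obtain p where "pick I a = Suc p" by (cases "pick I a") auto
        then show ?thesis using 2 off[of p] l sK[OF a] by (simp add: s_def)
      next
        case 3
        then show ?thesis using sK[OF a] by (simp add: s_def)
      qed
    qed
    then have 1: "0 < fdet k (\<lambda>a b. udiag n g \<mu> (pick I a) (pick K b))"
      using minors[OF Suc.prems(1) I K] by (simp add: Xm[OF K])
    have "\<forall>a<k. pick K a \<le> pick J a + m \<and> pick J a \<le> pick K a + m"
    proof (intro allI impI)
      fix a assume a: "a < k"
      show "pick K a \<le> pick J a + m \<and> pick J a \<le> pick K a + m"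
        using near[rule_format, OF a] unfolding sK[OF a] s_def by auto
    qed
    then have 2: "0 < fdet k (\<lambda>a b. udiag n g (\<lambda>l. \<mu> l ^ m) (pick K a) (pick J b))"
      using Suc.IH[OF Suc.prems(1) K J] by blast
    show "0 < (\<Sum>K\<in>ksub n k. fdet k (\<lambda>a b. udiag n g \<mu> (pick I a) (pick K b)) *
      fdet k (\<lambda>a b. udiag n g (\<lambda>l. \<mu> l ^ m) (pick K a) (pick J b)))"
      by (rule sum_pos2[OF finite_ksub K]) (rule complex_mult_pos[OF 1 2], rule nn)
  qed
qed

text \<open>What is used of the shift \<open>1 + q P\<close> for a suitable small \<open>q\<close>:
  the eigenvectors \<open>g\<close> are kept, possibly negative eigenvalues become nonnegative as
  Perron--Frobenius requires, and the minors are nonnegative with a criterion for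
  strictness.\<close>

definition tnn_shift :: "nat \<Rightarrow> (nat \<Rightarrow> nat \<Rightarrow> real) \<Rightarrow> complex mat \<Rightarrow> (nat \<Rightarrow> real) \<Rightarrow> real \<Rightarrow> bool" where
  "tnn_shift n P g \<mu> q \<longleftrightarrow> 0 < q \<and> (\<forall>i<n. 0 \<le> 1 + q * \<mu> i) \<and>
    (\<forall>i<n. \<forall>j<n. udiag n g (\<lambda>l. 1 + q * \<mu> l) i j = of_real ((if i = j then 1 else 0) + q * P i j)) \<and>
    (\<forall>k\<le>n. \<forall>I\<in>ksub n k. \<forall>J\<in>ksub n k.
      0 \<le> fdet k (\<lambda>a b. (if pick I a = pick J b then 1 else 0) + q * P (pick I a) (pick J b)) \<and>
      ((\<forall>a<k. pick I a = pick J a \<or> 0 < P (pick I a) (pick J a)) \<longrightarrow>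
        0 < fdet k (\<lambda>a b. (if pick I a = pick J b then 1 else 0) + q * P (pick I a) (pick J b))))"

lemma eventually_shift_minors:
  fixes P :: "nat \<Rightarrow> nat \<Rightarrow> real"
  assumes tri: "\<And>i j. i + 1 < j \<or> j + 1 < i \<Longrightarrow> P i j = 0"
    and off: "\<And>i. 0 \<le> P i (Suc i)" "\<And>i. 0 \<le> P (Suc i) i"
    and eq: "\<And>i j. i < n \<Longrightarrow> j < n \<Longrightarrow> of_real (P i j) = udiag n g \<mu> i j"
    and g: "g \<in> unitary_group n"
  shows "\<exists>q. tnn_shift n P g \<mu> q"
proof -
  let ?T = "\<lambda>q. \<forall>k\<le>n. \<forall>I\<in>ksub n k. \<forall>J\<in>ksub n k.
      0 \<le> fdet k (\<lambda>a b. (if pick I a = pick J b then 1 else 0) + q * P (pick I a) (pick J b)) \<and>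
      ((\<forall>a<k. pick I a = pick J a \<or> 0 < P (pick I a) (pick J a)) \<longrightarrow>
        0 < fdet k (\<lambda>a b. (if pick I a = pick J b then 1 else 0) + q * P (pick I a) (pick J b)))"
  have "\<forall>\<^sub>F q in at_right (0::real). \<forall>i\<in>{..<n}. 0 < 1 + q * \<mu> i"
  proof (intro eventually_ball_finite finite_lessThan ballI)
    fix i
    have "((\<lambda>q. 1 + q * \<mu> i) \<longlongrightarrow> 1 + 0 * \<mu> i) (at_right 0)" by (intro tendsto_intros)
    then show "\<forall>\<^sub>F q in at_right 0. 0 < 1 + q * \<mu> i" by (rule order_tendstoD) simp
  qed
  moreover have "\<forall>\<^sub>F q in at_right 0. ?T q"
  proof (rule eventually_all_minors)
    fix k I J assume "I \<in> ksub n k" "J \<in> ksub n k"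
    note c = incr_pick[OF this(1)] incr_pick[OF this(2)]
    show "\<forall>\<^sub>F q in at_right 0.
      0 \<le> fdet k (\<lambda>a b. (if pick I a = pick J b then 1 else 0) + q * P (pick I a) (pick J b)) \<and>
      ((\<forall>a<k. pick I a = pick J a \<or> 0 < P (pick I a) (pick J a)) \<longrightarrow>
        0 < fdet k (\<lambda>a b. (if pick I a = pick J b then 1 else 0) + q * P (pick I a) (pick J b)))"
      by (rule eventually_tridiagonal_minor[where P=P and r="pick I" and c="pick J", OF tri off c])
  qed
  ultimately have ev: "\<forall>\<^sub>F q in at_right (0::real). (\<forall>i\<in>{..<n}. 0 < 1 + q * \<mu> i) \<and> ?T q \<and> 0 < q"
    by (intro eventually_conj eventually_at_right_less)
  obtain q :: real where q: "\<forall>i\<in>{..<n}. 0 < 1 + q * \<mu> i" "?T q" "0 < q"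
    using eventually_happens'[OF trivial_limit_at_right_real ev] by (elim exE conjE)
  have "udiag n g (\<lambda>l. 1 + q * \<mu> l) i j = of_real ((if i = j then 1 else 0) + q * P i j)" if "i < n" "j < n" for i j
  proof -
    have "udiag n g (\<lambda>l. 1 + q * \<mu> l) i j = (\<Sum>l<n. g $$ (i, l) * cnj (g $$ (j, l))) + of_real q * udiag n g \<mu> i j"
      by (simp add: udiag_def algebra_simps sum.distrib sum_distrib_left)
    then show ?thesis using unitary_rows[OF g that] eq[OF that, symmetric] by simp
  qed
  then have "tnn_shift n P g \<mu> q"
    unfolding tnn_shift_def using q by (intro conjI) (simp_all add: less_imp_le)
  then show ?thesis ..
qed

text \<open>Any two indices below \<open>n\<close> differ by less than \<open>n\<close>, so
  \<open>n\<close> unit steps connect all row and column sets, and the \<open>n\<close>-th power of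
  the shift is totally positive. Its eigenvalues are ordered like \<open>\<mu>\<close>, since the
  shifted ones are nonnegative.\<close>

lemma Jacobi_U_pos:
  fixes P :: "nat \<Rightarrow> nat \<Rightarrow> real"
  assumes tri: "\<And>i j. i + 1 < j \<or> j + 1 < i \<Longrightarrow> P i j = 0"
    and nn: "\<And>i. 0 \<le> P i (Suc i)" "\<And>i. 0 \<le> P (Suc i) i"
    and off: "\<And>i. Suc i < n \<Longrightarrow> 0 < P i (Suc i) \<and> 0 < P (Suc i) i"
    and eq: "\<And>i j. i < n \<Longrightarrow> j < n \<Longrightarrow> of_real (P i j) = udiag n g \<mu> i j"
    and g: "g \<in> unitary_group n" and decr: "\<And>i j. i < j \<Longrightarrow> j < n \<Longrightarrow> \<mu> j \<le> \<mu> i"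
  shows "\<exists>g'\<in>U_pos n. \<forall>\<nu>. \<forall>i<n. \<forall>j<n. udiag n g' \<nu> i j = udiag n g \<nu> i j"
proof -
  have "\<exists>q. tnn_shift n P g \<mu> q" by (rule eventually_shift_minors[OF tri nn eq g])
  then obtain q where "tnn_shift n P g \<mu> q" ..
  note q' = this[unfolded tnn_shift_def]
  note q = q'[THEN conjunct1] q'[THEN conjunct2, THEN conjunct1]
    q'[THEN conjunct2, THEN conjunct2, THEN conjunct1] q'[THEN conjunct2, THEN conjunct2, THEN conjunct2]
  have tp: "totally_pos n (udiag n g (\<lambda>l. (1 + q * \<mu> l) ^ n))"
    unfolding totally_pos_def
  proof (intro allI impI ballI)
    fix k I J assume k: "k \<le> n" and I: "I \<in> ksub n k" and J: "J \<in> ksub n k"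
    have "pick I a \<le> pick J a + n \<and> pick J a \<le> pick I a + n" if "a < k" for a
      using pick_less[OF I that] pick_less[OF J that] by simp
    moreover have "(\<forall>a<k. pick I a \<le> pick J a + n \<and> pick J a \<le> pick I a + n) \<longrightarrow>
        0 < fdet k (\<lambda>a b. udiag n g (\<lambda>l. (1 + q * \<mu> l) ^ n) (pick I a) (pick J b))"
      by (rule tridiagonal_power_minors[where P=P and q=q and \<mu>="\<lambda>l. 1 + q * \<mu> l" and m=n,
            OF g _ off _ k I J, THEN conjunct2]) (use q in blast)+
    ultimately show "0 < fdet k (\<lambda>a b. udiag n g (\<lambda>l. (1 + q * \<mu> l) ^ n) (pick I a) (pick J b))"
      by blast
  qed
  show ?thesis
  proof (rule totally_pos_udiag_imp_U_pos[OF g _ _ tp])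
    show "(1 + q * \<mu> j) ^ n \<le> (1 + q * \<mu> i) ^ n" if "i < j" "j < n" for i j
      using decr[OF that] q(1,2) that by (intro power_mono) auto
    show "0 \<le> (1 + q * \<mu> i) ^ n" if "i < n" for i using q(2) that by simp
  qed
qed

section \<open>Signs of the off-diagonal entries\<close>

lemma fdet_last_row_unit:
  assumes "\<And>b. b < k \<Longrightarrow> h k b = 0"
  shows "fdet (Suc k) h = h k k * fdet k h"
proof -
  have "fdet (Suc k) h = fdet (Suc k) (\<lambda>a b. h b a)" by (rule fdet_transpose[symmetric])
  also have "\<dots> = (\<Sum>i\<le>k. h k i * (-1) ^ (i + k) * fdet k (\<lambda>a b. h b (if a < i then a else Suc a)))"
    by (rule fdet_laplace_last_col)
  also have "\<dots> = (\<Sum>i\<in>{k}. h k i * (-1) ^ (i + k) * fdet k (\<lambda>a b. h b (if a < i then a else Suc a)))"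
    by (rule sum.mono_neutral_right) (use assms in auto)
  also have "\<dots> = h k k * fdet k (\<lambda>a b. h b (if a < k then a else Suc a))" by (simp add: mult_2[symmetric])
  also have "fdet k (\<lambda>a b. h b (if a < k then a else Suc a)) = fdet k (\<lambda>a b. h b a)" by (rule fdet_cong) simp
  also have "\<dots> = fdet k h" by (rule fdet_transpose)
  finally show ?thesis .
qed

text \<open>Rows taken in any order: expand by Cauchy--Binet, where the selection matrix only sees the set
  of chosen rows.\<close>

lemma nonzero_minor_image:
  fixes A :: "nat \<Rightarrow> nat \<Rightarrow> complex"
  assumes r: "\<And>a. a < k \<Longrightarrow> r a < n" and nz: "fdet k (\<lambda>a b. A (r a) b) \<noteq> 0"
  shows "r ` {..<k} \<in> ksub n k \<and> fdet k (\<lambda>a b. A (pick (r ` {..<k}) a) b) \<noteq> 0"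
proof -
  have inj: "inj_on r {..<k}"
  proof (rule inj_onI, rule ccontr)
    fix a b assume "a \<in> {..<k}" "b \<in> {..<k}" "r a = r b" "a \<noteq> b"
    then have "fdet k (\<lambda>a b. A (r a) b) = 0" by (intro fdet_identical_rows[of a k b]) auto
    then show False using nz by simp
  qed
  have rk: "r ` {..<k} \<in> ksub n k" using r inj by (auto simp: ksub_def card_image)
  have "fdet k (\<lambda>a b. A (r a) b) = fdet k (\<lambda>a b. \<Sum>l<n. (if r a = l then 1 else 0) * A l b)"
    using r by (intro fdet_cong) (simp add: if_distrib[where f="\<lambda>x. x * _"] cong: if_cong)
  also have "\<dots> = (\<Sum>K\<in>ksub n k. fdet k (\<lambda>a b. if r a = pick K b then 1 else 0) * fdet k (\<lambda>a b. A (pick K a) b))"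
    by (rule Cauchy_Binet)
  finally have "(\<Sum>K\<in>ksub n k. fdet k (\<lambda>a b. if r a = pick K b then 1 else 0) * fdet k (\<lambda>a b. A (pick K a) b)) \<noteq> 0"
    using nz by simp
  then obtain K where K: "K \<in> ksub n k" "fdet k (\<lambda>a b. if r a = pick K b then 1 else (0::complex)) \<noteq> 0"
    "fdet k (\<lambda>a b. A (pick K a) b) \<noteq> 0"
    by (rule sum.not_neutral_contains_not_neutral) auto
  have "r a \<in> K" if "a < k" for a
  proof (rule ccontr)
    assume "r a \<notin> K"
    then have "fdet k (\<lambda>a b. if r a = pick K b then 1 else (0::complex)) = 0"
      using pick_in_ksub[OF K(1)] by (intro fdet_zero_row[OF that]) auto
    then show False using K(2) by simp
  qed
  then have "r ` {..<k} \<subseteq> K" by auto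
  then have "r ` {..<k} = K" using ksubD[OF rk] ksubD[OF K(1)] by (intro card_subset_eq) auto
  then show ?thesis using rk K by simp
qed

lemma unitary_column_nonzero:
  assumes g: "g \<in> unitary_group n" and i: "i < n"
  shows "\<exists>c<n. g $$ (i, c) \<noteq> 0"
proof (rule ccontr)
  assume "\<not> ?thesis"
  then have "(\<Sum>l<n. g $$ (i, l) * cnj (g $$ (i, l))) = 0" by (intro sum.neutral) auto
  then show False using unitary_rows[OF g i i] by simp
qed

text \<open>Take the first column in which row \<open>i\<close> or row \<open>Suc i\<close> does not vanish.\<close>

lemma separating_minor:
  assumes g: "g \<in> unitary_group n" and i: "Suc i < n"
  shows "\<exists>k J p p'. k \<le> n \<and> J \<in> ksub n k \<and> fdet k (\<lambda>a b. g $$ (pick J a, b)) \<noteq> 0 \<and>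
    p \<in> J \<and> p' \<notin> J \<and> (p = i \<and> p' = Suc i \<or> p = Suc i \<and> p' = i)"
proof -
  define Q where "Q c \<longleftrightarrow> c < n \<and> (g $$ (i, c) \<noteq> 0 \<or> g $$ (Suc i, c) \<noteq> 0)" for c
  obtain c0 where "Q c0" using unitary_column_nonzero[OF g, of i] i unfolding Q_def by auto
  define c where "c = (LEAST c. Q c)"
  have c: "Q c" unfolding c_def by (rule LeastI) fact
  have before: "g $$ (i, x) = 0 \<and> g $$ (Suc i, x) = 0" if "x < c" for x
    using not_less_Least[of x Q] that c unfolding c_def Q_def by auto
  obtain p p' where p: "g $$ (p, c) \<noteq> 0" "p = i \<and> p' = Suc i \<or> p = Suc i \<and> p' = i"
    using c unfolding Q_def by blast
  have pn: "p < n" using p(2) i by auto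
  have cn: "c < n" using c by (simp add: Q_def)
  \<comment> \<open>Rows \<open>i\<close> and \<open>Suc i\<close> vanish before column
    \<open>c\<close>, so a nonzero minor on the columns before \<open>c\<close> contains neither of
    them.\<close>
  obtain J' where J': "J' \<in> ksub n c" "fdet c (\<lambda>a b. g $$ (pick J' a, b)) \<noteq> 0"
    using left_minor_nonzero[OF g, of c] cn by auto
  have notJ: "x \<notin> J'" if "x = i \<or> x = Suc i" for x
  proof
    assume "x \<in> J'"
    then obtain a where a: "a < c" "x = pick J' a" using pick_image_ksub[OF J'(1)] by blast
    have "fdet c (\<lambda>a b. g $$ (pick J' a, b)) = 0"
      by (rule fdet_zero_row[OF a(1)]) (use a that before in auto)
    then show False using J'(2) by simp
  qed
  \<comment> \<open>Row \<open>p\<close> is put last instead of in its sorted place, so the last row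
    of the minor is zero except in column \<open>c\<close>. Afterwards
    \<open>nonzero_minor_image\<close> passes to the sorted rows.\<close>
  define r where "r a = (if a < c then pick J' a else p)" for a
  have rn: "r a < n" if "a < Suc c" for a using pick_less[OF J'(1)] pn by (simp add: r_def)
  have "fdet (Suc c) (\<lambda>a b. g $$ (r a, b)) = g $$ (r c, c) * fdet c (\<lambda>a b. g $$ (r a, b))"
    by (rule fdet_last_row_unit) (use before p(2) in \<open>auto simp: r_def\<close>)
  also have "fdet c (\<lambda>a b. g $$ (r a, b)) = fdet c (\<lambda>a b. g $$ (pick J' a, b))"
    by (rule fdet_cong) (simp add: r_def)
  finally have nz: "fdet (Suc c) (\<lambda>a b. g $$ (r a, b)) \<noteq> 0" using p(1) J'(2) by (simp add: r_def)
  define J where "J = r ` {..<Suc c}"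
  have J: "J \<in> ksub n (Suc c)" "fdet (Suc c) (\<lambda>a b. g $$ (pick J a, b)) \<noteq> 0"
    using nonzero_minor_image[of "Suc c" r n "\<lambda>i j. g $$ (i, j)", OF rn nz] by (simp_all add: J_def)
  have "p \<in> J" unfolding J_def by (rule image_eqI[of _ _ c]) (simp_all add: r_def)
  moreover have "p' \<notin> J"
  proof
    assume "p' \<in> J"
    then obtain a where a: "a < Suc c" "p' = r a" by (auto simp: J_def)
    have "p' \<noteq> p" using p(2) by auto
    then have "a < c" "p' = pick J' a" using a by (auto simp: r_def split: if_splits)
    then have "p' \<in> J'" using pick_in_ksub[OF J'(1)] by simp
    then show False using notJ p(2) by blast
  qed
  ultimately show ?thesis using J p(2) cn by (intro exI[of _ "Suc c"] exI[of _ J] exI[of _ p] exI[of _ p']) simp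
qed

lemma complex_nonneg_cmod: "0 \<le> z \<Longrightarrow> of_real (cmod z) = z"
  by (auto simp: less_eq_complex_def complex_eq_iff cmod_eq_Re)

lemma cmod_1_cnj: "cmod z = 1 \<Longrightarrow> cnj z * z = 1"
  using complex_norm_square[of z] by (simp add: mult.commute)

text \<open>Conjugating by phases \<open>D\<close> makes the off-diagonal entries nonnegative; comparing the phases of
  two left-justified minors whose row sets differ by \<open>i \<leftrightarrow> Suc i\<close> shows that \<open>D i = D (Suc i)\<close>.\<close>

lemma tridiagonal_left_nonneg:
  assumes h: "h \<in> unitary_group n" and ln: "left_nonneg n (\<lambda>i j. h $$ (i, j))"
    and decr: "\<And>i j. i < j \<Longrightarrow> j < n \<Longrightarrow> \<nu> j \<le> \<nu> i"
    and tri: "\<And>i j. i < n \<Longrightarrow> j < n \<Longrightarrow> i + 1 < j \<or> j + 1 < i \<Longrightarrow> udiag n h \<nu> i j = 0"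
    and i: "Suc i < n"
  shows "0 \<le> udiag n h \<nu> i (Suc i)"
proof (cases "udiag n h \<nu> i (Suc i) = 0")
  case nz: False
  define L where "L = udiag n h \<nu>"
  define s where "s l = (if L l (Suc l) = 0 then 1 else sgn (L l (Suc l)))" for l
  \<comment> \<open>A cumulative product: the ratio of \<open>D (Suc l)\<close> to
    \<open>D l\<close> cancels the phase \<open>s l\<close> of the entry at
    \<open>(l, Suc l)\<close>, for all \<open>l\<close> at once. Where that entry is zero,
    \<open>s l\<close> is 1.\<close>
  define D where "D l = (\<Prod>x<l. cnj (s x))" for l
  have s1: "cmod (s l) = 1" for l by (simp add: s_def norm_sgn)
  have "cmod (D l) = 1" for l by (simp add: D_def s1 flip: prod_norm)
  then have D1: "cnj (D l) * D l = 1" for l by (rule cmod_1_cnj)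
  have Ls: "L l (Suc l) * cnj (s l) = of_real (cmod (L l (Suc l)))" for l
  proof (cases "L l (Suc l) = 0")
    case False
    then have "L l (Suc l) = of_real (cmod (L l (Suc l))) * s l" by (simp add: s_def sgn_eq)
    then have "L l (Suc l) * cnj (s l) = of_real (cmod (L l (Suc l))) * (cnj (s l) * s l)"
      by (metis mult.assoc mult.commute)
    then show ?thesis using cmod_1_cnj[OF s1] by simp
  qed simp
  have herm: "L b a = cnj (L a b)" for a b unfolding L_def by (rule udiag_herm)
  define P where "P a b = (if a = b then Re (L a a) else if b = Suc a \<and> b < n then cmod (L a b)
    else if a = Suc b \<and> a < n then cmod (L b a) else 0)" for a b
  have up: "cnj (D a) * L a (Suc a) * D (Suc a) = of_real (cmod (L a (Suc a)))" for a
  proof -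
    have "cnj (D a) * L a (Suc a) * D (Suc a) = (cnj (D a) * D a) * (L a (Suc a) * cnj (s a))"
      by (simp add: D_def mult_ac)
    then show ?thesis unfolding D1 Ls by simp
  qed
  have PL: "cnj (D a) * L a b * D b = of_real (P a b)" if "a < n" "b < n" for a b
  proof -
    consider "a = b" | "b = Suc a" | "a = Suc b" | "a + 1 < b \<or> b + 1 < a" by linarith
    then show ?thesis
    proof cases
      case 1
      have "cnj (L a a) = L a a" using herm[of a a] by (rule sym)
      then have "L a a = of_real (Re (L a a))" by (simp add: complex_eq_iff)
      moreover have "cnj (D a) * L a a * D a = (cnj (D a) * D a) * L a a" by (simp add: mult_ac)
      ultimately show ?thesis using 1 D1 by (simp add: P_def)
    next
      case 2
      then show ?thesis using up[of a] that by (simp add: P_def)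
    next
      case 3
      have "cnj (D a) * L a b * D b = cnj (cnj (D b) * L b a * D a)"
        using herm[of b a] by (simp add: mult_ac)
      then show ?thesis using up[of b] 3 that by (simp add: P_def)
    next
      case 4
      then show ?thesis using tri[OF that 4] by (auto simp: P_def L_def)
    qed
  qed
  define g where "g = mat n n (\<lambda>(a, b). cnj (D a) * h $$ (a, b))"
  have gu: "g \<in> unitary_group n"
    unfolding unitary_iff
  proof (intro conjI allI impI)
    fix a b assume ab: "a < n" "b < n"
    have "(\<Sum>l<n. cnj (g $$ (l, a)) * g $$ (l, b)) = (\<Sum>l<n. (cnj (D l) * D l) * (cnj (h $$ (l, a)) * h $$ (l, b)))"
      by (intro sum.cong refl) (use ab in \<open>simp add: g_def mult_ac\<close>)
    then show "(\<Sum>l<n. cnj (g $$ (l, a)) * g $$ (l, b)) = (if a = b then 1 else 0)"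
      unfolding D1 using unitary_cols[OF h ab] by simp
  qed (simp add: g_def)
  have gspec: "udiag n g \<mu> a b = cnj (D a) * udiag n h \<mu> a b * D b" if "a < n" "b < n" for \<mu> a b
    unfolding udiag_def sum_distrib_left sum_distrib_right
    by (intro sum.cong refl) (use that in \<open>simp add: g_def mult_ac\<close>)
  have trP: "P a b = 0" if "a + 1 < b \<or> b + 1 < a" for a b using that by (auto simp: P_def)
  have offP: "0 \<le> P a (Suc a)" "0 \<le> P (Suc a) a" for a by (auto simp: P_def)
  have eqP: "of_real (P a b) = udiag n g \<nu> a b" if "a < n" "b < n" for a b
    using PL[OF that] gspec[OF that] by (simp add: L_def)
  have "\<exists>q. tnn_shift n P g \<nu> q" by (rule eventually_shift_minors[OF trP offP eqP gu])
  then obtain q where "tnn_shift n P g \<nu> q" ..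
  note q' = this[unfolded tnn_shift_def]
  note q = q'[THEN conjunct1] q'[THEN conjunct2, THEN conjunct1]
    q'[THEN conjunct2, THEN conjunct2, THEN conjunct1] q'[THEN conjunct2, THEN conjunct2, THEN conjunct2]
  have N: "fdet k (\<lambda>a b. udiag n g (\<lambda>l. 1 + q * \<nu> l) (pick I a) (pick J b)) =
      of_real (fdet k (\<lambda>a b. (if pick I a = pick J b then 1 else 0) + q * P (pick I a) (pick J b)))"
    if "I \<in> ksub n k" "J \<in> ksub n k" for k I J
    unfolding fdet_of_real by (rule fdet_cong) (use q(3) pick_less that in simp)
  obtain k J p p' where k: "k \<le> n" and J: "J \<in> ksub n k" and VJ: "fdet k (\<lambda>a b. h $$ (pick J a, b)) \<noteq> 0"
    and p: "p \<in> J" "p' \<notin> J" "p = i \<and> p' = Suc i \<or> p = Suc i \<and> p' = i"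
    using separating_minor[OF h i] by (elim exE conjE)
  obtain a0 where a0: "a0 < k" "pick J a0 = p" using p(1) pick_image_ksub[OF J] by (metis imageE lessThan_iff)
  \<comment> \<open>Exchanging \<open>p\<close> for its neighbour \<open>p'\<close>, which is not in
    \<open>J\<close>, passes no other element of \<open>J\<close>; the enumeration stays
    increasing.\<close>
  define r where "r a = (if pick J a = p then p' else pick J a)" for a
  have r: "incr k n r"
  proof -
    have "r a < r b" if ab: "a < b" "b < k" for a b
    proof -
      have "pick J a < pick J b" using incr_mono[OF incr_pick[OF J] ab] .
      moreover have "pick J a \<noteq> p'" "pick J b \<noteq> p'" using pick_in_ksub[OF J] ab p(2) by force+
      ultimately show ?thesis using p(3) by (auto simp: r_def)
    qed
    moreover have "r a < n" if "a < k" for a using pick_less[OF J that] p(3) i by (auto simp: r_def)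
    ultimately show ?thesis by (auto simp: incr_def strict_mono_on_def)
  qed
  define I where "I = r ` {..<k}"
  have I: "I \<in> ksub n k" unfolding I_def by (rule incr_image[OF r])
  have rI: "pick I a = r a" if "a < k" for a unfolding I_def using incr_eq_pick[OF r that] by simp
  have "0 < P p' p" using p(3) nz i by (auto simp: P_def L_def)
  then have "\<forall>a<k. pick I a = pick J a \<or> 0 < P (pick I a) (pick J a)"
    by (auto simp: rI r_def)
  then have NIJ: "0 < fdet k (\<lambda>a b. udiag n g (\<lambda>l. 1 + q * \<nu> l) (pick I a) (pick J b))"
    using q(4) k I J unfolding N[OF I J] by simp
  have Nnn: "0 \<le> fdet k (\<lambda>a b. udiag n g (\<lambda>l. 1 + q * \<nu> l) (pick I' a) (pick J' b))"
    if "I' \<in> ksub n k" "J' \<in> ksub n k" for I' J'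
    using q(4) k that unfolding N[OF that] by simp
  define V where "V I = fdet k (\<lambda>a b. h $$ (pick I a, b))" for I
  \<comment> \<open>The minors \<open>V\<close> of \<open>h\<close> are nonnegative by hypothesis,
    so the phase of a nonzero left minor of \<open>g\<close> is exactly the product \<open>E\<close>
    of the row phases. Aligned phases for \<open>I\<close> and \<open>J\<close> thus force
    \<open>E I = E J\<close>, where all factors cancel except those of \<open>p\<close> and
    \<open>p'\<close>.\<close>
  define E where "E I = (\<Prod>a<k. cnj (D (pick I a)))" for I
  have gV: "fdet k (\<lambda>a b. g $$ (pick I' a, b)) = E I' * V I'" if "I' \<in> ksub n k" for I'
  proof -
    have "fdet k (\<lambda>a b. g $$ (pick I' a, b)) = fdet k (\<lambda>a b. cnj (D (pick I' a)) * h $$ (pick I' a, b))"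
      by (rule fdet_cong) (use pick_less that k in \<open>simp add: g_def\<close>)
    then show ?thesis unfolding fdet_scale_rows E_def V_def .
  qed
  have E1: "cmod (E I') = 1" for I'
    using \<open>\<And>l. cmod (D l) = 1\<close> by (simp add: E_def flip: prod_norm)
  have VJ': "V J \<noteq> 0" using VJ by (simp add: V_def)
  have "E J * V J \<noteq> 0" using VJ' E1[of J] by auto
  then have nzJ: "fdet k (\<lambda>a b. g $$ (pick J a, b)) \<noteq> 0" unfolding gV[OF J] .
  have ph: "E I * V I \<noteq> 0 \<and> cnj (E I * V I) * (E J * V J) = of_real (cmod (E I * V I) * cmod (E J * V J))"
    unfolding gV[OF I, symmetric] gV[OF J, symmetric]
  proof (rule left_minor_phases[OF gu k _ _ Nnn I J NIJ nzJ])
    show "1 + q * \<nu> b \<le> 1 + q * \<nu> a" if "a < b" "b < n" for a b using decr[OF that] q(1) by simp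
    show "0 \<le> 1 + q * \<nu> a" if "a < n" for a using q(2) that by simp
  qed
  have Vr: "of_real (cmod (V I')) = V I'" if "I' \<in> ksub n k" for I'
    using ln k that unfolding left_nonneg_def V_def by (intro complex_nonneg_cmod) simp
  have "cnj (V I) = V I" by (subst (1 2) Vr[OF I, symmetric]) simp
  then have "(cnj (E I) * E J) * (V I * V J) = V I * V J"
    using ph VJ' by (auto simp: norm_mult E1 Vr I J mult_ac)
  then have eqV: "(cnj (E I) * E J) * (V I * V J) = 1 * (V I * V J)" by (simp only: mult_1)
  have nzV: "V I * V J \<noteq> 0" using ph VJ' by simp
  have EE: "cnj (E I) * E J = 1" using eqV unfolding mult_right_cancel[OF nzV] .
  have "cnj (E I) * E J = (\<Prod>a<k. D (pick I a) * cnj (D (pick J a)))"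
    by (simp add: E_def prod.distrib)
  also have "\<dots> = (\<Prod>a\<in>{a0}. D (pick I a) * cnj (D (pick J a)))"
  proof (rule prod.mono_neutral_right)
    show "\<forall>a\<in>{..<k} - {a0}. D (pick I a) * cnj (D (pick J a)) = 1"
    proof
      fix a assume a: "a \<in> {..<k} - {a0}"
      then have "pick J a \<noteq> p" using incr_inj[OF incr_pick[OF J]] a0 by (auto simp: inj_on_def)
      then have "pick I a = pick J a" using a by (simp add: rI r_def)
      then show "D (pick I a) * cnj (D (pick J a)) = 1" using D1 by (simp add: mult.commute)
    qed
  qed (use a0 in auto)
  also have "\<dots> = D p' * cnj (D p)" using a0 by (simp add: rI r_def)
  finally have DD: "D p' * cnj (D p) = 1" using EE by simp
  have "D p' = D p' * (cnj (D p) * D p)" unfolding D1 by simp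
  also have "\<dots> = D p" using DD by (simp add: mult.assoc[symmetric])
  finally have "D i = D (Suc i)" using p(3) by auto
  then have "cnj (D i) * L i (Suc i) * D (Suc i) = (cnj (D i) * D i) * L i (Suc i)" by (simp add: mult_ac)
  then have "L i (Suc i) = of_real (cmod (L i (Suc i)))" using up[of i] D1 by simp
  then show ?thesis unfolding L_def by (metis complex_of_real_nonneg norm_ge_zero)
qed simp

lemma fdet_inverse:
  fixes X :: "nat \<Rightarrow> nat \<Rightarrow> complex"
  assumes "fdet k X \<noteq> 0"
  shows "\<exists>Y. (\<forall>a<k. \<forall>b<k. (\<Sum>j<k. X a j * Y j b) = (if a = b then 1 else 0)) \<and>
    (\<forall>a<k. \<forall>b<k. (\<Sum>j<k. Y a j * X j b) = (if a = b then 1 else 0))"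
proof -
  let ?X = "mat k k (\<lambda>(a, b). X a b)"
  have X: "?X \<in> carrier_mat k k" by simp
  note adj = adj_mat[OF X]
  define Y where "Y a b = adj_mat ?X $$ (a, b) / fdet k X" for a b
  have 1: "(\<Sum>j<k. X a j * adj_mat ?X $$ (j, b)) = (if a = b then fdet k X else 0)" if "a < k" "b < k" for a b
    using arg_cong[OF adj(2), of "\<lambda>m. m $$ (a, b)"] that
    by (simp add: index_mult_sum[OF X adj(1)] fdet_def del: index_mult_mat(1))
  have 2: "(\<Sum>j<k. adj_mat ?X $$ (a, j) * X j b) = (if a = b then fdet k X else 0)" if "a < k" "b < k" for a b
    using arg_cong[OF adj(3), of "\<lambda>m. m $$ (a, b)"] that
    by (simp add: index_mult_sum[OF adj(1) X] fdet_def del: index_mult_mat(1))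
  show ?thesis
    using 1 2 assms by (intro exI[of _ Y]) (simp add: Y_def sum_divide_distrib[symmetric])
qed

text \<open>If the corner vanished, the rest of the last column would be orthogonal to the rows
  \<open>1..m\<close> of the first \<open>m\<close> columns. The determinant of that block is a
  left-justified minor, hence nonzero, so the whole last column would be zero.\<close>

lemma left_pos_unitary_corner_nonzero:
  assumes g: "g \<in> unitary_group n" and l: "left_pos n (\<lambda>i j. g $$ (i, j))" and n: "n = Suc m"
  shows "g $$ (0, m) \<noteq> 0"
proof
  assume z: "g $$ (0, m) = 0"
  define Z where "Z a j = g $$ (Suc a, j)" for a j
  have "incr m n Suc" using n by (auto simp: incr_def strict_mono_on_def)
  then have "fdet m Z \<noteq> 0" using left_posD[OF l] n unfolding Z_def by fastforce
  then obtain Y where Y: "\<forall>a<m. \<forall>b<m. (\<Sum>j<m. Z a j * Y j b) = (if a = b then 1 else 0)"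
    using fdet_inverse by blast
  have orth: "(\<Sum>a<m. cnj (g $$ (Suc a, m)) * Z a j) = 0" if "j < m" for j
  proof -
    have "(\<Sum>a<Suc m. cnj (g $$ (a, m)) * g $$ (a, j)) = 0"
      using unitary_cols[OF g, of m j] that n by simp
    then show ?thesis unfolding sum.lessThan_Suc_shift using z by (simp add: Z_def)
  qed
  have "cnj (g $$ (Suc b, m)) = 0" if b: "b < m" for b
  proof -
    have "cnj (g $$ (Suc b, m)) = (\<Sum>a<m. if a = b then cnj (g $$ (Suc a, m)) else 0)" using b by simp
    also have "\<dots> = (\<Sum>a<m. cnj (g $$ (Suc a, m)) * (\<Sum>j<m. Z a j * Y j b))"
      by (intro sum.cong refl) (use Y b in simp)
    also have "\<dots> = (\<Sum>j<m. (\<Sum>a<m. cnj (g $$ (Suc a, m)) * Z a j) * Y j b)"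
      unfolding sum_distrib_left sum_distrib_right by (subst sum.swap) (simp add: mult.assoc)
    also have "\<dots> = 0" using orth by simp
    finally show ?thesis .
  qed
  then have "(\<Sum>a<Suc m. cnj (g $$ (a, m)) * g $$ (a, m)) = 0"
    unfolding sum.lessThan_Suc_shift using z by simp
  then show False using unitary_cols[OF g, of m m] n by simp
qed

lemma udiag_eigenvector:
  assumes g: "g \<in> unitary_group n" and j: "j < n"
  shows "(\<Sum>c<n. udiag n g \<nu> a c * g $$ (c, j)) = g $$ (a, j) * of_real (\<nu> j)"
proof -
  have "(\<Sum>c<n. udiag n g \<nu> a c * g $$ (c, j)) =
      (\<Sum>c<n. \<Sum>l<n. g $$ (a, l) * of_real (\<nu> l) * (cnj (g $$ (c, l)) * g $$ (c, j)))"
    by (simp add: udiag_def sum_distrib_right mult.assoc)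
  also have "\<dots> = (\<Sum>l<n. g $$ (a, l) * of_real (\<nu> l) * (\<Sum>c<n. cnj (g $$ (c, l)) * g $$ (c, j)))"
    by (subst sum.swap) (simp add: sum_distrib_left)
  also have "\<dots> = (\<Sum>l<n. if l = j then g $$ (a, l) * of_real (\<nu> l) else 0)"
    using unitary_cols[OF g] j by (intro sum.cong) auto
  finally show ?thesis using j by simp
qed

text \<open>If an off-diagonal entry vanished, the leading block would have trace \<open>\<nu> 0 + \<dots> + \<nu> p\<close>,
  contradicting strictness in the Ky Fan inequality.\<close>

lemma tridiagonal_nonzero:
  assumes g: "g \<in> U_pos n" and decr: "\<And>i j. i < j \<Longrightarrow> j < n \<Longrightarrow> \<nu> j \<le> \<nu> i"
    and nc: "\<nu> (n - 1) < \<nu> 0"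
    and tri: "\<And>i j. i < n \<Longrightarrow> j < n \<Longrightarrow> i + 1 < j \<or> j + 1 < i \<Longrightarrow> udiag n g \<nu> i j = 0"
    and p: "Suc p < n"
  shows "udiag n g \<nu> p (Suc p) \<noteq> 0"
proof
  assume z: "udiag n g \<nu> p (Suc p) = 0"
  note gu = U_pos_imp[OF g]
  have block: "udiag n g \<nu> a l = 0" if "a < Suc p" "Suc p \<le> l" "l < n" for a l
  proof (cases "a = p \<and> l = Suc p")
    case False
    then have "a + 1 < l" using that by linarith
    then show ?thesis using tri[of a l] that p by simp
  qed (use z in simp)

  \<comment> \<open>As the block right of the leading one vanishes, truncating the first
    \<open>Suc p\<close> columns of \<open>g\<close> gives eigenvectors of the leading block. They
    form a basis by positivity of the leading left minor, so the block is similar to the diagonal of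
    \<open>\<nu> 0, ..., \<nu> p\<close>, which fixes its trace.\<close>
  have LX: "(\<Sum>c<Suc p. udiag n g \<nu> a c * g $$ (c, j)) = g $$ (a, j) * of_real (\<nu> j)"
    if "a < Suc p" "j < Suc p" for a j
  proof -
    have "(\<Sum>c<Suc p. udiag n g \<nu> a c * g $$ (c, j)) = (\<Sum>c<n. udiag n g \<nu> a c * g $$ (c, j))"
      by (rule sum.mono_neutral_left) (use block[OF that(1)] p in auto)
    then show ?thesis using udiag_eigenvector[OF gu(1)] that p by simp
  qed
  have "fdet (Suc p) (\<lambda>a j. g $$ (a, j)) \<noteq> 0"
    using left_posD[OF gu(2) incr_id, of "Suc p"] p by auto
  then obtain Y where Y: "\<forall>a<Suc p. \<forall>b<Suc p. (\<Sum>j<Suc p. g $$ (a, j) * Y j b) = (if a = b then 1 else 0)"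
    "\<forall>a<Suc p. \<forall>b<Suc p. (\<Sum>j<Suc p. Y a j * g $$ (j, b)) = (if a = b then 1 else 0)"
    using fdet_inverse by blast
  have diag: "udiag n g \<nu> a a = (\<Sum>j<Suc p. g $$ (a, j) * of_real (\<nu> j) * Y j a)" if a: "a < Suc p" for a
  proof -
    have "udiag n g \<nu> a a = (\<Sum>c<Suc p. if c = a then udiag n g \<nu> a c else 0)"
      using a by (simp del: sum.lessThan_Suc)
    also have "\<dots> = (\<Sum>c<Suc p. udiag n g \<nu> a c * (\<Sum>j<Suc p. g $$ (c, j) * Y j a))"
      by (intro sum.cong refl) (use Y(1) a in \<open>simp del: sum.lessThan_Suc\<close>)
    also have "\<dots> = (\<Sum>j<Suc p. (\<Sum>c<Suc p. udiag n g \<nu> a c * g $$ (c, j)) * Y j a)"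
      unfolding sum_distrib_left sum_distrib_right by (subst sum.swap) (simp only: mult.assoc)
    also have "\<dots> = (\<Sum>j<Suc p. g $$ (a, j) * of_real (\<nu> j) * Y j a)"
      by (intro sum.cong refl) (use LX a in \<open>simp del: sum.lessThan_Suc\<close>)
    finally show ?thesis .
  qed
  have "(\<Sum>a<Suc p. udiag n g \<nu> a a) = (\<Sum>a<Suc p. \<Sum>j<Suc p. g $$ (a, j) * of_real (\<nu> j) * Y j a)"
    by (intro sum.cong refl diag) simp
  also have "\<dots> = (\<Sum>j<Suc p. of_real (\<nu> j) * (\<Sum>a<Suc p. Y j a * g $$ (a, j)))"
    unfolding sum_distrib_left by (subst sum.swap) (simp only: mult_ac)
  also have "\<dots> = (\<Sum>j<Suc p. of_real (\<nu> j))"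
    by (intro sum.cong refl) (use Y(2) in \<open>simp del: sum.lessThan_Suc\<close>)
  finally have "Re (\<Sum>a<Suc p. udiag n g \<nu> a a) = Re (\<Sum>j<Suc p. complex_of_real (\<nu> j))" by simp
  then have tr: "(\<Sum>a<Suc p. Re (udiag n g \<nu> a a)) = (\<Sum>j<Suc p. \<nu> j)"
    by (simp only: Re_sum Re_complex_of_real)
  have pn: "p < n" using p by simp
  define t where "t j = (\<Sum>a<Suc p. (cmod (g $$ (a, j)))\<^sup>2)" for j
  have t: "0 \<le> t j \<and> t j \<le> 1" if "j < n" for j using Ky_Fan(2)[OF gu(1) pn that] unfolding t_def .
  have le: "\<nu> p \<le> \<nu> j" if "j < Suc p" for j using decr[of j p] that p by (cases "j = p") auto
  have le': "\<nu> j \<le> \<nu> p" if "j \<in> {Suc p..<n}" for j using decr[of p j] that by auto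
  have n1: "0 \<le> (\<nu> j - \<nu> p) * (1 - t j)" if "j < Suc p" for j
    using le[OF that] t[of j] that p by (intro mult_nonneg_nonneg) auto
  have n2: "0 \<le> (\<nu> p - \<nu> j) * t j" if "j \<in> {Suc p..<n}" for j
    using le'[OF that] t[of j] that p by (intro mult_nonneg_nonneg) auto
  have zero: "(\<Sum>j<Suc p. (\<nu> j - \<nu> p) * (1 - t j)) + (\<Sum>j\<in>{Suc p..<n}. (\<nu> p - \<nu> j) * t j) = 0"
    using Ky_Fan(1)[OF gu(1) pn, where \<nu>=\<nu>] unfolding tr t_def by linarith
  have s1: "(\<nu> 0 - \<nu> p) * (1 - t 0) \<le> (\<Sum>j<Suc p. (\<nu> j - \<nu> p) * (1 - t j))"
    using n1 by (intro member_le_sum) auto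
  have s2: "(\<nu> p - \<nu> (n - 1)) * t (n - 1) \<le> (\<Sum>j\<in>{Suc p..<n}. (\<nu> p - \<nu> j) * t j)"
    using n2 p by (intro member_le_sum) auto
  have e0: "(\<nu> 0 - \<nu> p) * (1 - t 0) = 0" and e1: "(\<nu> p - \<nu> (n - 1)) * t (n - 1) = 0"
  proof -
    have a1: "0 \<le> (\<nu> 0 - \<nu> p) * (1 - t 0)" by (rule n1) simp
    have a2: "0 \<le> (\<nu> p - \<nu> (n - 1)) * t (n - 1)" by (rule n2) (use p in auto)
    show "(\<nu> 0 - \<nu> p) * (1 - t 0) = 0" "(\<nu> p - \<nu> (n - 1)) * t (n - 1) = 0"
      using zero s1 s2 a1 a2 by linarith+
  qed
  \<comment> \<open>The entry of column 0 in row \<open>Suc p\<close> is positive and is not counted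
    in \<open>t 0\<close>.\<close>
  have "t 0 < 1"
  proof -
    have "incr 1 n (\<lambda>_. Suc p)" using p by (auto simp: incr_def strict_mono_on_def)
    then have "0 < fdet (Suc 0) (\<lambda>a b. g $$ (Suc p, b))" using left_posD[OF gu(2), of "Suc 0"] p by simp
    then have "g $$ (Suc p, 0) \<noteq> 0" by (auto simp: fdet_1)
    then have "0 < (cmod (g $$ (Suc p, 0)))\<^sup>2" by simp
    moreover have "(\<Sum>a<Suc (Suc p). (cmod (g $$ (a, 0)))\<^sup>2) \<le> 1"
      using Ky_Fan(2)[OF gu(1) p, of 0] p by simp
    ultimately show ?thesis unfolding t_def sum.lessThan_Suc[of _ "Suc p"] by linarith
  qed
  then have eq1: "\<nu> 0 = \<nu> p" using e0 by simp
  \<comment> \<open>The corner entry is counted in \<open>t (n - 1)\<close>. Both vanishing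
    remainder terms together then make the first and the last eigenvalue equal.\<close>
  have "0 < t (n - 1)"
  proof -
    have "g $$ (0, n - 1) \<noteq> 0"
      by (rule left_pos_unitary_corner_nonzero[OF gu]) (use p in simp)
    then show ?thesis unfolding t_def by (intro sum_pos2[of _ 0]) auto
  qed
  then have "\<nu> p = \<nu> (n - 1)" using e1 by simp
  then show False using eq1 nc by simp
qed

lemma udiag_cong: "(\<And>l. l < n \<Longrightarrow> \<mu> l = \<nu> l) \<Longrightarrow> udiag n g \<mu> i j = udiag n g \<nu> i j"
  unfolding udiag_def by (intro sum.cong) auto

section \<open>Nonnegative tridiagonal matrices as limits\<close>

text \<open>An eigenvalue is a diagonal entry after conjugation by \<open>g\<close>, whose entries
  have modulus at most 1. The bound depends on the matrix alone, which gives compactness of the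
  spectra of a convergent family.\<close>

lemma udiag_eigenvalue_bound:
  assumes g: "g \<in> unitary_group n" and l: "l < n"
  shows "\<bar>\<mu> l\<bar> \<le> (\<Sum>a<n. \<Sum>b<n. cmod (udiag n g \<mu> a b))"
proof -
  note c = unitary_carrier[OF g]
  have one: "mat_adjoint g * g = 1\<^sub>m n" using g by (simp add: unitary_group_def)
  have "of_real (\<mu> l) = (\<Sum>a<n. \<Sum>b<n. cnj (g $$ (a, l)) * udiag n g \<mu> a b * g $$ (b, l))"
    unfolding udiag_conj[OF c c l l] one using l by (simp add: udiag_one)
  then have "\<bar>\<mu> l\<bar> = cmod (\<Sum>a<n. \<Sum>b<n. cnj (g $$ (a, l)) * udiag n g \<mu> a b * g $$ (b, l))"
    by (metis norm_of_real)
  also have "\<dots> \<le> (\<Sum>a<n. cmod (\<Sum>b<n. cnj (g $$ (a, l)) * udiag n g \<mu> a b * g $$ (b, l)))"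
    by (rule norm_sum)
  also have "\<dots> \<le> (\<Sum>a<n. \<Sum>b<n. cmod (cnj (g $$ (a, l)) * udiag n g \<mu> a b * g $$ (b, l)))"
    by (intro sum_mono norm_sum)
  also have "\<dots> \<le> (\<Sum>a<n. \<Sum>b<n. cmod (udiag n g \<mu> a b))"
  proof (intro sum_mono)
    fix a b assume "a \<in> {..<n}" "b \<in> {..<n}"
    then have "cmod (g $$ (a, l)) \<le> 1" "cmod (g $$ (b, l)) \<le> 1" using unitary_entry_le[OF g] l by auto
    then have "cmod (g $$ (a, l)) * cmod (udiag n g \<mu> a b) \<le> 1 * cmod (udiag n g \<mu> a b)"
      by (intro mult_right_mono) auto
    moreover have "cmod (g $$ (a, l)) * cmod (udiag n g \<mu> a b) * cmod (g $$ (b, l)) \<le> cmod (g $$ (a, l)) * cmod (udiag n g \<mu> a b) * 1"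
      using \<open>cmod (g $$ (b, l)) \<le> 1\<close> by (intro mult_left_mono) auto
    ultimately show "cmod (cnj (g $$ (a, l)) * udiag n g \<mu> a b * g $$ (b, l)) \<le> cmod (udiag n g \<mu> a b)"
      by (simp add: norm_mult)
  qed
  finally show ?thesis .
qed

text \<open>Make the off-diagonal entries positive, diagonalise, and pass to a limit of the
  diagonalising matrices; the spectrum of the limit is determined by the matrix.\<close>

lemma tridiagonal_nonneg_imp_orbit_nonneg:
  assumes L: "L \<in> carrier_mat n n" and g: "g \<in> unitary_group n"
    and Lg: "\<And>i j. i < n \<Longrightarrow> j < n \<Longrightarrow> L $$ (i, j) = udiag n g (\<lambda>l. lam $ l) i j"
    and decr: "\<And>i j. i < j \<Longrightarrow> j < n \<Longrightarrow> lam $ j \<le> lam $ i"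
    and tri: "\<And>i j. i < n \<Longrightarrow> j < n \<Longrightarrow> i + 1 < j \<or> j + 1 < i \<Longrightarrow> L $$ (i, j) = 0"
    and real: "\<And>i j. i < n \<Longrightarrow> j < n \<Longrightarrow> L $$ (i, j) \<in> \<real>"
    and off: "\<And>i. Suc i < n \<Longrightarrow> 0 \<le> Re (L $$ (i, Suc i)) \<and> 0 \<le> Re (L $$ (Suc i, i))"
  shows "\<i> \<cdot>\<^sub>m L \<in> orbit_nonneg n lam"
proof -
  \<comment> \<open>The perturbation \<open>1 / (m + 1)\<close> sits on both neighbouring diagonals,
    so the matrix stays symmetric.\<close>
  define P where "P m i j = (if i < n \<and> j < n then Re (L $$ (i, j)) +
    (if j = Suc i \<or> i = Suc j then inverse (real (Suc m)) else 0) else 0)" for m i j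
  have Pt: "P m i j = 0" if "i + 1 < j \<or> j + 1 < i" for m i j using tri[of i j] that by (auto simp: P_def)
  have Po: "0 < P m i (Suc i) \<and> 0 < P m (Suc i) i" if "Suc i < n" for m i
    using off[OF that] that by (auto simp: P_def intro: add_nonneg_pos)
  have Pn: "0 \<le> P m i (Suc i)" "0 \<le> P m (Suc i) i" for m i
    using Po[of i m] by (cases "Suc i < n"; auto simp: P_def)+
  have Lr: "L $$ (i, j) = of_real (Re (L $$ (i, j)))" if "i < n" "j < n" for i j
    using real[OF that] by (simp add: complex_is_Real_iff complex_eq_iff)
  have sym: "Re (L $$ (j, i)) = Re (L $$ (i, j))" if "i < n" "j < n" for i j
    unfolding Lg[OF that] Lg[OF that(2,1)] by (subst udiag_herm) simp
  have Ps: "P m j i = P m i j" for m i j using sym by (auto simp: P_def)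
  have ex: "\<exists>g'\<in>U_pos n. \<exists>\<mu>. (\<forall>i j. i < j \<longrightarrow> j < n \<longrightarrow> \<mu> j \<le> \<mu> i) \<and>
      (\<forall>i<n. \<forall>j<n. udiag n g' \<mu> i j = of_real (P m i j))" for m
  proof -
    define A where "A = mat n n (\<lambda>(i, j). complex_of_real (P m i j))"
    have "\<exists>g\<in>unitary_group n. \<exists>\<mu>. (\<forall>i j. i < j \<longrightarrow> j < n \<longrightarrow> \<mu> j \<le> \<mu> i) \<and>
      (\<forall>i<n. \<forall>j<n. A $$ (i, j) = udiag n g \<mu> i j)"
    proof (rule spectral_theorem)
      show "A $$ (j, i) = cnj (A $$ (i, j))" if "i < n" "j < n" for i j
        using that Ps[of m j i] by (simp add: A_def)
    qed (simp add: A_def)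
    then obtain h \<mu> where h: "h \<in> unitary_group n" "\<forall>i j. i < j \<longrightarrow> j < n \<longrightarrow> \<mu> j \<le> \<mu> i"
      "\<forall>i<n. \<forall>j<n. A $$ (i, j) = udiag n h \<mu> i j" by blast
    have eq: "of_real (P m i j) = udiag n h \<mu> i j" if "i < n" "j < n" for i j
      using h(3) that by (simp add: A_def)
    have "\<exists>g'\<in>U_pos n. \<forall>\<nu>. \<forall>i<n. \<forall>j<n. udiag n g' \<nu> i j = udiag n h \<nu> i j"
      by (rule Jacobi_U_pos[OF Pt Pn Po eq h(1) h(2)[rule_format]])
    then obtain g' where g': "g' \<in> U_pos n" "\<forall>\<nu>. \<forall>i<n. \<forall>j<n. udiag n g' \<nu> i j = udiag n h \<nu> i j" by blast
    then have "\<forall>i<n. \<forall>j<n. udiag n g' \<mu> i j = of_real (P m i j)" using eq by simp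
    then show ?thesis using g'(1) h(2) by blast
  qed
  obtain g' where g': "\<And>m. g' m \<in> U_pos n" and "\<forall>m. \<exists>\<mu>. (\<forall>i j. i < j \<longrightarrow> j < n \<longrightarrow> \<mu> j \<le> \<mu> i) \<and>
      (\<forall>i<n. \<forall>j<n. udiag n (g' m) \<mu> i j = of_real (P m i j))"
    using ex by metis
  then obtain \<mu> where \<mu>: "\<And>m i j. i < j \<Longrightarrow> j < n \<Longrightarrow> \<mu> m j \<le> \<mu> m i"
    and sp: "\<And>m i j. i < n \<Longrightarrow> j < n \<Longrightarrow> udiag n (g' m) (\<mu> m) i j = of_real (P m i j)"
    by metis
  \<comment> \<open>The perturbation is at most 1 per entry, so one bound serves the eigenvalues of
    all \<open>P m\<close>.\<close>
  define B where "B = (\<Sum>a<n. \<Sum>b<n. \<bar>Re (L $$ (a, b))\<bar> + 1)"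
  have bound: "\<bar>\<mu> m l\<bar> \<le> B" if "l < n" for m l
  proof -
    have "\<bar>\<mu> m l\<bar> \<le> (\<Sum>a<n. \<Sum>b<n. cmod (udiag n (g' m) (\<mu> m) a b))"
      by (rule udiag_eigenvalue_bound[OF U_pos_imp(1)[OF g'] that])
    also have "\<dots> \<le> B"
      unfolding B_def
    proof (intro sum_mono)
      fix a b assume "a \<in> {..<n}" "b \<in> {..<n}"
      then have "cmod (udiag n (g' m) (\<mu> m) a b) = \<bar>P m a b\<bar>" by (simp add: sp)
      also have "\<dots> \<le> \<bar>Re (L $$ (a, b))\<bar> + 1"
      proof -
        have i: "0 \<le> inverse (real (Suc m))" "inverse (real (Suc m)) \<le> 1" by (simp_all add: inverse_le_1_iff)
        have "\<bar>u + inverse (real (Suc m))\<bar> \<le> \<bar>u\<bar> + 1" for u using i by linarith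
        then show ?thesis by (auto simp: P_def simp del: of_nat_Suc)
      qed
      finally show "cmod (udiag n (g' m) (\<mu> m) a b) \<le> \<bar>Re (L $$ (a, b))\<bar> + 1" .
    qed
    finally show ?thesis .
  qed
  obtain r h where r: "strict_mono r" and h: "h \<in> unitary_group n"
    and hl: "\<forall>i<n. \<forall>j<n. (\<lambda>m. g' (r m) $$ (i, j)) \<longlonglongrightarrow> h $$ (i, j)"
    using U_pos_subseq[of g' n, OF g'] by blast
  obtain s \<nu> where s: "strict_mono s" and \<nu>: "\<forall>l\<in>{..<n}. (\<lambda>m. \<mu> (r (s m)) l) \<longlonglongrightarrow> \<nu> l"
    using finite_bounded_subseq[of "{..<n}" "\<lambda>m. \<mu> (r m)" B] bound by auto
  have hl': "(\<lambda>m. g' (r (s m)) $$ (i, j)) \<longlonglongrightarrow> h $$ (i, j)" if "i < n" "j < n" for i j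
    using LIMSEQ_subseq_LIMSEQ[OF hl[rule_format, OF that] s] by (simp add: o_def)
  have Lh: "L $$ (i, j) = udiag n h \<nu> i j" if ij: "i < n" "j < n" for i j
  proof -
    have "(\<lambda>m. udiag n (g' (r (s m))) (\<mu> (r (s m))) i j) \<longlonglongrightarrow> udiag n h \<nu> i j"
      by (rule tendsto_udiag[OF hl' _ ij]) (use \<nu> in auto)
    moreover have inv: "(\<lambda>m. inverse (real (Suc (r (s m))))) \<longlonglongrightarrow> 0"
      using LIMSEQ_subseq_LIMSEQ[OF LIMSEQ_inverse_real_of_nat strict_mono_o[OF r s]] by (simp add: o_def)
    have "(\<lambda>m. P (r (s m)) i j) \<longlonglongrightarrow> Re (L $$ (i, j))"
    proof (cases "j = Suc i \<or> i = Suc j")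
      case True
      then have "P (r (s m)) i j = Re (L $$ (i, j)) + inverse (real (Suc (r (s m))))" for m
        using ij by (simp add: P_def del: of_nat_Suc)
      then show ?thesis using tendsto_add[OF tendsto_const inv, of "Re (L $$ (i, j))"] by simp
    next
      case False
      then show ?thesis using ij by (simp add: P_def)
    qed
    then have "(\<lambda>m. complex_of_real (P (r (s m)) i j)) \<longlonglongrightarrow> of_real (Re (L $$ (i, j)))"
      by (rule tendsto_of_real)
    ultimately show ?thesis unfolding sp[OF ij] using LIMSEQ_unique Lr[OF ij] by metis
  qed
  have \<nu>decr: "\<nu> j \<le> \<nu> i" if "i < j" "j < n" for i j
    using \<nu> \<mu>[OF that] that by (intro LIMSEQ_le[of "\<lambda>m. \<mu> (r (s m)) j" _ "\<lambda>m. \<mu> (r (s m)) i"]) auto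
  have gh: "udiag n g (\<lambda>l. lam $ l) i j = udiag n h \<nu> i j" if "i < n" "j < n" for i j
    using Lg[OF that] Lh[OF that] by simp
  have "lam $ l = \<nu> l" if "l < n" for l
    by (rule spectrum_unique[OF g h gh decr \<nu>decr that])
  then have "L $$ (i, j) = udiag n h (\<lambda>l. lam $ l) i j" if "i < n" "j < n" for i j
    using Lh[OF that] udiag_cong[of n "\<lambda>l. lam $ l" \<nu>] by simp
  then show ?thesis
    by (intro orbit_nonnegI[OF L, of "\<lambda>m. g' (r (s m))" h] g' hl')
qed

lemma tridiagonal_orbit_iff:
  assumes L: "L \<in> carrier_mat n n" and orb: "\<i> \<cdot>\<^sub>m L \<in> orbit n lam"
    and decr: "\<And>i j. i < j \<Longrightarrow> j < n \<Longrightarrow> lam $ j \<le> lam $ i"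
    and nc: "i0 < n" "j0 < n" "lam $ i0 \<noteq> lam $ j0"
    and tr: "tridiagonal L"
  shows "\<i> \<cdot>\<^sub>m L \<in> orbit_pos n lam \<longleftrightarrow>
          (\<forall>i<n. \<forall>j<n. L $$ (i, j) \<in> \<real>) \<and>
          (\<forall>i. i + 1 < n \<longrightarrow> 0 < Re (L $$ (i, i + 1)) \<and> 0 < Re (L $$ (i + 1, i)))" (is "?A \<longleftrightarrow> ?B")
    and "\<i> \<cdot>\<^sub>m L \<in> orbit_nonneg n lam \<longleftrightarrow>
          (\<forall>i<n. \<forall>j<n. L $$ (i, j) \<in> \<real>) \<and>
          (\<forall>i. i + 1 < n \<longrightarrow> 0 \<le> Re (L $$ (i, i + 1)) \<and> 0 \<le> Re (L $$ (i + 1, i)))" (is "?C \<longleftrightarrow> ?D")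
proof -
  have tri: "L $$ (i, j) = 0" if "i < n" "j < n" "i + 1 < j \<or> j + 1 < i" for i j
    using tr L that by (auto simp: tridiagonal_def)
  obtain g where g: "g \<in> unitary_group n" and Lg: "\<forall>i<n. \<forall>j<n. L $$ (i, j) = udiag n g (\<lambda>l. lam $ l) i j"
    using orb unfolding orbit_iff[OF L] by blast
  have le: "lam $ j \<le> lam $ i" if "i \<le> j" "j < n" for i j using decr[of i j] that by (cases "i = j") auto
  have lt: "lam $ (n - 1) < lam $ 0"
    using le[of 0 i0] le[of 0 j0] le[of i0 "n - 1"] le[of j0 "n - 1"] nc by force
  have herm: "L $$ (j, i) = cnj (L $$ (i, j))" if "i < n" "j < n" for i j
    unfolding Lg[rule_format, OF that] Lg[rule_format, OF that(2,1)] by (rule udiag_herm)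
  have real: "\<forall>i<n. \<forall>j<n. L $$ (i, j) \<in> \<real>"
    if nn: "\<And>i. Suc i < n \<Longrightarrow> 0 \<le> L $$ (i, Suc i)"
  proof (intro allI impI)
    fix i j assume ij: "i < n" "j < n"
    have im: "L $$ (i, Suc i) \<in> \<real>" if "Suc i < n" for i
      using nn[OF that] by (simp add: less_eq_complex_def complex_is_Real_iff)
    consider "i = j" | "j = Suc i" | "i = Suc j" | "i + 1 < j \<or> j + 1 < i" by linarith
    then show "L $$ (i, j) \<in> \<real>"
    proof cases
      case 1
      have "cnj (L $$ (i, i)) = L $$ (i, i)" using herm[OF ij(1) ij(1)] by (rule sym)
      then show ?thesis using 1 by (simp add: complex_is_Real_iff complex_eq_iff)
    next
      case 2 then show ?thesis using im ij by simp
    next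
      case 3
      then have "L $$ (i, j) = cnj (L $$ (j, i))" using herm ij by blast
      then show ?thesis using im[of j] 3 ij by (simp add: complex_is_Real_iff)
    next
      case 4 then show ?thesis using tri[OF ij 4] by simp
    qed
  qed
  have nonneg: "0 \<le> L $$ (i, Suc i)"
    if h: "h \<in> unitary_group n" "left_nonneg n (\<lambda>i j. h $$ (i, j))"
      and Lh: "\<forall>i<n. \<forall>j<n. L $$ (i, j) = udiag n h (\<lambda>l. lam $ l) i j" and i: "Suc i < n" for h i
  proof -
    have t: "udiag n h (\<lambda>l. lam $ l) i j = 0" if "i < n" "j < n" "i + 1 < j \<or> j + 1 < i" for i j
      using tri[OF that] Lh that by simp
    have "0 \<le> udiag n h (\<lambda>l. lam $ l) i (Suc i)"
      by (rule tridiagonal_left_nonneg[OF h decr t i])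
    then show ?thesis using Lh i by simp
  qed
  have symRe: "Re (L $$ (Suc i, i)) = Re (L $$ (i, Suc i))" if "Suc i < n" for i
    using herm[of i "Suc i"] that by simp
  show "?A \<longleftrightarrow> ?B"
  proof
    assume ?A
    then obtain h where h: "h \<in> U_pos n" and Lh: "\<forall>i<n. \<forall>j<n. L $$ (i, j) = udiag n h (\<lambda>l. lam $ l) i j"
      unfolding orbit_pos_iff[OF L] by blast
    have ln: "left_nonneg n (\<lambda>i j. h $$ (i, j))"
      using U_pos_imp(2)[OF h] unfolding left_nonneg_def left_pos_def by (simp add: less_imp_le)
    note nn = nonneg[OF U_pos_imp(1)[OF h] ln Lh]
    have t: "udiag n h (\<lambda>l. lam $ l) i j = 0" if "i < n" "j < n" "i + 1 < j \<or> j + 1 < i" for i j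
      using tri[OF that] Lh that by simp
    have "0 < Re (L $$ (i, Suc i))" if i: "Suc i < n" for i
    proof -
      have "udiag n h (\<lambda>l. lam $ l) i (Suc i) \<noteq> 0"
        by (rule tridiagonal_nonzero[OF h decr lt t i])
      then have "L $$ (i, Suc i) \<noteq> 0" using Lh i by simp
      then show ?thesis using nn[OF i] by (auto simp: less_eq_complex_def complex_eq_iff)
    qed
    then show ?B using real[OF nn] symRe by simp
  next
    assume B: ?B
    define P where "P i j = (if i < n \<and> j < n then Re (L $$ (i, j)) else 0)" for i j
    have Pt: "P i j = 0" if "i + 1 < j \<or> j + 1 < i" for i j using tri[of i j] that by (auto simp: P_def)
    have Po: "0 < P i (Suc i) \<and> 0 < P (Suc i) i" if "Suc i < n" for i using B that by (auto simp: P_def)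
    have Pn: "0 \<le> P i (Suc i)" "0 \<le> P (Suc i) i" for i
      using Po[of i] by (cases "Suc i < n"; auto simp: P_def)+
    have eq: "of_real (P i j) = udiag n g (\<lambda>l. lam $ l) i j" if "i < n" "j < n" for i j
      using B that Lg by (simp add: P_def complex_is_Real_iff complex_eq_iff)
    have "\<exists>g'\<in>U_pos n. \<forall>\<nu>. \<forall>i<n. \<forall>j<n. udiag n g' \<nu> i j = udiag n g \<nu> i j"
      by (rule Jacobi_U_pos[OF Pt Pn Po eq g decr])
    then obtain g' where g': "g' \<in> U_pos n" "\<forall>\<nu>. \<forall>i<n. \<forall>j<n. udiag n g' \<nu> i j = udiag n g \<nu> i j" by blast
    then have "\<forall>i<n. \<forall>j<n. L $$ (i, j) = udiag n g' (\<lambda>l. lam $ l) i j" using Lg by simp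
    then show ?A unfolding orbit_pos_iff[OF L] using g'(1) by blast
  qed
  show "?C \<longleftrightarrow> ?D"
  proof
    assume ?C
    then obtain h where h: "h \<in> unitary_group n" "left_nonneg n (\<lambda>i j. h $$ (i, j))"
      and Lh: "\<forall>i<n. \<forall>j<n. L $$ (i, j) = udiag n h (\<lambda>l. lam $ l) i j"
      using orbit_nonneg_udiag[OF L] by blast
    note nn = nonneg[OF h Lh]
    have "0 \<le> Re (L $$ (i, Suc i))" if "Suc i < n" for i using nn[OF that] by (simp add: less_eq_complex_def)
    then show ?D using real[OF nn] symRe by simp
  next
    assume D: ?D
    show ?C
      by (rule tridiagonal_nonneg_imp_orbit_nonneg[OF L g _ decr tri]) (use D Lg in auto)
  qed
qed

section \<open>Projections\<close>

lemma adj_mat_index: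
  assumes A: "A \<in> carrier_mat (Suc m) (Suc m)" and ij: "i < Suc m" "j < Suc m"
  shows "adj_mat A $$ (i, j) = (-1) ^ (j + i) *
    fdet m (\<lambda>a b. A $$ (if a < j then a else Suc a, if b < i then b else Suc b))"
  using A ij by (simp add: adj_mat_def cofactor_def mat_delete_def fdet_def)

text \<open>Entries of the adjugate are polynomials in the entries of the matrix. Using it as an
  inverse up to the factor \<open>det\<close> makes continuity immediate.\<close>

lemma tendsto_adj_mat:
  fixes A :: "'m \<Rightarrow> real mat"
  assumes A: "\<And>q. A q \<in> carrier_mat n n" and B: "B \<in> carrier_mat n n"
    and lim: "\<And>i j. i < n \<Longrightarrow> j < n \<Longrightarrow> ((\<lambda>q. A q $$ (i, j)) \<longlongrightarrow> B $$ (i, j)) F"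
    and ij: "i < n" "j < n"
  shows "((\<lambda>q. adj_mat (A q) $$ (i, j)) \<longlongrightarrow> adj_mat B $$ (i, j)) F"
proof (cases n)
  case (Suc m)
  note A' = A[unfolded Suc] and B' = B[unfolded Suc] and ij' = ij[unfolded Suc]
  show ?thesis
    unfolding adj_mat_index[OF A' ij'] adj_mat_index[OF B' ij']
    by (intro tendsto_mult tendsto_const tendsto_fdet lim) (use Suc in auto)
qed (use ij in simp)

text \<open>A totally positive matrix so close to the identity that its inverse, up to a positive scalar,
  preserves the positivity of finitely many given numbers \<open>p I\<close>.\<close>

lemma gauss_near_identity:
  fixes p :: "nat set \<Rightarrow> real"
  assumes p: "\<And>I. I \<in> ksub n k \<Longrightarrow> 0 < p I"
  shows "\<exists>T U d. totally_pos n (\<lambda>i j. of_real (T i j)) \<and> d \<noteq> 0 \<and>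
    (\<forall>i<n. \<forall>j<n. (\<Sum>l<n. T i l * U l j) = (if i = j then d else (0::real))) \<and>
    (\<forall>I\<in>ksub n k. 0 < (\<Sum>K\<in>ksub n k. fdet k (\<lambda>a b. U (pick I a) (pick K b)) * p K))"
proof -
  define T where "T q = mat n n (\<lambda>(i, j). (q::real) ^ sq_dist i j)" for q
  have Tc: "T q \<in> carrier_mat n n" for q by (simp add: T_def)
  have Tlim: "((\<lambda>q. T q $$ (i, j)) \<longlongrightarrow> 1\<^sub>m n $$ (i, j)) (at_right 0)" if "i < n" "j < n" for i j
  proof -
    have "((\<lambda>q::real. q ^ sq_dist i j) \<longlongrightarrow> 0 ^ sq_dist i j) (at_right 0)" by (intro tendsto_intros)
    also have "(0::real) ^ sq_dist i j = 1\<^sub>m n $$ (i, j)" using that by (cases "i = j") (auto simp: power_0_left)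
    finally show ?thesis using that by (simp add: T_def)
  qed
  have "adj_mat (1\<^sub>m n :: real mat) = 1\<^sub>m n * adj_mat (1\<^sub>m n)"
    by (rule left_mult_one_mat[OF adj_mat(1)[OF one_carrier_mat], symmetric])
  also have "\<dots> = det (1\<^sub>m n) \<cdot>\<^sub>m 1\<^sub>m n" by (rule adj_mat(2)[OF one_carrier_mat])
  also have "\<dots> = 1\<^sub>m n" by (rule eq_matI) simp_all
  finally have "adj_mat (1\<^sub>m n :: real mat) = 1\<^sub>m n" .
  then have Ulim: "((\<lambda>q. adj_mat (T q) $$ (i, j)) \<longlongrightarrow> (if i = j then 1 else 0)) (at_right 0)" if "i < n" "j < n" for i j
    using tendsto_adj_mat[OF Tc one_carrier_mat Tlim that] that by simp
  have "\<forall>\<^sub>F q in at_right 0. \<forall>I\<in>ksub n k. 0 < (\<Sum>K\<in>ksub n k. fdet k (\<lambda>a b. adj_mat (T q) $$ (pick I a, pick K b)) * p K)"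
  proof (intro eventually_ball_finite finite_ksub ballI)
    fix I assume I: "I \<in> ksub n k"
    have "((\<lambda>q. \<Sum>K\<in>ksub n k. fdet k (\<lambda>a b. adj_mat (T q) $$ (pick I a, pick K b)) * p K) \<longlongrightarrow>
      (\<Sum>K\<in>ksub n k. fdet k (\<lambda>a b. if pick I a = pick K b then 1 else 0) * p K)) (at_right 0)"
      by (intro tendsto_sum tendsto_mult tendsto_const tendsto_fdet Ulim)
        (use pick_less I in auto)
    also have "(\<Sum>K\<in>ksub n k. fdet k (\<lambda>a b. if pick I a = pick K b then 1 else 0) * p K) =
      (\<Sum>K\<in>ksub n k. if I = K then p K else 0)"
      by (intro sum.cong refl) (simp add: fdet_delta[OF I])
    also have "\<dots> = p I" using I by simp
    finally show "\<forall>\<^sub>F q in at_right 0. 0 < (\<Sum>K\<in>ksub n k. fdet k (\<lambda>a b. adj_mat (T q) $$ (pick I a, pick K b)) * p K)"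
      by (rule order_tendstoD) (use p I in simp)
  qed
  then have ev: "\<forall>\<^sub>F q in at_right 0. (\<forall>I\<in>ksub n k. 0 < (\<Sum>K\<in>ksub n k. fdet k (\<lambda>a b. adj_mat (T q) $$ (pick I a, pick K b)) * p K))
      \<and> totally_pos n (\<lambda>i j. of_real (q ^ sq_dist i j))"
    using totally_pos_gauss by (rule eventually_conj)
  obtain q where q: "\<forall>I\<in>ksub n k. 0 < (\<Sum>K\<in>ksub n k. fdet k (\<lambda>a b. adj_mat (T q) $$ (pick I a, pick K b)) * p K)"
    "totally_pos n (\<lambda>i j. of_real (q ^ sq_dist i j))"
    using eventually_happens'[OF trivial_limit_at_right_real ev] by (elim exE conjE)
  have "incr n n (\<lambda>a. a)" by (simp add: incr_id)
  then have "0 < fdet n (\<lambda>a b. complex_of_real (q ^ sq_dist a b))" using totally_posD[OF q(2)] by blast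
  then have d: "0 < det (T q)" unfolding fdet_of_real[symmetric] by (simp add: T_def fdet_def)
  have TU: "(\<Sum>l<n. q ^ sq_dist i l * adj_mat (T q) $$ (l, j)) = (if i = j then det (T q) else 0)" if "i < n" "j < n" for i j
  proof -
    have "(\<Sum>l<n. q ^ sq_dist i l * adj_mat (T q) $$ (l, j)) = (T q * adj_mat (T q)) $$ (i, j)"
      unfolding index_mult_sum[OF Tc adj_mat(1)[OF Tc] that]
      by (intro sum.cong refl arg_cong2[where f="(*)"]) (use that in \<open>simp add: T_def\<close>)
    also have "\<dots> = (det (T q) \<cdot>\<^sub>m 1\<^sub>m n) $$ (i, j)" unfolding adj_mat(2)[OF Tc] ..
    finally show ?thesis using that by simp
  qed
  show ?thesis
    by (rule exI[of _ "\<lambda>i j. q ^ sq_dist i j"], rule exI[of _ "\<lambda>i j. adj_mat (T q) $$ (i, j)"], rule exI[of _ "det (T q)"])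
      (use q d TU in auto)
qed

lemma fdet_unit_rows:
  assumes "j \<le> k" "\<And>a b. j \<le> a \<Longrightarrow> a < k \<Longrightarrow> b < k \<Longrightarrow> h a b = (if a = b then 1 else 0)"
  shows "fdet k h = fdet j h"
  using assms
proof (induction k)
  case (Suc k)
  show ?case
  proof (cases "j = Suc k")
    case False
    then have jk: "j \<le> k" using Suc.prems by simp
    have "fdet (Suc k) h = h k k * fdet k h" by (rule fdet_last_row_unit) (use Suc.prems(2)[of k] jk in simp)
    also have "h k k = 1" using Suc.prems(2)[of k k] jk by simp
    finally show ?thesis using Suc.IH[OF jk] Suc.prems(2) by simp
  qed simp
qed simp

text \<open>If the last \<open>k\<close> rows form an identity matrix, then a left-justified minor of order \<open>j\<close> either
  vanishes or can be completed to a maximal minor by the last \<open>k - j\<close> rows.\<close>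

lemma left_minors_of_reduced_frame:
  fixes A :: "nat \<Rightarrow> nat \<Rightarrow> complex"
  assumes k: "k \<le> n" and j: "j \<le> k"
    and pos: "\<And>r. incr k n r \<Longrightarrow> 0 < fdet k (\<lambda>a b. A (r a) b)"
    and bot: "\<And>a b. a < k \<Longrightarrow> b < k \<Longrightarrow> A (n - k + a) b = (if a = b then 1 else 0)"
    and r: "incr j n r"
  shows "0 \<le> fdet j (\<lambda>a b. A (r a) b)"
proof (cases "j = 0 \<or> r (j - 1) < n - k + j")
  case True
  \<comment> \<open>Completion of \<open>r\<close> by the rows carrying the unit vectors
    \<open>j..k-1\<close>. The case assumption keeps the enumeration increasing, and the added rows
    do not change the determinant.\<close>
  define s where "s a = (if a < j then r a else n - k + a)" for a
  have rb: "r a < n - k + j" if "a < j" for a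
  proof -
    have "a \<le> j - 1" "j - 1 < j" using that by auto
    then have "r a \<le> r (j - 1)" by (rule incr_mono_le[OF r])
    then show ?thesis using True that by auto
  qed
  have "incr k n s"
  proof -
    have "s a < s b" if "a < b" "b < k" for a b
      using incr_mono[OF r, of a b] rb[of a] that by (auto simp: s_def)
    moreover have "s a < n" if "a < k" for a using incr_less[OF r, of a] that k by (auto simp: s_def)
    ultimately show ?thesis by (auto simp: incr_def strict_mono_on_def)
  qed
  then have "0 < fdet k (\<lambda>a b. A (s a) b)" by (rule pos)
  also have "fdet k (\<lambda>a b. A (s a) b) = fdet j (\<lambda>a b. A (s a) b)"
    by (rule fdet_unit_rows[OF j]) (use bot in \<open>simp add: s_def\<close>)
  also have "\<dots> = fdet j (\<lambda>a b. A (r a) b)" by (rule fdet_cong) (simp add: s_def)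
  finally show ?thesis by (rule less_imp_le)
next
  case False
  then have j0: "0 < j" and ge: "n - k + j \<le> r (j - 1)" by auto
  \<comment> \<open>The last chosen row is the unit vector with its 1 in column \<open>x\<close>,
    beyond the first \<open>j\<close> columns, so it contributes a zero row.\<close>
  define x where "x = r (j - 1) - (n - k)"
  have rx: "r (j - 1) = n - k + x" "j \<le> x" using ge by (auto simp: x_def)
  have "x < k" using incr_less[OF r, of "j - 1"] j0 rx k by linarith
  have "fdet j (\<lambda>a b. A (r a) b) = 0"
    by (rule fdet_zero_row[of "j - 1"]) (use j0 rx \<open>x < k\<close> bot[of x] j in auto)
  then show ?thesis by simp
qed

text \<open>Append columns \<open>(\<epsilon>\<^bsup>n-1\<^esup>, \<dots>, \<epsilon>, 1)\<close>: expanding along the last column, the bottom entry dominates.\<close>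

lemma extend_left_pos:
  fixes M0 :: "nat \<Rightarrow> nat \<Rightarrow> complex"
  assumes k: "k \<le> n" and M0: "\<And>j I. j \<le> k \<Longrightarrow> I \<in> ksub n j \<Longrightarrow> 0 < fdet j (\<lambda>a b. M0 (pick I a) b)"
  shows "k \<le> m \<Longrightarrow> m \<le> n \<Longrightarrow> \<exists>M. (\<forall>i j. j < k \<longrightarrow> M i j = M0 i j) \<and>
    (\<forall>j\<le>m. \<forall>I\<in>ksub n j. 0 < fdet j (\<lambda>a b. M (pick I a) b))"
proof (induction m rule: dec_induct)
  case base
  then show ?case using M0 by (intro exI[of _ M0]) simp
next
  case (step m)
  then obtain M where M: "\<forall>i j. j < k \<longrightarrow> M i j = M0 i j"
    "\<forall>j\<le>m. \<forall>I\<in>ksub n j. 0 < fdet j (\<lambda>a b. M (pick I a) b)" by auto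
  define W where "W e i j = (if j = m then complex_of_real (e ^ (n - 1 - i)) else M i j)" for e i j
  have old: "fdet j (\<lambda>a b. W e (r a) b) = fdet j (\<lambda>a b. M (r a) b)" if "j \<le> m" for j e r
    by (rule fdet_cong) (use that in \<open>simp add: W_def\<close>)
  have "\<forall>\<^sub>F e in at_right 0. \<forall>I\<in>ksub n (Suc m). 0 < fdet (Suc m) (\<lambda>a b. W e (pick I a) b)"
  proof (intro eventually_ball_finite finite_ksub ballI)
    fix I assume I: "I \<in> ksub n (Suc m)"
    define r where "r = pick I"
    have r: "incr (Suc m) n r" unfolding r_def by (rule incr_pick[OF I])
    define d where "d i = Re (fdet m (\<lambda>a b. M (r (if a < i then a else Suc a)) b))" for i
    have d: "fdet m (\<lambda>a b. M (r (if a < i then a else Suc a)) b) = of_real (d i)" "0 < d i" if "i \<le> m" for i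
    proof -
      have "incr m n (\<lambda>a. r (if a < i then a else Suc a))"
      proof -
        have "r (if a < i then a else Suc a) < r (if b < i then b else Suc b)" if "a < b" "b < m" for a b
          by (rule incr_mono[OF r]) (use that in auto)
        moreover have "r (if a < i then a else Suc a) < n" if "a < m" for a
          by (rule incr_less[OF r]) (use that in auto)
        ultimately show ?thesis by (simp add: incr_def strict_mono_on_def image_subset_iff)
      qed
      then have "0 < fdet m (\<lambda>a b. M (pick ((\<lambda>a. r (if a < i then a else Suc a)) ` {..<m}) a) b)"
        using M(2) incr_image by blast
      also have "\<dots> = fdet m (\<lambda>a b. M (r (if a < i then a else Suc a)) b)"
        using incr_eq_pick[OF \<open>incr m n (\<lambda>a. r (if a < i then a else Suc a))\<close>] by (intro fdet_cong) simp
      finally show "fdet m (\<lambda>a b. M (r (if a < i then a else Suc a)) b) = of_real (d i)" "0 < d i"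
        by (auto simp: d_def less_complex_def complex_eq_iff)
    qed
    define E where "E i = n - 1 - r i" for i
    have E: "E m < E i" if "i < m" for i
      using incr_mono[OF r that] incr_less[OF r, of m] unfolding E_def by simp
    define G where "G e = (\<Sum>i\<le>m. (-1) ^ (i + m) * d i * e ^ (E i - E m))" for e :: real
    have eq: "fdet (Suc m) (\<lambda>a b. W e (r a) b) = of_real (e ^ E m * G e)" for e
    proof -
      have "fdet (Suc m) (\<lambda>a b. W e (r a) b) = (\<Sum>i\<le>m. W e (r i) m * (-1) ^ (i + m) *
          fdet m (\<lambda>a b. W e (r (if a < i then a else Suc a)) b))"
        by (rule fdet_laplace_last_col)
      also have "\<dots> = (\<Sum>i\<le>m. of_real (e ^ E m * ((-1) ^ (i + m) * d i * e ^ (E i - E m))))"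
      proof (rule sum.cong[OF refl])
        fix i assume i: "i \<in> {..m}"
        have "E i = E m + (E i - E m)" using E[of i] i by (cases "i = m") auto
        then have ee: "e ^ E i = e ^ E m * e ^ (E i - E m)" by (metis power_add)
        have "W e (r i) m = of_real (e ^ E i)" by (simp add: W_def E_def)
        then show "W e (r i) m * (-1) ^ (i + m) * fdet m (\<lambda>a b. W e (r (if a < i then a else Suc a)) b) =
            of_real (e ^ E m * ((-1) ^ (i + m) * d i * e ^ (E i - E m)))"
          unfolding old[OF order_refl] d(1)[of i, OF i[unfolded atMost_iff]] ee by simp
      qed
      also have "\<dots> = of_real (e ^ E m * G e)"
        unfolding of_real_sum[symmetric] G_def sum_distrib_left ..
      finally show ?thesis .
    qed
    have "(G \<longlongrightarrow> (\<Sum>i\<le>m. (-1) ^ (i + m) * d i * 0 ^ (E i - E m))) (at_right 0)"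
      unfolding G_def by (intro tendsto_intros)
    also have "(\<Sum>i\<le>m. (-1) ^ (i + m) * d i * 0 ^ (E i - E m)) = (\<Sum>i\<le>m. if i = m then d i else 0)"
    proof (rule sum.cong[OF refl])
      fix i assume i: "i \<in> {..m}"
      show "(-1) ^ (i + m) * d i * 0 ^ (E i - E m) = (if i = m then d i else 0)"
      proof (cases "i = m")
        case False
        then have "E i - E m \<noteq> 0" using E[of i] i by simp
        then show ?thesis using False by (simp add: power_0_left)
      qed (simp add: mult_2[symmetric])
    qed
    also have "\<dots> = d m" by simp
    finally have "\<forall>\<^sub>F e in at_right 0. 0 < G e" by (rule order_tendstoD) (use d in simp)
    moreover have "\<forall>\<^sub>F e in at_right 0. (0::real) < e" by (rule eventually_at_right_less)
    ultimately show "\<forall>\<^sub>F e in at_right 0. 0 < fdet (Suc m) (\<lambda>a b. W e (pick I a) b)"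
      by eventually_elim (simp add: eq[unfolded r_def] del: of_real_mult of_real_power)
  qed
  then obtain e where e: "\<forall>I\<in>ksub n (Suc m). 0 < fdet (Suc m) (\<lambda>a b. W e (pick I a) b)"
    using eventually_happens'[OF trivial_limit_at_right_real] by blast
  have "0 < fdet j (\<lambda>a b. W e (pick I a) b)" if "j \<le> Suc m" "I \<in> ksub n j" for j I
  proof (cases "j = Suc m")
    case False
    then have "j \<le> m" using that by simp
    then show ?thesis using M(2) that old[of j e "pick I"] by simp
  qed (use e that in simp)
  moreover have "W e i j = M0 i j" if "j < k" for i j using M(1) that step.hyps by (simp add: W_def)
  ultimately show ?case by (intro exI[of _ "W e"]) simp
qed

text \<open>After applying the inverse of a totally positive matrix \<open>T\<close> near the identity, intersect with coordinate
  subspaces to get a flag with nonnegative coordinates, and then apply \<open>T\<close>.\<close>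

lemma positive_frame:
  fixes A :: "nat \<Rightarrow> nat \<Rightarrow> complex"
  assumes k: "k \<le> n" and A: "\<And>I. I \<in> ksub n k \<Longrightarrow> 0 < fdet k (\<lambda>a b. A (pick I a) b)"
  shows "\<exists>g\<in>U_pos n. \<exists>C. \<forall>a<n. \<forall>j<k. A a j = (\<Sum>i<k. g $$ (a, i) * C i j)"
proof -
  define p where "p I = Re (fdet k (\<lambda>a b. A (pick I a) b))" for I
  have p: "fdet k (\<lambda>a b. A (pick I a) b) = of_real (p I)" "0 < p I" if "I \<in> ksub n k" for I
    using A[OF that] by (auto simp: p_def less_complex_def complex_eq_iff)
  have "\<exists>T U d. totally_pos n (\<lambda>i j. of_real (T i j)) \<and> d \<noteq> 0 \<and>
    (\<forall>i<n. \<forall>j<n. (\<Sum>l<n. T i l * U l j) = (if i = j then d else (0::real))) \<and>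
    (\<forall>I\<in>ksub n k. 0 < (\<Sum>K\<in>ksub n k. fdet k (\<lambda>a b. U (pick I a) (pick K b)) * p K))"
    by (rule gauss_near_identity[OF p(2)])
  then obtain T U d where T: "totally_pos n (\<lambda>i j. complex_of_real (T i j))" and d: "d \<noteq> 0"
    and TU: "\<forall>i<n. \<forall>j<n. (\<Sum>l<n. T i l * U l j) = (if i = j then d else (0::real))"
    and Up: "\<forall>I\<in>ksub n k. 0 < (\<Sum>K\<in>ksub n k. fdet k (\<lambda>a b. U (pick I a) (pick K b)) * p K)"
    by (elim exE conjE)
  define A' where "A' i j = (\<Sum>l<n. of_real (U i l) * A l j)" for i j
  have A': "0 < fdet k (\<lambda>a b. A' (r a) b)" if r: "incr k n r" for r
  proof -
    define I where "I = r ` {..<k}"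
    have I: "I \<in> ksub n k" unfolding I_def by (rule incr_image[OF r])
    have "fdet k (\<lambda>a b. A' (r a) b) = fdet k (\<lambda>a b. A' (pick I a) b)"
      unfolding I_def using incr_eq_pick[OF r] by (intro fdet_cong) simp
    also have "\<dots> = (\<Sum>K\<in>ksub n k. fdet k (\<lambda>a b. complex_of_real (U (pick I a) (pick K b))) * fdet k (\<lambda>a b. A (pick K a) b))"
      unfolding A'_def by (rule Cauchy_Binet)
    also have "\<dots> = of_real (\<Sum>K\<in>ksub n k. fdet k (\<lambda>a b. U (pick I a) (pick K b)) * p K)"
      unfolding of_real_sum by (intro sum.cong refl) (simp add: p fdet_of_real)
    finally show ?thesis using Up I by (simp del: of_real_sum of_real_mult)
  qed
  \<comment> \<open>The bottom \<open>k\<close> rows of \<open>A'\<close>. Multiplying by the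
    inverse \<open>Y\<close> changes the basis of the column space so that this block becomes the
    identity; since \<open>fdet k Y\<close> is positive, maximal minors stay positive.\<close>
  define Z where "Z a b = A' (n - k + a) b" for a b
  have "incr k n (\<lambda>a. n - k + a)" using k by (auto simp: incr_def strict_mono_on_def)
  then have Zpos: "0 < fdet k Z" unfolding Z_def by (rule A')
  then obtain Y where ZY: "\<forall>a<k. \<forall>b<k. (\<Sum>j<k. Z a j * Y j b) = (if a = b then 1 else 0)"
    and YZ: "\<forall>a<k. \<forall>b<k. (\<Sum>j<k. Y a j * Z j b) = (if a = b then 1 else 0)"
    using fdet_inverse[of k Z] by (metis less_irrefl)
  have "fdet k (\<lambda>a b. \<Sum>j<k. Y a j * Z j b) = fdet k (\<lambda>a b. if a = b then 1 else 0)"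
    by (rule fdet_cong) (use YZ in simp)
  also have "\<dots> = 1" by (subst fdet_upper_triangular) simp_all
  finally have "fdet k Y * fdet k Z = 1" by (simp only: fdet_mult)
  then have Ypos: "0 < fdet k Y" using complex_pos_mult_cancel[OF Zpos, of "fdet k Y"] complex_zero_less_one by simp
  define A'' where "A'' i j = (\<Sum>l<k. A' i l * Y l j)" for i j
  have A'': "0 < fdet k (\<lambda>a b. A'' (r a) b)" if "incr k n r" for r
    unfolding A''_def fdet_mult by (rule complex_mult_pos[OF A'[OF that] Ypos])
  have bot: "A'' (n - k + a) b = (if a = b then 1 else 0)" if "a < k" "b < k" for a b
    using ZY that by (simp add: A''_def Z_def)
  have A''nn: "0 \<le> fdet j (\<lambda>a b. A'' (pick K a) b)" if "j \<le> k" "K \<in> ksub n j" for j K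
    by (rule left_minors_of_reduced_frame[OF k that(1) A'' bot incr_pick[OF that(2)]])
  have A''1: "\<exists>K\<in>ksub n j. 0 < fdet j (\<lambda>a b. A'' (pick K a) b)" if j: "j \<le> k" for j
  proof -
    have i: "incr j n (\<lambda>a. n - k + a)" using k j by (auto simp: incr_def strict_mono_on_def)
    define K where "K = (\<lambda>a. n - k + a) ` {..<j}"
    have "fdet j (\<lambda>a b. A'' (pick K a) b) = fdet j (\<lambda>a b. if a = b then 1 else 0)"
      unfolding K_def
    proof (rule fdet_cong)
      fix a b assume "a < j" "b < j"
      then show "A'' (pick ((\<lambda>a. n - k + a) ` {..<j}) a) b = (if a = b then 1 else 0)"
        using incr_eq_pick[OF i, symmetric] bot j by simp
    qed
    also have "\<dots> = 1" by (subst fdet_upper_triangular) simp_all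
    finally have "0 < fdet j (\<lambda>a b. A'' (pick K a) b)" by (simp add: complex_zero_less_one)
    then show ?thesis using incr_image[OF i] unfolding K_def by blast
  qed
  define M0 where "M0 i j = (\<Sum>l<n. of_real (T i l) * A'' l j)" for i j
  have M0: "0 < fdet j (\<lambda>a b. M0 (pick I a) b)" if j: "j \<le> k" and I: "I \<in> ksub n j" for j I
  proof -
    have Tp: "0 < fdet j (\<lambda>a b. complex_of_real (T (pick I a) (pick K b)))" if "K \<in> ksub n j" for K
      using T j k I that unfolding totally_pos_def by simp
    obtain K where K: "K \<in> ksub n j" "0 < fdet j (\<lambda>a b. A'' (pick K a) b)" using A''1[OF j] by blast
    have "fdet j (\<lambda>a b. M0 (pick I a) b) =
        (\<Sum>K\<in>ksub n j. fdet j (\<lambda>a b. complex_of_real (T (pick I a) (pick K b))) * fdet j (\<lambda>a b. A'' (pick K a) b))"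
      unfolding M0_def by (rule Cauchy_Binet)
    also have "0 < \<dots>"
    proof (rule sum_pos2[OF finite_ksub K(1)])
      show "0 < fdet j (\<lambda>a b. complex_of_real (T (pick I a) (pick K b))) * fdet j (\<lambda>a b. A'' (pick K a) b)"
        by (rule complex_mult_pos[OF Tp[OF K(1)] K(2)])
      show "0 \<le> fdet j (\<lambda>a b. complex_of_real (T (pick I a) (pick K b))) * fdet j (\<lambda>a b. A'' (pick K a) b)"
        if "K \<in> ksub n j" for K
        by (rule mult_nonneg_nonneg[OF less_imp_le[OF Tp[OF that]] A''nn[OF j that]])
    qed
    finally show ?thesis .
  qed
  have "\<exists>M. (\<forall>i j. j < k \<longrightarrow> M i j = M0 i j) \<and>
    (\<forall>j\<le>n. \<forall>I\<in>ksub n j. 0 < fdet j (\<lambda>a b. M (pick I a) b))"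
    by (rule extend_left_pos[OF k M0 k order_refl])
  then obtain M where M: "\<And>i j. j < k \<Longrightarrow> M i j = M0 i j" and Ml: "left_pos n M"
    unfolding left_pos_def by blast
  obtain g b where g: "g \<in> unitary_group n" and b: "upper_pos n b"
    and Mgb: "\<forall>a<n. \<forall>j<n. M a j = (\<Sum>i<n. g $$ (a, i) * b i j)"
    using QR_unitary[of n M, OF left_pos_nonzero[OF Ml]] by blast
  have "left_pos n (\<lambda>i j. g $$ (i, j))"
    using left_pos_mult_upper_pos[OF b, of M "\<lambda>i j. g $$ (i, j)"] Mgb Ml by simp
  then have gU: "g \<in> U_pos n" using g by (simp add: U_pos_iff)
  have M0b: "M0 a j = (\<Sum>i<k. g $$ (a, i) * b i j)" if "a < n" "j < k" for a j
  proof -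
    have jn: "j < n" using that k by simp
    have "M0 a j = M a j" by (rule M[OF that(2), symmetric])
    also have "\<dots> = (\<Sum>i<n. g $$ (a, i) * b i j)" using Mgb that(1) jn by blast
    also have "\<dots> = (\<Sum>i<k. g $$ (a, i) * b i j)"
    proof (rule sum.mono_neutral_right)
      show "\<forall>i\<in>{..<n} - {..<k}. g $$ (a, i) * b i j = 0"
        using b that(2) unfolding upper_pos_def by simp
    qed (use k in auto)
    finally show ?thesis .
  qed
  have A'Z: "(\<Sum>l<k. A'' i l * Z l j) = A' i j" if "j < k" for i j
  proof -
    have "(\<Sum>l<k. A'' i l * Z l j) = (\<Sum>x<k. A' i x * (\<Sum>l<k. Y x l * Z l j))"
      unfolding A''_def sum_distrib_left sum_distrib_right by (subst sum.swap) (simp add: mult.assoc)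
    also have "\<dots> = (\<Sum>x<k. if x = j then A' i x else 0)"
      by (intro sum.cong refl) (use YZ that in simp)
    finally show ?thesis using that by simp
  qed
  have TA': "(\<Sum>l<n. of_real (T i l) * A' l j) = of_real d * A i j" if "i < n" for i j
  proof -
    have "(\<Sum>l<n. of_real (T i l) * A' l j) = (\<Sum>x<n. of_real (\<Sum>l<n. T i l * U l x) * A x j)"
      unfolding A'_def sum_distrib_left of_real_sum sum_distrib_right
      by (subst sum.swap) (simp add: mult.assoc)
    also have "\<dots> = (\<Sum>x<n. if i = x then of_real d * A x j else 0)"
      by (intro sum.cong refl) (use TU that in simp)
    finally show ?thesis using that by simp
  qed
  \<comment> \<open>All changes are undone: \<open>T\<close> times \<open>A'\<close> is
    \<open>d\<close> times \<open>A\<close>, \<open>A'\<close> is \<open>A''\<close> times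
    \<open>Z\<close>, and \<open>T\<close> times \<open>A''\<close> is \<open>M0\<close>, which
    factors through the first \<open>k\<close> columns of \<open>g\<close> by way of
    \<open>b\<close>. This gives the coefficients \<open>b * Z / d\<close>.\<close>
  have "A a j = (\<Sum>i<k. g $$ (a, i) * ((\<Sum>l<k. b i l * Z l j) / of_real d))" if a: "a < n" and j: "j < k" for a j
  proof -
    have "of_real d * A a j = (\<Sum>x<n. of_real (T a x) * (\<Sum>l<k. A'' x l * Z l j))"
      unfolding A'Z[OF j] TA'[OF a] ..
    also have "\<dots> = (\<Sum>l<k. M0 a l * Z l j)"
      unfolding M0_def sum_distrib_left sum_distrib_right by (subst sum.swap) (simp add: mult.assoc)
    also have "\<dots> = (\<Sum>l<k. (\<Sum>i<k. g $$ (a, i) * b i l) * Z l j)"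
      by (intro sum.cong refl) (use M0b a in simp)
    also have "\<dots> = (\<Sum>i<k. g $$ (a, i) * (\<Sum>l<k. b i l * Z l j))"
      unfolding sum_distrib_left sum_distrib_right by (subst sum.swap) (simp add: mult.assoc)
    finally show ?thesis using d by (simp add: sum_divide_distrib[symmetric] field_simps)
  qed
  then show ?thesis using gU
    by (intro bexI[of _ g] exI[of _ "\<lambda>i j. (\<Sum>l<k. b i l * Z l j) / of_real d"]) auto
qed

section \<open>Orthogonal projections of rank \<open>k\<close>\<close>

definition first_ones :: "nat \<Rightarrow> nat \<Rightarrow> real" where
  "first_ones k l = (if l < k then 1 else 0)"

lemma udiag_step:
  assumes "k \<le> n"
  shows "udiag n g (first_ones k) i j = (\<Sum>l<k. g $$ (i, l) * cnj (g $$ (j, l)))"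
proof -
  have "udiag n g (first_ones k) i j = (\<Sum>l<k. g $$ (i, l) * of_real (first_ones k l) * cnj (g $$ (j, l)))"
    unfolding udiag_def by (rule sum.mono_neutral_right) (use assms in \<open>auto simp: first_ones_def\<close>)
  then show ?thesis by (simp add: first_ones_def)
qed

lemma minor_udiag_step:
  assumes k: "k \<le> n"
  shows "fdet k (\<lambda>a b. udiag n g (first_ones k) (r a) (c b)) =
    fdet k (\<lambda>a b. g $$ (r a, b)) * cnj (fdet k (\<lambda>a b. g $$ (c a, b)))"
proof -
  have "fdet k (\<lambda>a b. udiag n g (first_ones k) (r a) (c b)) = fdet k (\<lambda>a b. \<Sum>l<k. g $$ (r a, l) * cnj (g $$ (c b, l)))"
    by (simp only: udiag_step[OF k])
  also have "\<dots> = fdet k (\<lambda>a b. g $$ (r a, b)) * fdet k (\<lambda>a b. cnj (g $$ (c b, a)))" by (rule fdet_mult)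
  also have "fdet k (\<lambda>a b. cnj (g $$ (c b, a))) = cnj (fdet k (\<lambda>a b. g $$ (c a, b)))"
    unfolding fdet_cnj by (rule fdet_transpose[of k "\<lambda>a b. cnj (g $$ (c a, b))"])
  finally show ?thesis .
qed

text \<open>Columns in the span of eigenvectors for the eigenvalue 1 are fixed. The conclusion no
  longer mentions the coefficients \<open>C\<close>, so it passes to limits without any control over
  them.\<close>

lemma udiag_step_fixes:
  assumes g: "g \<in> unitary_group n" and k: "k \<le> n"
    and A: "\<And>a j. a < n \<Longrightarrow> j < m \<Longrightarrow> A a j = (\<Sum>i<k. g $$ (a, i) * C i j)" and aj: "a < n" "j < m"
  shows "(\<Sum>b<n. udiag n g (first_ones k) a b * A b j) = A a j"
proof -
  have "(\<Sum>b<n. udiag n g (first_ones k) a b * A b j) = (\<Sum>b<n. \<Sum>i<k. udiag n g (first_ones k) a b * (g $$ (b, i) * C i j))"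
    by (intro sum.cong refl) (use A aj in \<open>simp add: sum_distrib_left\<close>)
  also have "\<dots> = (\<Sum>i<k. (\<Sum>b<n. udiag n g (first_ones k) a b * g $$ (b, i)) * C i j)"
    unfolding sum_distrib_right by (subst sum.swap) (simp only: mult.assoc)
  also have "\<dots> = (\<Sum>i<k. g $$ (a, i) * C i j)"
    by (intro sum.cong refl) (use udiag_eigenvector[OF g] k in \<open>simp add: first_ones_def\<close>)
  finally show ?thesis using A aj by simp
qed

lemma udiag_step_trace:
  assumes g: "g \<in> unitary_group n" and k: "k \<le> n"
  shows "(\<Sum>a<n. udiag n g (first_ones k) a a) = of_nat k"
proof -
  have "(\<Sum>a<n. udiag n g (first_ones k) a a) = (\<Sum>l<k. \<Sum>a<n. cnj (g $$ (a, l)) * g $$ (a, l))"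
    unfolding udiag_step[OF k] by (subst sum.swap) (simp only: mult.commute)
  also have "\<dots> = (\<Sum>l<k. 1)" by (intro sum.cong refl) (use unitary_cols[OF g] k in simp)
  finally show ?thesis by simp
qed

text \<open>Two orthogonal projections of rank \<open>k\<close> agree once one fixes the image of the other: the
  Frobenius norm of their difference is a difference of traces.\<close>

lemma udiag_step_unique:
  assumes g: "g \<in> unitary_group n" and h: "h \<in> unitary_group n" and k: "k \<le> n"
    and J: "J \<in> ksub n k" and nz: "fdet k (\<lambda>a b. g $$ (pick J a, b)) \<noteq> 0"
    and fx: "\<And>a j. a < n \<Longrightarrow> j < k \<Longrightarrow>
      (\<Sum>b<n. udiag n h (first_ones k) a b * udiag n g (first_ones k) b (pick J j)) = udiag n g (first_ones k) a (pick J j)"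
    and ij: "i < n" "j < n"
  shows "udiag n h (first_ones k) i j = udiag n g (first_ones k) i j"
proof -
  define L where "L = udiag n g (first_ones k)"
  define P where "P = udiag n h (first_ones k)"
  \<comment> \<open>Columns \<open>J\<close> of the projection are the first \<open>k\<close>
    columns of \<open>g\<close> times \<open>X\<close>. As \<open>X\<close> is invertible, these
    \<open>k\<close> columns already span the image, so being fixed on them is enough.\<close>
  define X where "X l j = cnj (g $$ (pick J j, l))" for l j
  have "fdet k X = cnj (fdet k (\<lambda>a b. g $$ (pick J a, b)))"
    unfolding X_def fdet_cnj by (rule fdet_transpose[of k "\<lambda>a b. cnj (g $$ (pick J a, b))"])
  then have "fdet k X \<noteq> 0" using nz by simp
  then obtain Y where XY: "\<forall>a<k. \<forall>b<k. (\<Sum>j<k. X a j * Y j b) = (if a = b then 1 else 0)"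
    using fdet_inverse by blast
  have LJ: "L a (pick J j) = (\<Sum>l<k. g $$ (a, l) * X l j)" for a j
    unfolding L_def udiag_step[OF k] X_def ..
  have gLY: "g $$ (a, l) = (\<Sum>j<k. L a (pick J j) * Y j l)" if "l < k" for a l
  proof -
    have "(\<Sum>j<k. L a (pick J j) * Y j l) = (\<Sum>x<k. g $$ (a, x) * (\<Sum>j<k. X x j * Y j l))"
      unfolding LJ sum_distrib_left sum_distrib_right by (subst sum.swap) (simp add: mult.assoc)
    also have "\<dots> = (\<Sum>x<k. if x = l then g $$ (a, x) else 0)"
      by (intro sum.cong refl) (use XY that in simp)
    finally show ?thesis using that by simp
  qed
  have Pg: "(\<Sum>b<n. P a b * g $$ (b, l)) = g $$ (a, l)" if "a < n" "l < k" for a l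
  proof -
    have "(\<Sum>b<n. P a b * g $$ (b, l)) = (\<Sum>j<k. (\<Sum>b<n. P a b * L b (pick J j)) * Y j l)"
      unfolding gLY[OF that(2)] sum_distrib_left sum_distrib_right by (subst sum.swap) (simp add: mult.assoc)
    also have "\<dots> = (\<Sum>j<k. L a (pick J j) * Y j l)"
      by (intro sum.cong refl) (use fx that in \<open>simp add: L_def P_def\<close>)
    finally show ?thesis using gLY[OF that(2)] by simp
  qed
  have PL: "(\<Sum>b<n. P a b * L b c) = L a c" if "a < n" for a c
  proof -
    have "(\<Sum>b<n. P a b * L b c) = (\<Sum>l<k. (\<Sum>b<n. P a b * g $$ (b, l)) * cnj (g $$ (c, l)))"
      unfolding L_def udiag_step[OF k] sum_distrib_left sum_distrib_right
      by (subst sum.swap) (simp add: mult.assoc)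
    also have "\<dots> = L a c"
      unfolding L_def udiag_step[OF k] by (intro sum.cong refl) (use Pg that in simp)
    finally show ?thesis .
  qed
  have hL: "L b a = cnj (L a b)" for a b unfolding L_def by (rule udiag_herm)
  have hP: "P b a = cnj (P a b)" for a b unfolding P_def by (rule udiag_herm)
  have LP: "(\<Sum>b<n. L a b * P b a) = L a a" if "a < n" for a
  proof -
    have "(\<Sum>b<n. L a b * P b a) = cnj (\<Sum>b<n. P a b * L b a)"
      unfolding cnj_sum complex_cnj_mult by (intro sum.cong refl) (simp only: hL[symmetric] hP[symmetric] mult.commute)
    then show ?thesis unfolding PL[OF that] hL[symmetric] .
  qed
  have idem: "(\<lambda>l. first_ones k l * first_ones k l) = first_ones k" by (auto simp: first_ones_def)
  have PP: "(\<Sum>b<n. P a b * P b a) = P a a" and LL: "(\<Sum>b<n. L a b * L b a) = L a a" for a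
    unfolding P_def L_def using udiag_mult[OF h, of "first_ones k" a "first_ones k" a] udiag_mult[OF g, of "first_ones k" a "first_ones k" a] idem by simp_all
  have "(\<Sum>a<n. \<Sum>b<n. (P a b - L a b) * (P b a - L b a)) =
      (\<Sum>a<n. (\<Sum>b<n. P a b * P b a) - (\<Sum>b<n. P a b * L b a) - (\<Sum>b<n. L a b * P b a) + (\<Sum>b<n. L a b * L b a))"
    by (simp add: algebra_simps sum.distrib sum_subtractf)
  also have "\<dots> = (\<Sum>a<n. P a a - L a a)"
    by (intro sum.cong refl) (simp add: PP LL PL LP)
  also have "\<dots> = 0"
    unfolding sum_subtractf P_def L_def udiag_step_trace[OF g k] udiag_step_trace[OF h k] by simp
  finally have z: "(\<Sum>a<n. \<Sum>b<n. (P a b - L a b) * (P b a - L b a)) = 0" .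
  have "(P a b - L a b) * (P b a - L b a) = of_real ((cmod (P a b - L a b))\<^sup>2)" for a b
    using complex_norm_square[of "P a b - L a b"] hP[of b a] hL[of b a] by simp
  then have "complex_of_real (\<Sum>a<n. \<Sum>b<n. (cmod (P a b - L a b))\<^sup>2) = 0" using z by simp
  then have s0: "(\<Sum>a<n. \<Sum>b<n. (cmod (P a b - L a b))\<^sup>2) = 0" using of_real_eq_0_iff by blast
  have "(cmod (P i j - L i j))\<^sup>2 \<le> (\<Sum>b<n. (cmod (P i b - L i b))\<^sup>2)"
    using ij by (intro member_le_sum) auto
  also have "\<dots> \<le> (\<Sum>a<n. \<Sum>b<n. (cmod (P a b - L a b))\<^sup>2)"
    using ij by (intro member_le_sum sum_nonneg) auto
  finally show ?thesis using s0 by (simp add: P_def L_def)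
qed

lemma udiag_omega: "udiag n g (\<lambda>l. omega n k $ l) i j = udiag n g (first_ones k) i j"
  by (rule udiag_cong) (simp add: omega_def first_ones_def)

lemma pos_complex_iff: "0 < z \<longleftrightarrow> z \<in> \<real> \<and> 0 < Re z"
  by (auto simp: less_complex_def complex_is_Real_iff)

lemma nonneg_complex_iff: "0 \<le> z \<longleftrightarrow> z \<in> \<real> \<and> 0 \<le> Re z"
  by (auto simp: less_eq_complex_def complex_is_Real_iff)

lemma orbit_omega_iff:
  assumes L: "L \<in> carrier_mat n n" and orb: "\<i> \<cdot>\<^sub>m L \<in> orbit n (omega n k)" and k: "k \<le> n"
  shows "\<i> \<cdot>\<^sub>m L \<in> orbit_pos n (omega n k) \<longleftrightarrow>
      (\<forall>I\<in>ksub n k. \<forall>J\<in>ksub n k. 0 < minor L I J)" (is "?A \<longleftrightarrow> ?B")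
    and "\<i> \<cdot>\<^sub>m L \<in> orbit_nonneg n (omega n k) \<longleftrightarrow>
      (\<forall>I\<in>ksub n k. \<forall>J\<in>ksub n k. 0 \<le> minor L I J)" (is "?C \<longleftrightarrow> ?D")
proof -
  obtain g where g: "g \<in> unitary_group n" and Lg: "\<forall>i<n. \<forall>j<n. L $$ (i, j) = udiag n g (first_ones k) i j"
    using orb unfolding orbit_iff[OF L] udiag_omega by blast
  have mv: "minor L I J = fdet k (\<lambda>a b. h $$ (pick I a, b)) * cnj (fdet k (\<lambda>a b. h $$ (pick J a, b)))"
    if Lh: "\<forall>i<n. \<forall>j<n. L $$ (i, j) = udiag n h (first_ones k) i j" and IJ: "I \<in> ksub n k" "J \<in> ksub n k" for h I J
  proof -
    have "minor L I J = fdet k (\<lambda>a b. udiag n h (first_ones k) (pick I a) (pick J b))"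
      unfolding minor_eq_fdet[OF L IJ] by (rule fdet_cong) (use Lh IJ pick_less in simp)
    then show ?thesis unfolding minor_udiag_step[OF k] .
  qed
  have cp: "0 < cnj z" if "0 < z" for z using that by (simp add: less_complex_def)
  have cn: "0 \<le> cnj z" if "0 \<le> z" for z using that by (simp add: less_eq_complex_def)
  define v where "v I = fdet k (\<lambda>a b. g $$ (pick I a, b))" for I
  obtain J where J: "J \<in> ksub n k" "v J \<noteq> 0" using left_minor_nonzero[OF g k] by (auto simp: v_def)
  \<comment> \<open>Columns \<open>J\<close> of \<open>L\<close> with \<open>v J\<close> nonzero: a
    frame of the image whose maximal minors are themselves minors of \<open>L\<close>, so the
    hypotheses on minors apply to it directly.\<close>
  define A where "A a j = udiag n g (first_ones k) a (pick J j)" for a j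
  have Ap: "fdet k (\<lambda>a b. A (pick I a) b) = minor L I J" if "I \<in> ksub n k" for I
    unfolding A_def minor_udiag_step[OF k] mv[OF Lg that J(1)] ..
  show "?A \<longleftrightarrow> ?B"
  proof
    assume ?A
    then obtain h where h: "h \<in> U_pos n" and Lh: "\<forall>i<n. \<forall>j<n. L $$ (i, j) = udiag n h (first_ones k) i j"
      unfolding orbit_pos_iff[OF L] udiag_omega by blast
    have "0 < fdet k (\<lambda>a b. h $$ (pick I a, b))" if "I \<in> ksub n k" for I
      using U_pos_imp(2)[OF h] k that unfolding left_pos_def by blast
    then show ?B using mv[OF Lh] complex_mult_pos cp by simp
  next
    assume B: ?B
    have "\<exists>h\<in>U_pos n. \<exists>C. \<forall>a<n. \<forall>j<k. A a j = (\<Sum>i<k. h $$ (a, i) * C i j)"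
      by (rule positive_frame[OF k]) (simp add: Ap B J(1))
    then obtain h C where h: "h \<in> U_pos n" and C: "\<forall>a<n. \<forall>j<k. A a j = (\<Sum>i<k. h $$ (a, i) * C i j)"
      by blast
    note hu = U_pos_imp(1)[OF h]
    have fx: "(\<Sum>b<n. udiag n h (first_ones k) a b * udiag n g (first_ones k) b (pick J j)) = udiag n g (first_ones k) a (pick J j)"
      if "a < n" "j < k" for a j
    proof -
      have "(\<Sum>b<n. udiag n h (first_ones k) a b * A b j) = A a j"
        by (rule udiag_step_fixes[OF hu k, where m=k and C=C]) (use C that in simp_all)
      then show ?thesis unfolding A_def .
    qed
    have "udiag n h (first_ones k) i j = udiag n g (first_ones k) i j" if "i < n" "j < n" for i j
      by (rule udiag_step_unique[OF g hu k J(1) J(2)[unfolded v_def] fx that])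
    then have "\<forall>i<n. \<forall>j<n. L $$ (i, j) = udiag n h (first_ones k) i j" using Lg by simp
    then show ?A unfolding orbit_pos_iff[OF L] udiag_omega using h by blast
  qed
  show "?C \<longleftrightarrow> ?D"
  proof
    assume nonneg: ?C
    obtain h where h: "h \<in> unitary_group n" "left_nonneg n (\<lambda>i j. h $$ (i, j))"
      and Lh: "\<forall>i<n. \<forall>j<n. L $$ (i, j) = udiag n h (first_ones k) i j"
      using orbit_nonneg_udiag[OF L nonneg] unfolding udiag_omega by blast
    have "0 \<le> fdet k (\<lambda>a b. h $$ (pick I a, b))" if "I \<in> ksub n k" for I
      using h(2) k that unfolding left_nonneg_def by blast
    then show ?D using mv[OF Lh] mult_nonneg_nonneg cn by simp
  next
    assume D: ?D
    \<comment> \<open>This minor is the squared modulus of \<open>v J\<close>, hence strictly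
      positive even when other minors vanish.\<close>
    have JJ: "0 < minor L J J"
    proof -
      have "0 \<le> minor L J J" using D J(1) by blast
      moreover have "minor L J J \<noteq> 0" using J mv[OF Lg J(1) J(1)] by (simp add: v_def)
      ultimately
      show ?thesis by (simp add: order.strict_iff_order)
    qed
    have ql: "filterlim (\<lambda>m. inverse (real (Suc m))) (at_right 0) sequentially"
      by (rule tendsto_imp_filterlim_at_right[OF LIMSEQ_inverse_real_of_nat]) simp
    have "\<forall>\<^sub>F m in sequentially. totally_pos n (\<lambda>i j. complex_of_real (inverse (real (Suc m)) ^ sq_dist i j))"
      by (rule eventually_compose_filterlim[OF totally_pos_gauss ql])
    then obtain N where N: "\<And>m. N \<le> m \<Longrightarrow> totally_pos n (\<lambda>i j. complex_of_real (inverse (real (Suc m)) ^ sq_dist i j))"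
      unfolding eventually_sequentially by blast
    \<comment> \<open>The shift by \<open>N\<close> makes the Gaussian matrix totally positive for
      every \<open>m\<close>, not only eventually.\<close>
    define q where "q m = inverse (real (Suc (m + N)))" for m
    have qt: "totally_pos n (\<lambda>i j. complex_of_real (q m ^ sq_dist i j))" for m unfolding q_def by (rule N) simp
    have q0: "filterlim q (at_right 0) sequentially"
      unfolding q_def using filterlim_compose[OF ql filterlim_add_const_nat_at_top] by (simp add: o_def)
    \<comment> \<open>Smoothing by a totally positive matrix turns nonnegative maximal minors, one
      of them positive, into positive ones, and \<open>B m\<close> tends to
      \<open>A\<close>.\<close>
    define B where "B m i j = (\<Sum>l<n. of_real (q m ^ sq_dist i l) * A l j)" for m i j
    have Bp: "0 < fdet k (\<lambda>a b. B m (pick I a) b)" if I: "I \<in> ksub n k" for m I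
    proof -
      have Tp: "0 < fdet k (\<lambda>a b. complex_of_real (q m ^ sq_dist (pick I a) (pick K b)))" if "K \<in> ksub n k" for K
        using qt[of m] k I that unfolding totally_pos_def by blast
      have "fdet k (\<lambda>a b. B m (pick I a) b) = (\<Sum>K\<in>ksub n k.
          fdet k (\<lambda>a b. complex_of_real (q m ^ sq_dist (pick I a) (pick K b))) * fdet k (\<lambda>a b. A (pick K a) b))"
        unfolding B_def by (rule Cauchy_Binet)
      also have "0 < \<dots>"
      proof (rule sum_pos2[OF finite_ksub J(1)])
        show "0 < fdet k (\<lambda>a b. complex_of_real (q m ^ sq_dist (pick I a) (pick J b))) * fdet k (\<lambda>a b. A (pick J a) b)"
          unfolding Ap[OF J(1)] by (rule complex_mult_pos[OF Tp[OF J(1)] JJ])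
        show "0 \<le> fdet k (\<lambda>a b. complex_of_real (q m ^ sq_dist (pick I a) (pick K b))) * fdet k (\<lambda>a b. A (pick K a) b)"
          if K: "K \<in> ksub n k" for K
          unfolding Ap[OF K] using D K J(1) by (intro mult_nonneg_nonneg less_imp_le[OF Tp[OF K]]) blast
      qed
      finally show ?thesis .
    qed
    have ex: "\<exists>h\<in>U_pos n. \<exists>C. \<forall>a<n. \<forall>j<k. B m a j = (\<Sum>i<k. h $$ (a, i) * C i j)" for m
      by (rule positive_frame[OF k Bp])
    have "\<forall>m. \<exists>h. h \<in> U_pos n \<and> (\<exists>C. \<forall>a<n. \<forall>j<k. B m a j = (\<Sum>i<k. h $$ (a, i) * C i j))"
      using ex by blast
    then have "\<exists>h. \<forall>m. h m \<in> U_pos n \<and> (\<exists>C. \<forall>a<n. \<forall>j<k. B m a j = (\<Sum>i<k. h m $$ (a, i) * C i j))"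
      by (rule choice)
    then obtain h where h: "\<And>m. h m \<in> U_pos n"
      and exC: "\<And>m. \<exists>C. \<forall>a<n. \<forall>j<k. B m a j = (\<Sum>i<k. h m $$ (a, i) * C i j)" by blast
    obtain r h' where r: "strict_mono r" and h': "h' \<in> unitary_group n"
      and hl: "\<forall>i<n. \<forall>j<n. (\<lambda>m. h (r m) $$ (i, j)) \<longlonglongrightarrow> h' $$ (i, j)"
      using U_pos_subseq[of h n, OF h] by blast
    have Bl: "(\<lambda>m. B (r m) a j) \<longlonglongrightarrow> A a j" if a: "a < n" for a j
    proof -
      have "filterlim (\<lambda>m. q (r m)) (at_right 0) sequentially"
        by (rule filterlim_compose[OF q0 filterlim_subseq[OF r]])
      then have "(\<lambda>m. complex_of_real (q (r m) ^ sq_dist a l)) \<longlonglongrightarrow> (if a = l then 1 else 0)" for l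
        by (rule filterlim_compose[OF tendsto_gauss])
      then have "(\<lambda>m. B (r m) a j) \<longlonglongrightarrow> (\<Sum>l<n. (if a = l then 1 else 0) * A l j)"
        unfolding B_def by (intro tendsto_sum tendsto_mult tendsto_const)
      also have "(\<Sum>l<n. (if a = l then 1 else 0) * A l j) = (\<Sum>l<n. if a = l then A l j else 0)"
        by (intro sum.cong refl) simp
      finally show ?thesis using a by simp
    qed
    have fx: "(\<Sum>b<n. udiag n h' (first_ones k) a b * udiag n g (first_ones k) b (pick J j)) = udiag n g (first_ones k) a (pick J j)"
      if "a < n" "j < k" for a j
    proof -
      have "(\<lambda>m. \<Sum>b<n. udiag n (h (r m)) (first_ones k) a b * B (r m) b j) \<longlonglongrightarrow>
          (\<Sum>b<n. udiag n h' (first_ones k) a b * A b j)"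
        by (intro tendsto_sum tendsto_mult tendsto_udiag[where \<mu>="\<lambda>_. first_ones k"] Bl) (use hl that in auto)
      moreover have "(\<Sum>b<n. udiag n (h (r m)) (first_ones k) a b * B (r m) b j) = B (r m) a j" for m
      proof -
        obtain C where C: "\<forall>a<n. \<forall>j<k. B (r m) a j = (\<Sum>i<k. h (r m) $$ (a, i) * C i j)"
          using exC by blast
        show ?thesis
          by (rule udiag_step_fixes[OF U_pos_imp(1)[OF h] k, where m=k and C=C]) (use C that in simp_all)
      qed
      ultimately have "(\<lambda>m. B (r m) a j) \<longlonglongrightarrow> (\<Sum>b<n. udiag n h' (first_ones k) a b * A b j)" by simp
      then have "(\<Sum>b<n. udiag n h' (first_ones k) a b * A b j) = A a j"
        by (rule LIMSEQ_unique[OF _ Bl[OF that(1)]])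
      then show ?thesis unfolding A_def .
    qed
    have "udiag n h' (first_ones k) i j = udiag n g (first_ones k) i j" if "i < n" "j < n" for i j
      by (rule udiag_step_unique[OF g h' k J(1) J(2)[unfolded v_def] fx that])
    then have "L $$ (i, j) = udiag n h' (\<lambda>l. omega n k $ l) i j" if "i < n" "j < n" for i j
      using Lg that by (simp add: udiag_omega)
    then show ?C
      by (intro orbit_nonnegI[OF L, of "\<lambda>m. h (r m)" h'] h) (use hl in auto)
  qed
qed

lemma ksub_pair_iff:
  "(\<forall>I J. I \<subseteq> {..<n} \<and> J \<subseteq> {..<n} \<and> card I = k \<and> card J = k \<longrightarrow> Q I J) \<longleftrightarrow>
   (\<forall>I\<in>ksub n k. \<forall>J\<in>ksub n k. Q I J)"
  unfolding ksub_def by blast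

theorem theorem1p1:
  fixes n :: nat and lam :: "real vec" and L :: "complex mat"
  assumes lam: "lam \<in> carrier_vec n"
    and decr: "\<forall>i j. i < j \<and> j < n \<longrightarrow> lam $ j \<le> lam $ i"
    and L: "L \<in> carrier_mat n n"
    and orb: "\<i> \<cdot>\<^sub>m L \<in> orbit n lam"
  shows
    "((\<forall>i j. i < j \<and> j < n \<longrightarrow> lam $ j < lam $ i) \<and> (\<forall>i<n. 0 < lam $ i) \<longrightarrow>
        (\<i> \<cdot>\<^sub>m L \<in> orbit_pos n lam \<longleftrightarrow> (\<exists>m>0. L ^\<^sub>m m \<in> GL_pos_complex n)))
     \<and>
     (\<forall>k\<le>n. lam = omega n k \<longrightarrow>
        (\<i> \<cdot>\<^sub>m L \<in> orbit_pos n lam \<longleftrightarrow>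
          (\<forall>I J. I \<subseteq> {..<n} \<and> J \<subseteq> {..<n} \<and> card I = k \<and> card J = k \<longrightarrow>
             minor L I J \<in> \<real> \<and> 0 < Re (minor L I J))) \<and>
        (\<i> \<cdot>\<^sub>m L \<in> orbit_nonneg n lam \<longleftrightarrow>
          (\<forall>I J. I \<subseteq> {..<n} \<and> J \<subseteq> {..<n} \<and> card I = k \<and> card J = k \<longrightarrow>
             minor L I J \<in> \<real> \<and> 0 \<le> Re (minor L I J))))
     \<and>
     ((\<exists>i<n. \<exists>j<n. lam $ i \<noteq> lam $ j) \<and> tridiagonal L \<longrightarrow>
        (\<i> \<cdot>\<^sub>m L \<in> orbit_pos n lam \<longleftrightarrow>
          (\<forall>i<n. \<forall>j<n. L $$ (i, j) \<in> \<real>) \<and>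
          (\<forall>i. i + 1 < n \<longrightarrow> 0 < Re (L $$ (i, i + 1)) \<and> 0 < Re (L $$ (i + 1, i)))) \<and>
        (\<i> \<cdot>\<^sub>m L \<in> orbit_nonneg n lam \<longleftrightarrow>
          (\<forall>i<n. \<forall>j<n. L $$ (i, j) \<in> \<real>) \<and>
          (\<forall>i. i + 1 < n \<longrightarrow> 0 \<le> Re (L $$ (i, i + 1)) \<and> 0 \<le> Re (L $$ (i + 1, i)))))"
proof (rule conjI[OF impI conjI[OF allI[OF impI[OF impI]] impI]])
  assume "(\<forall>i j. i < j \<and> j < n \<longrightarrow> lam $ j < lam $ i) \<and> (\<forall>i<n. 0 < lam $ i)"
  then show "\<i> \<cdot>\<^sub>m L \<in> orbit_pos n lam \<longleftrightarrow> (\<exists>m>0. L ^\<^sub>m m \<in> GL_pos_complex n)"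
    by (intro orbit_pos_iff_eventually_totally_pos[OF L orb]) simp_all
next
  fix k assume k: "k \<le> n" and lk: "lam = omega n k"
  show "(\<i> \<cdot>\<^sub>m L \<in> orbit_pos n lam \<longleftrightarrow>
          (\<forall>I J. I \<subseteq> {..<n} \<and> J \<subseteq> {..<n} \<and> card I = k \<and> card J = k \<longrightarrow>
             minor L I J \<in> \<real> \<and> 0 < Re (minor L I J))) \<and>
        (\<i> \<cdot>\<^sub>m L \<in> orbit_nonneg n lam \<longleftrightarrow>
          (\<forall>I J. I \<subseteq> {..<n} \<and> J \<subseteq> {..<n} \<and> card I = k \<and> card J = k \<longrightarrow>
             minor L I J \<in> \<real> \<and> 0 \<le> Re (minor L I J)))"
    unfolding ksub_pair_iff pos_complex_iff[symmetric] nonneg_complex_iff[symmetric] lk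
    using orbit_omega_iff[OF L orb[unfolded lk] k] by (rule conjI)
next
  assume as: "(\<exists>i<n. \<exists>j<n. lam $ i \<noteq> lam $ j) \<and> tridiagonal L"
  then obtain i0 j0 where ij: "i0 < n" "j0 < n" "lam $ i0 \<noteq> lam $ j0" by blast
  have d: "lam $ j \<le> lam $ i" if "i < j" "j < n" for i j using decr that by blast
  have tr: "tridiagonal L" using as by blast
  show "(\<i> \<cdot>\<^sub>m L \<in> orbit_pos n lam \<longleftrightarrow>
          (\<forall>i<n. \<forall>j<n. L $$ (i, j) \<in> \<real>) \<and>
          (\<forall>i. i + 1 < n \<longrightarrow> 0 < Re (L $$ (i, i + 1)) \<and> 0 < Re (L $$ (i + 1, i)))) \<and>
        (\<i> \<cdot>\<^sub>m L \<in> orbit_nonneg n lam \<longleftrightarrow>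
          (\<forall>i<n. \<forall>j<n. L $$ (i, j) \<in> \<real>) \<and>
          (\<forall>i. i + 1 < n \<longrightarrow> 0 \<le> Re (L $$ (i, i + 1)) \<and> 0 \<le> Re (L $$ (i + 1, i))))"
    by (rule conjI; rule tridiagonal_orbit_iff[OF L orb d ij tr])
qed

end
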